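(* Let $\mathcal{I}$ be a nonzero subspace of $\mathcal{H}^2$ which is shift invariant, i.e. $n^{-s}\mathcal{I}\subseteq\mathcal{I}$ for all $n\in\mathbb{N}$. Then $\mathcal{I}$ has the property $$\Lambda(p)|_{\mathcal{I}}\,\big(\Lambda(q)|_{\mathcal{I}}\big)^*=\big(\Lambda(q)|_{\mathcal{I}}\big)^*\,\Lambda(p)|_{\mathcal{I}}\qquad\text{for all primes }p,q\text{ with }p\neq q$$ if and only if there exists $\varphi\in L^2(0,1)$ such that the associated system of dilations $\{\varphi_n\}_{n\in\mathbb{N}}$, $\varphi_n(x)=\varphi(nx)$, is an orthonormal sequence in $L^2(0,1)$ and $$S^{-1}(\mathcal{I})=\overline{[\varphi_n]},$$ where $\overline{[\varphi_n]}$ denotes the closed linear span of $\{\varphi_n\}_{n\in\mathbb{N}}$ in $L^2(0,1)$.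
   Context: All spaces are over $\mathbb{C}$. $\mathcal{H}^2$ is the Hilbert space of Dirichlet series $\sum_{n\ge1}a_nn^{-s}$ with $\|\sum a_nn^{-s}\|_{\mathcal{H}^2}=(\sum_n|a_n|^2)^{1/2}<\infty$ and inner product $\langle\sum a_nn^{-s},\sum b_nn^{-s}\rangle=\sum a_n\overline{b_n}$. For $n\in\mathbb{N}$, $\Lambda(n)$ is the operator on $\mathcal{H}^2$ of multiplication by $n^{-s}$, i.e. $\Lambda(n)f(s)=n^{-s}f(s)$ for $f\in\mathcal{H}^2$ and $\operatorname{Re}(s)>1/2$. For shift invariant $\mathcal{I}$, $\Lambda(n)|_{\mathcal{I}}$ is the restriction of $\Lambda(n)$ to $\mathcal{I}$, viewed as an operator $\mathcal{I}\to\mathcal{I}$, and $(\Lambda(n)|_{\mathcal{I}})^*$ is the adjoint of this operator on $\mathcal{I}$ with respect to the inner product of $\mathcal{H}^2$. Let $e_n(x)=\sqrt2\sin(\pi nx)$, an orthonormal basis of $L^2(0,1)$; $S:L^2(0,1)\to\mathcal{H}^2$ is the isometric isomorphism $S(\sum c_ne_n)=\sum c_nn^{-s}$. Any $\varphi\in L^2(0,1)$ is regarded as a $2$-periodic odd function on $\mathbb{R}$, so that $\varphi_n(x)=\varphi(nx)$ makes sense on $(0,1)$. *)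

theory Defs
  imports "HOL-Analysis.Analysis" "HOL-Computational_Algebra.Primes"
begin

section \<open>The Hilbert space of Dirichlet series\<close>

text \<open>
  Dirichlet series with square-summable coefficients converge absolutely on the half-plane
  \<open>Re s > 1/2\<close>. We represent them as functions on that half-plane, extended by \<open>0\<close>, so that
  equality of functions on the half-plane is equality in HOL. Coefficients are indexed by
  \<open>n \<ge> 1\<close>; the entry at index \<open>0\<close> plays no role.
\<close>

definition dirichlet_series :: "(nat \<Rightarrow> complex) \<Rightarrow> complex \<Rightarrow> complex" where
  "dirichlet_series a s =
     (if Re s > 1/2 then \<Sum>\<^sub>\<infinity>n\<in>{1..}. a n * of_nat n powr (- s) else 0)"

definition square_summable :: "(nat \<Rightarrow> complex) \<Rightarrow> bool" where
  "square_summable a \<longleftrightarrow> (\<lambda>n. (cmod (a n))\<^sup>2) summable_on {1..}"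

definition H2 :: "(complex \<Rightarrow> complex) set" where
  "H2 = {dirichlet_series a | a. square_summable a}"

text \<open>The coefficient sequence, normalised at the unused index \<open>0\<close> to make it unique.\<close>

definition H2_coeff :: "(complex \<Rightarrow> complex) \<Rightarrow> nat \<Rightarrow> complex" where
  "H2_coeff F = (THE a. a 0 = 0 \<and> square_summable a \<and> F = dirichlet_series a)"

definition H2_inner :: "(complex \<Rightarrow> complex) \<Rightarrow> (complex \<Rightarrow> complex) \<Rightarrow> complex" where
  "H2_inner F G = (\<Sum>\<^sub>\<infinity>n\<in>{1..}. H2_coeff F n * cnj (H2_coeff G n))"

definition H2_norm :: "(complex \<Rightarrow> complex) \<Rightarrow> real" where
  "H2_norm F = sqrt (\<Sum>\<^sub>\<infinity>n\<in>{1..}. (cmod (H2_coeff F n))\<^sup>2)"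

text \<open>Subspaces of a Hilbert space are understood to be closed.\<close>

definition H2_subspace :: "(complex \<Rightarrow> complex) set \<Rightarrow> bool" where
  "H2_subspace I \<longleftrightarrow>
     I \<subseteq> H2 \<and>
     (\<lambda>s. 0) \<in> I \<and>
     (\<forall>F\<in>I. \<forall>G\<in>I. (\<lambda>s. F s + G s) \<in> I) \<and>
     (\<forall>c. \<forall>F\<in>I. (\<lambda>s. c * F s) \<in> I) \<and>
     (\<forall>F\<in>H2. (\<forall>\<epsilon>>0. \<exists>G\<in>I. H2_norm (\<lambda>s. F s - G s) < \<epsilon>) \<longrightarrow> F \<in> I)"

definition \<Lambda> :: "nat \<Rightarrow> (complex \<Rightarrow> complex) \<Rightarrow> complex \<Rightarrow> complex" where
  "\<Lambda> n F = (\<lambda>s. of_nat n powr (- s) * F s)"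

definition shift_invariant :: "(complex \<Rightarrow> complex) set \<Rightarrow> bool" where
  "shift_invariant I \<longleftrightarrow> (\<forall>n\<ge>1. \<Lambda> n ` I \<subseteq> I)"

text \<open>
  The adjoint of an operator \<open>T\<close> from \<open>I\<close> to \<open>I\<close>, with respect to the inner product of \<open>H2\<close>.
  It is well defined by the Riesz representation theorem if \<open>I\<close> is a closed subspace and
  \<open>T\<close> is bounded.
\<close>

definition adjoint_on ::
  "(complex \<Rightarrow> complex) set \<Rightarrow> ((complex \<Rightarrow> complex) \<Rightarrow> complex \<Rightarrow> complex) \<Rightarrow>
   (complex \<Rightarrow> complex) \<Rightarrow> complex \<Rightarrow> complex" where
  "adjoint_on I T =
     (\<lambda>G\<in>I. THE H. H \<in> I \<and> (\<forall>F\<in>I. H2_inner (T F) G = H2_inner F H))"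

section \<open>The space \<open>L\<^sup>2(0,1)\<close>\<close>

text \<open>
  Elements of \<open>L\<^sup>2(0,1)\<close> are represented by (Borel) functions. All notions below respect
  almost-everywhere equality on \<open>(0,1)\<close>, and the sets of functions that occur
  (\<open>S_preimage\<close>, \<open>L2_closed_span\<close>) are closed under it, so equality of such sets is equality of
  the corresponding sets of classes.
\<close>

abbreviation unit_measure :: "real measure" where
  "unit_measure \<equiv> restrict_space lborel {0<..<1}"

definition L2 :: "(real \<Rightarrow> complex) set" where
  "L2 = {f. f \<in> borel_measurable unit_measure \<and>
            integrable unit_measure (\<lambda>x. (cmod (f x))\<^sup>2)}"

definition L2_inner :: "(real \<Rightarrow> complex) \<Rightarrow> (real \<Rightarrow> complex) \<Rightarrow> complex" where
  "L2_inner f g = (LINT x|unit_measure. f x * cnj (g x))"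

definition L2_norm :: "(real \<Rightarrow> complex) \<Rightarrow> real" where
  "L2_norm f = sqrt (LINT x|unit_measure. (cmod (f x))\<^sup>2)"

definition L2_orthonormal :: "(nat \<Rightarrow> real \<Rightarrow> complex) \<Rightarrow> bool" where
  "L2_orthonormal u \<longleftrightarrow>
     (\<forall>n\<ge>1. u n \<in> L2) \<and>
     (\<forall>m\<ge>1. \<forall>n\<ge>1. L2_inner (u m) (u n) = (if m = n then 1 else 0))"

definition L2_closed_span :: "(nat \<Rightarrow> real \<Rightarrow> complex) \<Rightarrow> (real \<Rightarrow> complex) set" where
  "L2_closed_span u =
     {f \<in> L2. \<forall>\<epsilon>>0. \<exists>N c. L2_norm (\<lambda>x. f x - (\<Sum>n=1..N. c n * u n x)) < \<epsilon>}"

text \<open>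
  The 2-periodic odd function that agrees with \<open>\<phi>\<close> on \<open>(0,1)\<close>; the point
  \<open>2 * frac (x / 2)\<close> is the representative of \<open>x\<close> modulo \<open>2\<close> in \<open>[0,2)\<close>. Oddness and
  periodicity force the value \<open>0\<close> at the integers.
\<close>

definition odd_periodic_ext :: "(real \<Rightarrow> complex) \<Rightarrow> real \<Rightarrow> complex" where
  "odd_periodic_ext \<phi> x =
     (let y = 2 * frac (x / 2) in
        if 0 < y \<and> y < 1 then \<phi> y
        else if 1 < y then - \<phi> (2 - y)
        else 0)"

definition dilation :: "(real \<Rightarrow> complex) \<Rightarrow> nat \<Rightarrow> real \<Rightarrow> complex" where
  "dilation \<phi> n x = odd_periodic_ext \<phi> (of_nat n * x)"

section \<open>The isometric isomorphism \<open>S\<close>\<close>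

definition sine_basis :: "nat \<Rightarrow> real \<Rightarrow> complex" where
  "sine_basis n x = of_real (sqrt 2 * sin (pi * of_nat n * x))"

definition sine_expansion :: "(nat \<Rightarrow> complex) \<Rightarrow> (real \<Rightarrow> complex) \<Rightarrow> bool" where
  "sine_expansion c f \<longleftrightarrow>
     (\<lambda>N. L2_norm (\<lambda>x. f x - (\<Sum>n=1..N. c n * sine_basis n x))) \<longlonglongrightarrow> 0"

text \<open>
  \<open>S\<close> sends the sum of \<open>c n * sine_basis n\<close> over \<open>n \<ge> 1\<close>, convergent in \<open>L\<^sup>2(0,1)\<close>, to the
  Dirichlet series with coefficients \<open>c\<close>.
\<close>

definition S :: "(real \<Rightarrow> complex) \<Rightarrow> complex \<Rightarrow> complex" where
  "S f = (THE F. \<exists>c. square_summable c \<and> sine_expansion c f \<and> F = dirichlet_series c)"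

definition S_preimage :: "(complex \<Rightarrow> complex) set \<Rightarrow> (real \<Rightarrow> complex) set" where
  "S_preimage I = {f \<in> L2. S f \<in> I}"

end

theory Submission
  imports Defs
begin

text \<open>
  Everything is transported to square-summable sequences, where \<open>\<Lambda>(n)\<close> and the dilation
  \<open>\<phi> \<mapsto> \<phi>\<^sub>n\<close> both become the isometry moving the entry at \<open>k\<close> to \<open>n k\<close>.

  If the operators doubly commute, every vector in the common kernel of all \<open>(\<Lambda>(p)|\<^sub>I)\<^sup>*\<close> has
  pairwise orthogonal shifts. Such a vector exists in every nonzero reducing subspace: if \<open>k\<close> is the
  least index at which some element of the subspace does not vanish, take the vector representing the
  functional \<open>a \<mapsto> a k\<close>. The closed span of the shifts of such an \<open>f\<close> in \<open>I\<close> is reducing. If it were not all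
  of \<open>I\<close>, its complement would contain another such vector \<open>g\<close>, and the Dirichlet product of \<open>f\<close> and
  \<open>g\<close> would lie in the closed spans of the shifts of \<open>f\<close> and of the shifts of \<open>g\<close>, which are
  orthogonal; but this product is nonzero. Conversely, double commutation is checked by pairing
  with the shifts of \<open>f\<close>.

  Completeness of the sines uses that \<open>sin (n \<pi> x)\<close> is \<open>sin (\<pi> x)\<close> times a polynomial
  in \<open>cos (\<pi> x)\<close>, so that Weierstrass approximation applies.
\<close>

section \<open>Square-integrable functions on a measure space\<close>

text \<open>The Hilbert space facts are proved once, for square-integrable functions on an arbitrary
  measure: counting measure gives the sequences, Lebesgue measure gives the interval. Functions are
  used rather than classes, so \<open>nrm\<close> is only a seminorm on the interval; on sequences
  it is a norm, and equality of vectors is equality of functions. This is one more reason to carry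
  out the operator argument on sequences.

  Double commutation alone makes the shifts of common kernel vectors orthogonal for distinct
  indices. What forces one generator instead of several is that multiplication of Dirichlet series
  is commutative: combining the shifts of f with coefficients g gives the same vector as combining
  the shifts of g with coefficients f. Both series converge in norm because the shifts are
  orthonormal and the coefficients are square-summable. In general the product of two
  square-summable Dirichlet series need not be square-summable, which is why orthonormality of the
  shifts has to be known before the product is formed.\<close>

definition lsq :: "'a measure \<Rightarrow> ('a \<Rightarrow> complex) set" where
  "lsq M = {f \<in> borel_measurable M. integrable M (\<lambda>x. (cmod (f x))\<^sup>2)}"

definition ip :: "'a measure \<Rightarrow> ('a \<Rightarrow> complex) \<Rightarrow> ('a \<Rightarrow> complex) \<Rightarrow> complex" where
  "ip M f g = (LINT x|M. f x * cnj (g x))"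

definition nrm :: "'a measure \<Rightarrow> ('a \<Rightarrow> complex) \<Rightarrow> real" where
  "nrm M f = sqrt (LINT x|M. (cmod (f x))\<^sup>2)"

section \<open>Inner product, norm and completeness\<close>

lemma lsqD: "f \<in> lsq M \<Longrightarrow> f \<in> borel_measurable M"
  "f \<in> lsq M \<Longrightarrow> integrable M (\<lambda>x. (cmod (f x))\<^sup>2)"
  by (auto simp: lsq_def)

lemma lsq_mult_integrable:
  assumes "f \<in> lsq M" "g \<in> lsq M"
  shows "integrable M (\<lambda>x. f x * cnj (g x))"
proof (rule Bochner_Integration.integrable_bound)
  show "integrable M (\<lambda>x. (cmod (f x))\<^sup>2 + (cmod (g x))\<^sup>2)"
    using assms by (auto simp: lsq_def)
  have "(\<lambda>x. cnj (g x)) \<in> borel_measurable M"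
    using assms(2) by (intro borel_measurable_continuous_on[of cnj]) (auto simp: lsq_def continuous_intros)
  then show "(\<lambda>x. f x * cnj (g x)) \<in> borel_measurable M"
    using assms(1) by (auto simp: lsq_def)
  have "a * b \<le> a\<^sup>2 + b\<^sup>2" if "0 \<le> a" "0 \<le> b" for a b :: real
    using sum_squares_bound[of a b] mult_nonneg_nonneg[OF that] by linarith
  then show "AE x in M. norm (f x * cnj (g x)) \<le> norm ((cmod (f x))\<^sup>2 + (cmod (g x))\<^sup>2)"
    by (auto simp: norm_mult)
qed

lemma lsq_zero [simp]: "(\<lambda>x. 0) \<in> lsq M"
  by (simp add: lsq_def)

lemma lsq_scale: "f \<in> lsq M \<Longrightarrow> (\<lambda>x. c * f x) \<in> lsq M"
  by (auto simp: lsq_def norm_mult power_mult_distrib)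

lemma lsq_add:
  assumes "f \<in> lsq M" "g \<in> lsq M"
  shows "(\<lambda>x. f x + g x) \<in> lsq M"
proof -
  have "integrable M (\<lambda>x. (cmod (f x + g x))\<^sup>2)"
  proof (rule Bochner_Integration.integrable_bound)
    show "integrable M (\<lambda>x. 2 * (cmod (f x))\<^sup>2 + 2 * (cmod (g x))\<^sup>2)"
      using assms by (auto simp: lsq_def)
    show "(\<lambda>x. (cmod (f x + g x))\<^sup>2) \<in> borel_measurable M"
      using assms by (auto simp: lsq_def)
    have "(cmod (a + b))\<^sup>2 \<le> 2 * (cmod a)\<^sup>2 + 2 * (cmod b)\<^sup>2" for a b
    proof -
      have "(cmod (a + b))\<^sup>2 \<le> (cmod a + cmod b)\<^sup>2"
        by (intro power_mono norm_triangle_ineq) auto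
      also have "\<dots> \<le> 2 * (cmod a)\<^sup>2 + 2 * (cmod b)\<^sup>2"
        using sum_squares_bound[of "cmod a" "cmod b"] by (simp add: power2_sum)
      finally show ?thesis .
    qed
    then show "AE x in M. norm ((cmod (f x + g x))\<^sup>2) \<le> norm (2 * (cmod (f x))\<^sup>2 + 2 * (cmod (g x))\<^sup>2)"
      by auto
  qed
  then show ?thesis using assms by (auto simp: lsq_def)
qed

lemma lsq_diff: "f \<in> lsq M \<Longrightarrow> g \<in> lsq M \<Longrightarrow> (\<lambda>x. f x - g x) \<in> lsq M"
  using lsq_add[of f M "\<lambda>x. - 1 * g x"] lsq_scale[of g M "-1"] by simp

lemma lsq_sum: "(\<And>i. i \<in> A \<Longrightarrow> u i \<in> lsq M) \<Longrightarrow> (\<lambda>x. \<Sum>i\<in>A. u i x) \<in> lsq M"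
  by (induction A rule: infinite_finite_induct) (auto intro: lsq_add)

lemma lsq_lincomb: "(\<And>i. i \<in> A \<Longrightarrow> u i \<in> lsq M) \<Longrightarrow> (\<lambda>x. \<Sum>i\<in>A. c i * u i x) \<in> lsq M"
  by (intro lsq_sum lsq_scale)

lemma ip_cnj: "ip M g f = cnj (ip M f g)"
  unfolding ip_def Bochner_Integration.integral_cnj[symmetric] by (simp add: mult.commute)

lemma ip_add_left:
  "f \<in> lsq M \<Longrightarrow> g \<in> lsq M \<Longrightarrow> h \<in> lsq M \<Longrightarrow> ip M (\<lambda>x. f x + g x) h = ip M f h + ip M g h"
  unfolding ip_def distrib_right by (intro Bochner_Integration.integral_add lsq_mult_integrable)

lemma ip_diff_left:
  "f \<in> lsq M \<Longrightarrow> g \<in> lsq M \<Longrightarrow> h \<in> lsq M \<Longrightarrow> ip M (\<lambda>x. f x - g x) h = ip M f h - ip M g h"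
  unfolding ip_def left_diff_distrib by (intro Bochner_Integration.integral_diff lsq_mult_integrable)

lemma ip_scale_left: "ip M (\<lambda>x. c * f x) g = c * ip M f g"
  unfolding ip_def by (simp add: mult.assoc)

lemma ip_zero_left [simp]: "ip M (\<lambda>x. 0) g = 0"
  by (simp add: ip_def)

lemma ip_zero_right [simp]: "ip M g (\<lambda>x. 0) = 0"
  by (simp add: ip_def)

lemma ip_add_right:
  assumes "f \<in> lsq M" "g \<in> lsq M" "h \<in> lsq M"
  shows "ip M h (\<lambda>x. f x + g x) = ip M h f + ip M h g"
  unfolding ip_cnj[of M h] ip_add_left[OF assms] by (rule complex_cnj_add)

lemma ip_diff_right:
  assumes "f \<in> lsq M" "g \<in> lsq M" "h \<in> lsq M"
  shows "ip M h (\<lambda>x. f x - g x) = ip M h f - ip M h g"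
  unfolding ip_cnj[of M h] ip_diff_left[OF assms] by (rule complex_cnj_diff)

lemma ip_scale_right: "ip M g (\<lambda>x. c * f x) = cnj c * ip M g f"
  unfolding ip_cnj[of M g] ip_scale_left by (rule complex_cnj_mult)

lemma ip_lincomb_left:
  assumes "g \<in> lsq M" "\<And>i. i \<in> A \<Longrightarrow> u i \<in> lsq M"
  shows "ip M (\<lambda>x. \<Sum>i\<in>A. c i * u i x) g = (\<Sum>i\<in>A. c i * ip M (u i) g)"
  using assms(2)
proof (induction A rule: infinite_finite_induct)
  case (insert a A)
  then have "ip M (\<lambda>x. c a * u a x + (\<Sum>i\<in>A. c i * u i x)) g
      = ip M (\<lambda>x. c a * u a x) g + ip M (\<lambda>x. \<Sum>i\<in>A. c i * u i x) g"
    by (intro ip_add_left lsq_scale lsq_lincomb assms(1)) auto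
  with insert show ?case by (simp add: ip_scale_left)
qed auto

lemma ip_lincomb_right:
  assumes "g \<in> lsq M" "\<And>i. i \<in> A \<Longrightarrow> u i \<in> lsq M"
  shows "ip M g (\<lambda>x. \<Sum>i\<in>A. c i * u i x) = (\<Sum>i\<in>A. cnj (c i) * ip M g (u i))"
proof -
  have "ip M g (\<lambda>x. \<Sum>i\<in>A. c i * u i x) = cnj (ip M (\<lambda>x. \<Sum>i\<in>A. c i * u i x) g)"
    by (rule ip_cnj)
  also have "\<dots> = (\<Sum>i\<in>A. cnj (c i) * ip M g (u i))"
    using assms by (subst ip_lincomb_left) (auto simp: ip_cnj[of M g])
  finally show ?thesis .
qed

lemma nrm_nonneg [simp]: "0 \<le> nrm M f"
  by (simp add: nrm_def)

lemma nrm_zero [simp]: "nrm M (\<lambda>x. 0) = 0"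
  by (simp add: nrm_def)

lemma nrm_sq: "(nrm M f)\<^sup>2 = (LINT x|M. (cmod (f x))\<^sup>2)"
  by (simp add: nrm_def)

lemma ip_self: "ip M f f = of_real ((nrm M f)\<^sup>2)"
  unfolding nrm_sq ip_def complex_norm_square[symmetric] of_real_power[symmetric]
  by (rule integral_complex_of_real)

lemma nrm_sq_ip: "(nrm M f)\<^sup>2 = Re (ip M f f)"
  by (simp add: ip_self)

lemma nrm_scale: "nrm M (\<lambda>x. c * f x) = cmod c * nrm M f"
  by (simp add: nrm_def norm_mult power_mult_distrib real_sqrt_mult)

lemma nrm_minus_commute: "nrm M (\<lambda>x. f x - g x) = nrm M (\<lambda>x. g x - f x)"
  by (simp add: nrm_def norm_minus_commute)

lemma nrm_add_sq:
  assumes "f \<in> lsq M" "g \<in> lsq M"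
  shows "(nrm M (\<lambda>x. f x + g x))\<^sup>2 = (nrm M f)\<^sup>2 + (nrm M g)\<^sup>2 + 2 * Re (ip M f g)"
proof -
  have "ip M (\<lambda>x. f x + g x) (\<lambda>x. f x + g x) = ip M f f + ip M f g + (ip M g f + ip M g g)"
    using assms by (simp add: ip_add_left ip_add_right lsq_add)
  then show ?thesis by (simp add: nrm_sq_ip ip_cnj[of _ g f])
qed

lemma nrm_diff_sq:
  assumes "f \<in> lsq M" "g \<in> lsq M"
  shows "(nrm M (\<lambda>x. f x - g x))\<^sup>2 = (nrm M f)\<^sup>2 + (nrm M g)\<^sup>2 - 2 * Re (ip M f g)"
  using nrm_add_sq[OF assms(1) lsq_scale[OF assms(2), of "-1"]]
  by (simp only: nrm_scale ip_scale_right) simp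

text \<open>Evaluate at the minimum \<open>t = r / b\<close>. If \<open>b = 0\<close> the expression
  is affine in \<open>t\<close>, and the choice \<open>(a + 1) / (2 * r)\<close> would give it the
  value -1. Besides Cauchy-Schwarz this serves the representation theorem, where
  \<open>a = 0\<close> forces \<open>r = 0\<close>.\<close>

lemma quadratic_nonneg_imp_discriminant:
  fixes a b r :: real
  assumes nonneg: "\<And>t. 0 \<le> a - 2 * t * r + t\<^sup>2 * b" and "0 \<le> b"
  shows "r\<^sup>2 \<le> a * b"
proof (cases "b = 0")
  case True
  have "r = 0"
  proof (rule ccontr)
    assume "r \<noteq> 0"
    then show False using nonneg[of "(a + 1) / (2 * r)"] True by simp
  qed
  with True show ?thesis by simp
next
  case False
  with \<open>0 \<le> b\<close> have b: "b > 0" by simp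
  have "a - 2 * (r / b) * r + (r / b)\<^sup>2 * b = a - r\<^sup>2 / b"
    using b by (simp add: power2_eq_square field_simps)
  with nonneg[of "r / b"] have "r\<^sup>2 / b \<le> a" by simp
  then show ?thesis using b by (simp add: field_simps)
qed

lemma Cauchy_Schwarz_lsq:
  assumes "f \<in> lsq M" "g \<in> lsq M"
  shows "cmod (ip M f g) \<le> nrm M f * nrm M g"
proof -
  have real_case: "Re (ip M f g) \<le> nrm M f * nrm M g" if f: "f \<in> lsq M" for f
  proof -
    have "0 \<le> (nrm M f)\<^sup>2 - 2 * t * Re (ip M f g) + t\<^sup>2 * (nrm M g)\<^sup>2" for t :: real
    proof -
      have "0 \<le> (nrm M (\<lambda>x. f x - of_real t * g x))\<^sup>2" by simp
      also have "\<dots> = (nrm M f)\<^sup>2 - 2 * t * Re (ip M f g) + t\<^sup>2 * (nrm M g)\<^sup>2"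
        unfolding nrm_diff_sq[OF f lsq_scale[OF assms(2)]] nrm_scale ip_scale_right
        by (simp add: power_mult_distrib)
      finally show ?thesis .
    qed
    then have "(Re (ip M f g))\<^sup>2 \<le> (nrm M f)\<^sup>2 * (nrm M g)\<^sup>2"
      by (rule quadratic_nonneg_imp_discriminant) simp
    then have "(Re (ip M f g))\<^sup>2 \<le> (nrm M f * nrm M g)\<^sup>2"
      by (simp add: power_mult_distrib)
    then show ?thesis by (rule power2_le_imp_le) simp
  qed
  show ?thesis
  proof (cases "ip M f g = 0")
    case False
    \<comment> \<open>The discriminant only bounds the real part. Multiplying \<open>f\<close> by
      the unimodular \<open>w\<close> turns the inner product into its modulus and leaves the norm
      of \<open>f\<close> unchanged.\<close>
    define w where "w = cnj (sgn (ip M f g))"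
    have w: "cmod w = 1" using False by (simp add: w_def norm_sgn)
    have "w * ip M f g = of_real (cmod (ip M f g))"
      using False unfolding w_def sgn_eq
      by (simp add: field_simps complex_norm_square[symmetric] power2_eq_square)
    then show ?thesis
      using real_case[OF lsq_scale[OF assms(1), of w]] w
      by (simp add: ip_scale_left nrm_scale)
  qed simp
qed

lemma nrm_triangle:
  assumes "f \<in> lsq M" "g \<in> lsq M"
  shows "nrm M (\<lambda>x. f x + g x) \<le> nrm M f + nrm M g"
proof (rule power2_le_imp_le)
  have "Re (ip M f g) \<le> nrm M f * nrm M g"
    using Cauchy_Schwarz_lsq[OF assms] complex_Re_le_cmod[of "ip M f g"] by linarith
  then show "(nrm M (\<lambda>x. f x + g x))\<^sup>2 \<le> (nrm M f + nrm M g)\<^sup>2"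
    by (simp add: nrm_add_sq[OF assms] power2_sum)
qed (simp add: add_nonneg_nonneg)

lemma nrm_triangle_diff:
  assumes "f \<in> lsq M" "g \<in> lsq M" "h \<in> lsq M"
  shows "nrm M (\<lambda>x. f x - h x) \<le> nrm M (\<lambda>x. f x - g x) + nrm M (\<lambda>x. g x - h x)"
  using nrm_triangle[OF lsq_diff[OF assms(1,2)] lsq_diff[OF assms(2,3)]] by simp

lemma nrm_cong_AE:
  assumes "f \<in> borel_measurable M" "g \<in> borel_measurable M" "AE x in M. f x = g x"
  shows "nrm M f = nrm M g"
proof -
  have "(LINT x|M. (cmod (f x))\<^sup>2) = (LINT x|M. (cmod (g x))\<^sup>2)"
    by (rule integral_cong_AE) (use assms in auto)
  then show ?thesis by (simp add: nrm_def)
qed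

lemma ip_tendsto_left:
  assumes "f \<in> lsq M" "g \<in> lsq M" "\<And>n. s n \<in> lsq M"
    and "(\<lambda>n. nrm M (\<lambda>x. f x - s n x)) \<longlonglongrightarrow> 0"
  shows "(\<lambda>n. ip M (s n) g) \<longlonglongrightarrow> ip M f g"
proof -
  have "(\<lambda>n. ip M f g - ip M (s n) g) \<longlonglongrightarrow> 0"
  proof (rule Lim_null_comparison)
    show "(\<lambda>n. nrm M (\<lambda>x. f x - s n x) * nrm M g) \<longlonglongrightarrow> 0"
      using tendsto_mult_right[OF assms(4), of "nrm M g"] by simp
    show "\<forall>\<^sub>F n in sequentially. norm (ip M f g - ip M (s n) g) \<le> nrm M (\<lambda>x. f x - s n x) * nrm M g"
      using assms by (auto simp flip: ip_diff_left intro!: always_eventually Cauchy_Schwarz_lsq lsq_diff)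
  qed
  from tendsto_diff[OF tendsto_const[of "ip M f g"] this] show ?thesis by simp
qed

lemma ip_tendsto_right:
  assumes "f \<in> lsq M" "g \<in> lsq M" "\<And>n. s n \<in> lsq M"
    and "(\<lambda>n. nrm M (\<lambda>x. f x - s n x)) \<longlonglongrightarrow> 0"
  shows "(\<lambda>n. ip M g (s n)) \<longlonglongrightarrow> ip M g f"
  using tendsto_cnj[OF ip_tendsto_left[OF assms]] by (simp flip: ip_cnj)

lemma nrm_tendsto:
  assumes "f \<in> lsq M" "\<And>n. s n \<in> lsq M" "(\<lambda>n. nrm M (\<lambda>x. f x - s n x)) \<longlonglongrightarrow> 0"
  shows "(\<lambda>n. nrm M (s n)) \<longlonglongrightarrow> nrm M f"
proof -
  have "(\<lambda>n. nrm M (s n) - nrm M f) \<longlonglongrightarrow> 0"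
  proof (rule Lim_null_comparison[OF _ assms(3)])
    have "\<bar>nrm M (s n) - nrm M f\<bar> \<le> nrm M (\<lambda>x. f x - s n x)" for n
      using nrm_triangle[OF lsq_diff[OF assms(1,2)] assms(2), of n n]
        nrm_triangle[OF lsq_diff[OF assms(2,1)] assms(1), of n]
        nrm_minus_commute[of M f "s n"] by (simp add: abs_le_iff)
    then show "\<forall>\<^sub>F n in sequentially. norm (nrm M (s n) - nrm M f) \<le> nrm M (\<lambda>x. f x - s n x)"
      by simp
  qed
  from tendsto_add[OF this tendsto_const[of "nrm M f"]] show ?thesis by simp
qed

text \<open>The Riesz-Fischer argument: a rapidly Cauchy selection converges almost everywhere
  because the weighted sum of its squared increments has finite integral; Fatou's lemma bounds the
  distance to the limit, and the Cauchy property carries the convergence back to the whole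
  sequence.\<close>

lemma lsq_complete:
  assumes s: "\<And>n. s n \<in> lsq M"
    and Cauchy: "\<And>e. e > 0 \<Longrightarrow> \<exists>N. \<forall>m\<ge>N. \<forall>n\<ge>N. nrm M (\<lambda>x. s m x - s n x) < e"
  shows "\<exists>f\<in>lsq M. (\<lambda>n. nrm M (\<lambda>x. f x - s n x)) \<longlonglongrightarrow> 0"
proof -
  have "\<forall>k. \<exists>N. \<forall>m\<ge>N. \<forall>n\<ge>N. nrm M (\<lambda>x. s m x - s n x) < (1/4::real)^k"
    using Cauchy by simp
  then obtain R where R: "\<And>k m n. m \<ge> R k \<Longrightarrow> n \<ge> R k \<Longrightarrow> nrm M (\<lambda>x. s m x - s n x) < (1/4::real)^k"
    by metis
  define r where "r k = (\<Sum>j\<le>k. R j)" for k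
  have r: "R k \<le> r l" if "k \<le> l" for k l
    unfolding r_def by (rule member_le_sum) (use that in auto)
  define h where "h k = s (r k)" for k
  have h [measurable]: "h k \<in> borel_measurable M" and hl: "h k \<in> lsq M" for k
    using s lsqD(1) by (auto simp: h_def)
  have hdiff: "(nrm M (\<lambda>x. h l x - h k x))\<^sup>2 \<le> (1/16)^k" if "k \<le> l" for k l
  proof -
    have "nrm M (\<lambda>x. h l x - h k x) \<le> (1/4)^k"
      unfolding h_def using R[OF r[OF that] r[of k k]] by simp
    then have "(nrm M (\<lambda>x. h l x - h k x))\<^sup>2 \<le> ((1/4)^k)\<^sup>2"
      by (rule power_mono) simp
    also have "\<dots> = (1/16)^k"
      by (simp add: power2_eq_square flip: power_mult_distrib)
    finally show ?thesis .
  qed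
  have nn: "(\<integral>\<^sup>+x. ennreal ((cmod (h l x - h k x))\<^sup>2) \<partial>M) \<le> ennreal ((1/16)^k)" if "k \<le> l" for k l
  proof -
    have "(\<integral>\<^sup>+x. ennreal ((cmod (h l x - h k x))\<^sup>2) \<partial>M) = ennreal ((nrm M (\<lambda>x. h l x - h k x))\<^sup>2)"
      unfolding nrm_sq by (rule nn_integral_eq_integral) (use lsqD(2)[OF lsq_diff[OF hl hl]] in auto)
    also have "\<dots> \<le> ennreal ((1/16)^k)"
      using hdiff[OF that] by (rule ennreal_leI)
    finally show ?thesis .
  qed
  \<comment> \<open>The weight \<open>4^k\<close> is a compromise: against increments of squared
    norm at most \<open>(1/16)^k\<close> it still leaves a convergent geometric series, and a finite
    weighted sum \<open>C\<close> forces the pointwise increments below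
    \<open>sqrt C * (1/2)^k\<close>.\<close>
  have "(\<integral>\<^sup>+x. (\<Sum>k. ennreal (4^k * (cmod (h (Suc k) x - h k x))\<^sup>2)) \<partial>M)
      = (\<Sum>k. \<integral>\<^sup>+x. ennreal (4^k * (cmod (h (Suc k) x - h k x))\<^sup>2) \<partial>M)"
    by (rule nn_integral_suminf) simp
  also have "\<dots> \<le> (\<Sum>k. ennreal ((1/4)^k))"
  proof (intro suminf_le summableI)
    fix k
    have "(\<integral>\<^sup>+x. ennreal (4^k * (cmod (h (Suc k) x - h k x))\<^sup>2) \<partial>M)
        = ennreal (4^k) * (\<integral>\<^sup>+x. ennreal ((cmod (h (Suc k) x - h k x))\<^sup>2) \<partial>M)"
      by (subst nn_integral_cmult[symmetric]) (auto simp: ennreal_mult)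
    also have "\<dots> \<le> ennreal (4^k) * ennreal ((1/16)^k)"
      by (intro mult_left_mono nn) auto
    also have "\<dots> = ennreal ((1/4)^k)"
      by (simp flip: ennreal_mult power_mult_distrib)
    finally show "(\<integral>\<^sup>+x. ennreal (4^k * (cmod (h (Suc k) x - h k x))\<^sup>2) \<partial>M) \<le> ennreal ((1/4)^k)" .
  qed
  also have "\<dots> < \<infinity>"
    by (subst suminf_ennreal2) (auto intro: summable_geometric)
  finally have "AE x in M. (\<Sum>k. ennreal (4^k * (cmod (h (Suc k) x - h k x))\<^sup>2)) \<noteq> \<infinity>"
    by (intro nn_integral_PInf_AE) auto
  then have conv: "AE x in M. convergent (\<lambda>k. h k x)"
  proof eventually_elim
    case (elim x)
    define C where "C = enn2real (\<Sum>k. ennreal (4^k * (cmod (h (Suc k) x - h k x))\<^sup>2))"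
    have C: "(\<Sum>k. ennreal (4^k * (cmod (h (Suc k) x - h k x))\<^sup>2)) = ennreal C" "0 \<le> C"
      unfolding C_def using elim by (simp_all only: ennreal_enn2real less_top infinity_ennreal_def enn2real_nonneg)
    have ennreal_le_suminf: "F k \<le> (\<Sum>k. F k)" for F :: "nat \<Rightarrow> ennreal" and k
      using sum_le_suminf[OF summableI, of "{k}" F] by simp
    have bound: "cmod (h (Suc k) x - h k x) \<le> sqrt C * (1/2)^k" for k
    proof -
      have "ennreal (4^k * (cmod (h (Suc k) x - h k x))\<^sup>2) \<le> ennreal C"
        unfolding C(1)[symmetric] by (rule ennreal_le_suminf)
      then have "4^k * (cmod (h (Suc k) x - h k x))\<^sup>2 \<le> C"
        using C(2) by (simp only: ennreal_le_iff)
      moreover have "4^k * (cmod (h (Suc k) x - h k x))\<^sup>2 = (2^k * cmod (h (Suc k) x - h k x))\<^sup>2"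
      proof -
        have "(4::real)^k = 2^k * 2^k" by (simp flip: power_mult_distrib)
        then show ?thesis by (simp add: power2_eq_square)
      qed
      ultimately have "2^k * cmod (h (Suc k) x - h k x) \<le> sqrt C"
        by (simp add: real_le_rsqrt)
      then show ?thesis by (simp add: field_simps)
    qed
    have "summable (\<lambda>k. h (Suc k) x - h k x)"
      by (rule summable_comparison_test'[OF summable_mult[OF summable_geometric[of "1/2::real"]]])
        (use bound in auto)
    then have "convergent (\<lambda>n. \<Sum>k<n. h (Suc k) x - h k x)"
      by (simp add: summable_iff_convergent)
    then have "convergent (\<lambda>n. h n x - h 0 x)"
      by (simp add: sum_lessThan_telescope[of "\<lambda>k. h k x"])
    from convergent_add[OF this convergent_const[of "h 0 x"]] show ?case by simp
  qed
  \<comment> \<open>On the null set where the sequence diverges \<open>lim\<close> has an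
    unspecified value; measurability holds all the same, and integrals do not see the set.\<close>
  define f where "f x = lim (\<lambda>k. h k x)" for x
  have f [measurable]: "f \<in> borel_measurable M"
    unfolding f_def by (rule borel_measurable_lim_metric) simp
  have fnn: "(\<integral>\<^sup>+x. ennreal ((cmod (f x - h k x))\<^sup>2) \<partial>M) \<le> ennreal ((1/16)^k)" for k
  proof -
    have "(\<integral>\<^sup>+x. ennreal ((cmod (f x - h k x))\<^sup>2) \<partial>M)
        = (\<integral>\<^sup>+x. liminf (\<lambda>l. ennreal ((cmod (h l x - h k x))\<^sup>2)) \<partial>M)"
    proof (rule nn_integral_cong_AE)
      show "AE x in M. ennreal ((cmod (f x - h k x))\<^sup>2) = liminf (\<lambda>l. ennreal ((cmod (h l x - h k x))\<^sup>2))"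
        using conv
      proof eventually_elim
        case (elim x)
        then have "(\<lambda>l. h l x) \<longlonglongrightarrow> f x"
          by (simp add: f_def convergent_LIMSEQ_iff)
        then have "(\<lambda>l. ennreal ((cmod (h l x - h k x))\<^sup>2)) \<longlonglongrightarrow> ennreal ((cmod (f x - h k x))\<^sup>2)"
          by (intro tendsto_ennrealI tendsto_intros)
        then show ?case by (rule lim_imp_Liminf[OF sequentially_bot, symmetric])
      qed
    qed
    also have "\<dots> \<le> liminf (\<lambda>l. \<integral>\<^sup>+x. ennreal ((cmod (h l x - h k x))\<^sup>2) \<partial>M)"
      by (rule nn_integral_liminf) simp
    also have "\<dots> \<le> liminf (\<lambda>l::nat. ennreal ((1/16)^k))"
      by (rule Liminf_mono) (use nn in \<open>auto intro!: eventually_sequentiallyI[of k]\<close>)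
    finally show ?thesis by (simp add: Liminf_const)
  qed
  have fh: "(\<lambda>x. f x - h k x) \<in> lsq M" for k
  proof -
    have "integrable M (\<lambda>x. (cmod (f x - h k x))\<^sup>2)"
    proof (rule integrableI_bounded)
      have "(\<integral>\<^sup>+x. ennreal ((cmod (f x - h k x))\<^sup>2) \<partial>M) < \<infinity>"
        using fnn[of k] by (rule le_less_trans) (simp add: less_top)
      then show "(\<integral>\<^sup>+x. ennreal (norm ((cmod (f x - h k x))\<^sup>2)) \<partial>M) < \<infinity>" by simp
    qed simp
    then show ?thesis by (simp add: lsq_def)
  qed
  have "f \<in> lsq M"
    using lsq_add[OF fh[of 0] hl[of 0]] by simp
  have fh_nrm: "nrm M (\<lambda>x. f x - h k x) \<le> (1/4)^k" for k
  proof (rule power2_le_imp_le)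
    have "ennreal ((nrm M (\<lambda>x. f x - h k x))\<^sup>2) \<le> ennreal ((1/16)^k)"
      unfolding nrm_sq using fnn[of k]
      by (subst nn_integral_eq_integral[symmetric]) (use lsqD(2)[OF fh] in auto)
    then have "(nrm M (\<lambda>x. f x - h k x))\<^sup>2 \<le> (1/16)^k" by simp
    also have "(1/16)^k = ((1/4::real)^k)\<^sup>2"
      by (simp add: power2_eq_square flip: power_mult_distrib)
    finally show "(nrm M (\<lambda>x. f x - h k x))\<^sup>2 \<le> ((1/4)^k)\<^sup>2" .
  qed simp
  have "(\<lambda>n. nrm M (\<lambda>x. f x - s n x)) \<longlonglongrightarrow> 0"
  proof (rule LIMSEQ_I)
    fix e :: real assume "e > 0"
    then obtain k where k: "(1/4::real)^k < e / 2"
      using real_arch_pow_inv[of "e/2" "1/4"] by auto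
    show "\<exists>n0. \<forall>n\<ge>n0. norm (nrm M (\<lambda>x. f x - s n x) - 0) < e"
    proof (intro exI allI impI)
      fix n assume "n \<ge> R k"
      then have "nrm M (\<lambda>x. h k x - s n x) < (1/4)^k"
        unfolding h_def using R[OF r[of k k]] by simp
      then show "norm (nrm M (\<lambda>x. f x - s n x) - 0) < e"
        using nrm_triangle_diff[OF \<open>f \<in> lsq M\<close> hl[of k] s[of n]] fh_nrm[of k] k by simp
    qed
  qed
  with \<open>f \<in> lsq M\<close> show ?thesis by blast
qed

section \<open>Closed subspaces and the representation of bounded functionals\<close>

definition closed_subspace :: "'a measure \<Rightarrow> ('a \<Rightarrow> complex) set \<Rightarrow> bool" where
  "closed_subspace M K \<longleftrightarrow> K \<subseteq> lsq M \<and> (\<lambda>x. 0) \<in> K \<and>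
     (\<forall>f\<in>K. \<forall>g\<in>K. (\<lambda>x. f x + g x) \<in> K) \<and> (\<forall>c. \<forall>f\<in>K. (\<lambda>x. c * f x) \<in> K) \<and>
     (\<forall>f\<in>lsq M. (\<forall>\<epsilon>>0. \<exists>g\<in>K. nrm M (\<lambda>x. f x - g x) < \<epsilon>) \<longrightarrow> f \<in> K)"

context
  fixes M :: "'a measure" and K
  assumes K: "closed_subspace M K"
begin

lemma closed_subspace_lsq: "f \<in> K \<Longrightarrow> f \<in> lsq M"
  and closed_subspace_zero: "(\<lambda>x. 0) \<in> K"
  and closed_subspace_add: "f \<in> K \<Longrightarrow> g \<in> K \<Longrightarrow> (\<lambda>x. f x + g x) \<in> K"
  and closed_subspace_scale: "f \<in> K \<Longrightarrow> (\<lambda>x. c * f x) \<in> K"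
  using K by (auto simp: closed_subspace_def)

lemma closed_subspace_diff: "f \<in> K \<Longrightarrow> g \<in> K \<Longrightarrow> (\<lambda>x. f x - g x) \<in> K"
  using closed_subspace_add[of f "\<lambda>x. -1 * g x"] closed_subspace_scale[of g "-1"] by simp

lemma closed_subspace_lincomb: "(\<And>i. i \<in> A \<Longrightarrow> u i \<in> K) \<Longrightarrow> (\<lambda>x. \<Sum>i\<in>A. c i * u i x) \<in> K"
proof (induction A rule: infinite_finite_induct)
  case (insert a A)
  then show ?case
    using closed_subspace_add[OF closed_subspace_scale[of "u a" "c a"]] by simp
qed (simp_all add: closed_subspace_zero)

lemma closed_subspace_limit:
  assumes "f \<in> lsq M" "\<And>n. s n \<in> K" "(\<lambda>n. nrm M (\<lambda>x. f x - s n x)) \<longlonglongrightarrow> 0"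
  shows "f \<in> K"
proof -
  have "\<exists>g\<in>K. nrm M (\<lambda>x. f x - g x) < \<epsilon>" if "\<epsilon> > 0" for \<epsilon>
    using LIMSEQ_D[OF assms(3) that] assms(2) by auto
  with K assms(1) show ?thesis by (auto simp: closed_subspace_def)
qed

text \<open>The representing vector minimises \<open>\<parallel>f\<parallel>\<^sup>2 - 2 Re (L f)\<close>; a minimising sequence is Cauchy by
  the parallelogram law.\<close>

lemma Riesz_representation:
  assumes L_add: "\<And>f g. f \<in> K \<Longrightarrow> g \<in> K \<Longrightarrow> L (\<lambda>x. f x + g x) = L f + L g"
    and L_scale: "\<And>c f. f \<in> K \<Longrightarrow> L (\<lambda>x. c * f x) = c * L f"
    and L_bound: "\<And>f. f \<in> K \<Longrightarrow> cmod (L f) \<le> C * nrm M f"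
  shows "\<exists>h\<in>K. \<forall>f\<in>K. L f = ip M f h"
proof -
  note [simp] = closed_subspace_lsq closed_subspace_add closed_subspace_scale
  define Q where "Q f = (nrm M f)\<^sup>2 - 2 * Re (L f)" for f
  \<comment> \<open>Completing the square: \<open>Q f\<close> is at least
    \<open>(nrm M f - C)\<^sup>2 - C\<^sup>2\<close>.\<close>
  have "- (C\<^sup>2) \<le> Q f" if "f \<in> K" for f
  proof -
    have "Re (L f) \<le> C * nrm M f"
      using L_bound[OF that] complex_Re_le_cmod[of "L f"] by linarith
    moreover have "0 \<le> (nrm M f - C)\<^sup>2" by simp
    ultimately show ?thesis by (simp add: Q_def power2_diff mult.commute)
  qed
  then have bdd: "bdd_below (Q ` K)" by (intro bdd_belowI2)
  define m where "m = (INF f\<in>K. Q f)"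
  have m: "m \<le> Q f" if "f \<in> K" for f
    unfolding m_def by (rule cINF_lower[OF bdd that])
  have "\<exists>f\<in>K. Q f < m + 1 / real (Suc n)" for n
    using cINF_less_iff[of K Q "m + 1 / real (Suc n)"] bdd closed_subspace_zero
    by (auto simp: m_def)
  then obtain s where s: "\<And>n. s n \<in> K" "\<And>n. Q (s n) < m + 1 / real (Suc n)"
    by metis
  \<comment> \<open>For the midpoint \<open>u\<close> of \<open>f\<close> and \<open>g\<close> the
    parallelogram law reads \<open>2 * Q f + 2 * Q g - 4 * Q u = (nrm M (\<lambda>x. f x - g
    x))\<^sup>2\<close>, because the linear part of \<open>Q\<close> cancels.\<close>
  have par: "(nrm M (\<lambda>x. f x - g x))\<^sup>2 \<le> 2 * Q f + 2 * Q g - 4 * m" if "f \<in> K" "g \<in> K" for f g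
  proof -
    have "m \<le> Q (\<lambda>x. (1/2) * (f x + g x))"
      using that by (intro m closed_subspace_add closed_subspace_scale)
    moreover have "Re (L (\<lambda>x. (1/2) * (f x + g x))) = (Re (L f) + Re (L g)) / 2"
      unfolding L_scale[OF closed_subspace_add[OF that]] L_add[OF that] by simp
    moreover have "(nrm M (\<lambda>x. (1/2) * (f x + g x)))\<^sup>2 = (nrm M (\<lambda>x. f x + g x))\<^sup>2 / 4"
      unfolding nrm_scale by (simp add: power_mult_distrib power_divide)
    moreover have "f \<in> lsq M" "g \<in> lsq M" using that by auto
    ultimately show ?thesis
      by (simp add: Q_def nrm_add_sq nrm_diff_sq)
  qed
  have "\<exists>h\<in>lsq M. (\<lambda>n. nrm M (\<lambda>x. h x - s n x)) \<longlonglongrightarrow> 0"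
  proof (rule lsq_complete)
    fix e :: real assume e: "e > 0"
    then obtain N where N: "1 / real (Suc N) < e\<^sup>2 / 4"
      using reals_Archimedean[of "e\<^sup>2 / 4"] by (auto simp: inverse_eq_divide)
    show "\<exists>N. \<forall>i\<ge>N. \<forall>j\<ge>N. nrm M (\<lambda>x. s i x - s j x) < e"
    proof (intro exI allI impI)
      fix i j assume "i \<ge> N" "j \<ge> N"
      then have "1 / real (Suc i) \<le> 1 / real (Suc N)" "1 / real (Suc j) \<le> 1 / real (Suc N)"
        by (auto intro!: divide_left_mono)
      then have "(nrm M (\<lambda>x. s i x - s j x))\<^sup>2 < e\<^sup>2"
        using par[OF s(1) s(1), of i j] s(2)[of i] s(2)[of j] N by linarith
      then show "nrm M (\<lambda>x. s i x - s j x) < e"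
        by (rule power2_less_imp_less) (use e in simp)
    qed
  qed (use s in auto)
  then obtain h where h: "h \<in> lsq M" "(\<lambda>n. nrm M (\<lambda>x. h x - s n x)) \<longlonglongrightarrow> 0" by blast
  have hK: "h \<in> K" using closed_subspace_limit[OF h(1) s(1) h(2)] .
  have L_diff: "L (\<lambda>x. f x - g x) = L f - L g" if "f \<in> K" "g \<in> K" for f g
    using L_add[OF that(1) closed_subspace_scale[OF that(2), of "-1"]] L_scale[OF that(2), of "-1"] by simp
  have "(\<lambda>n. L h - L (s n)) \<longlonglongrightarrow> 0"
  proof (rule Lim_null_comparison)
    show "(\<lambda>n. C * nrm M (\<lambda>x. h x - s n x)) \<longlonglongrightarrow> 0"
      using tendsto_mult_left[OF h(2), of C] by simp
    show "\<forall>\<^sub>F n in sequentially. norm (L h - L (s n)) \<le> C * nrm M (\<lambda>x. h x - s n x)"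
      by (simp add: L_diff[OF hK s(1), symmetric] L_bound closed_subspace_diff hK s(1))
  qed
  from tendsto_diff[OF tendsto_const[of "L h"] this] have "(\<lambda>n. L (s n)) \<longlonglongrightarrow> L h" by simp
  moreover have "(\<lambda>n. nrm M (s n)) \<longlonglongrightarrow> nrm M h"
    by (rule nrm_tendsto) (use h s in auto)
  ultimately have "(\<lambda>n. Q (s n)) \<longlonglongrightarrow> Q h"
    unfolding Q_def by (intro tendsto_intros)
  moreover have "(\<lambda>n. m + 1 / real (Suc n)) \<longlonglongrightarrow> m + 0"
    using LIMSEQ_inverse_real_of_nat by (intro tendsto_intros) (simp add: inverse_eq_divide)
  ultimately have "Q h \<le> m"
    using s(2) by (intro LIMSEQ_le[of "\<lambda>n. Q (s n)" _ "\<lambda>n. m + 1 / real (Suc n)"]) (auto intro: less_imp_le)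
  \<comment> \<open>First variation: moving from the minimiser \<open>h\<close> in the direction
    \<open>f\<close> gives a quadratic polynomial in \<open>t\<close> that is nonnegative and has no
    constant term, so its linear coefficient vanishes.\<close>
  have Re_eq: "Re (L f) = Re (ip M f h)" if f: "f \<in> K" for f
  proof -
    have "0 \<le> 0 - 2 * t * (Re (L f) - Re (ip M h f)) + t\<^sup>2 * (nrm M f)\<^sup>2" for t :: real
    proof -
      have tf: "(\<lambda>x. of_real t * f x) \<in> K" using f by simp
      have "Q h \<le> Q (\<lambda>x. h x + of_real t * f x)"
        using m[OF closed_subspace_add[OF hK tf]] \<open>Q h \<le> m\<close> by linarith
      also have "\<dots> = (nrm M h)\<^sup>2 + t\<^sup>2 * (nrm M f)\<^sup>2 + 2 * t * Re (ip M h f) - 2 * (Re (L h) + t * Re (L f))"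
        unfolding Q_def nrm_add_sq[OF h(1) closed_subspace_lsq[OF tf]] nrm_scale ip_scale_right
          L_add[OF hK tf] L_scale[OF f]
        by (simp add: power_mult_distrib)
      finally show ?thesis by (simp add: Q_def algebra_simps)
    qed
    then have "(Re (L f) - Re (ip M h f))\<^sup>2 \<le> 0 * (nrm M f)\<^sup>2"
      by (rule quadratic_nonneg_imp_discriminant) simp
    then show ?thesis by (simp add: ip_cnj[of M f h])
  qed
  have "L f = ip M f h" if f: "f \<in> K" for f
  proof (rule complex_eqI)
    show "Re (L f) = Re (ip M f h)" by (rule Re_eq[OF f])
    show "Im (L f) = Im (ip M f h)"
      using Re_eq[OF closed_subspace_scale[OF f, of \<i>]] by (simp add: L_scale[OF f] ip_scale_left)
  qed
  with hK show ?thesis by blast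
qed

end

section \<open>Orthonormal sequences: series, Bessel's inequality, projection\<close>

definition orthonormal :: "'a measure \<Rightarrow> (nat \<Rightarrow> 'a \<Rightarrow> complex) \<Rightarrow> bool" where
  "orthonormal M u \<longleftrightarrow> (\<forall>n\<ge>1. u n \<in> lsq M) \<and>
     (\<forall>m\<ge>1. \<forall>n\<ge>1. ip M (u m) (u n) = (if m = n then 1 else 0))"

context
  fixes M :: "'a measure" and u
  assumes u: "orthonormal M u"
begin

lemma orthonormal_lsq: "n \<ge> 1 \<Longrightarrow> u n \<in> lsq M"
  and orthonormal_ip: "m \<ge> 1 \<Longrightarrow> n \<ge> 1 \<Longrightarrow> ip M (u m) (u n) = (if m = n then 1 else 0)"
  using u by (auto simp: orthonormal_def)

lemma orthonormal_lincomb_ip: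
  assumes "finite A" "A \<subseteq> {1..}" "m \<ge> 1"
  shows "ip M (\<lambda>x. \<Sum>i\<in>A. c i * u i x) (u m) = (if m \<in> A then c m else 0)"
proof -
  have "ip M (\<lambda>x. \<Sum>i\<in>A. c i * u i x) (u m) = (\<Sum>i\<in>A. c i * ip M (u i) (u m))"
    using assms by (intro ip_lincomb_left orthonormal_lsq) auto
  also have "\<dots> = (\<Sum>i\<in>A. if i = m then c m else 0)"
    using assms by (intro sum.cong) (auto simp: orthonormal_ip Suc_le_eq subset_iff)
  finally show ?thesis using assms by simp
qed

lemma orthonormal_lincomb_nrm:
  assumes "finite A" "A \<subseteq> {1..}"
  shows "(nrm M (\<lambda>x. \<Sum>i\<in>A. c i * u i x))\<^sup>2 = (\<Sum>i\<in>A. (cmod (c i))\<^sup>2)"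
proof -
  have "ip M (\<lambda>x. \<Sum>i\<in>A. c i * u i x) (\<lambda>x. \<Sum>i\<in>A. c i * u i x)
      = (\<Sum>j\<in>A. cnj (c j) * ip M (\<lambda>x. \<Sum>i\<in>A. c i * u i x) (u j))"
    using assms by (intro ip_lincomb_right lsq_lincomb orthonormal_lsq) auto
  also have "\<dots> = (\<Sum>j\<in>A. of_real ((cmod (c j))\<^sup>2))"
    using assms unfolding complex_norm_square
    by (intro sum.cong) (auto simp: orthonormal_lincomb_ip subset_iff mult.commute)
  finally show ?thesis by (simp add: nrm_sq_ip)
qed

text \<open>By Pythagoras the squared distance of two partial sums is a block of the numerical
  series, so its Cauchy criterion carries over, and completeness supplies the limit.\<close>

lemma orthonormal_series:
  assumes "summable (\<lambda>n. (cmod (c n))\<^sup>2)"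
  shows "\<exists>f\<in>lsq M. (\<lambda>N. nrm M (\<lambda>x. f x - (\<Sum>n=1..N. c n * u n x))) \<longlonglongrightarrow> 0"
proof (rule lsq_complete)
  show "(\<lambda>x. \<Sum>n=1..N. c n * u n x) \<in> lsq M" for N
    by (intro lsq_lincomb) (auto intro: orthonormal_lsq)
  fix e :: real assume e: "e > 0"
  then obtain N where N: "\<And>m n. m \<ge> N \<Longrightarrow> norm (\<Sum>k=m..<n. (cmod (c k))\<^sup>2) < e\<^sup>2"
    using assms unfolding summable_Cauchy by (meson zero_less_power)
  have ordered: "nrm M (\<lambda>x. (\<Sum>k=1..m. c k * u k x) - (\<Sum>k=1..n. c k * u k x)) < e"
    if "N \<le> n" "n \<le> m" for m n
  proof (rule power2_less_imp_less)
    have "(\<Sum>k=1..m. c k * u k x) - (\<Sum>k=1..n. c k * u k x) = (\<Sum>k=Suc n..<Suc m. c k * u k x)" for x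
    proof -
      have "{1..m} = {1..n} \<union> {Suc n..<Suc m}" using that by auto
      then have "(\<Sum>k=1..m. c k * u k x) = (\<Sum>k=1..n. c k * u k x) + (\<Sum>k=Suc n..<Suc m. c k * u k x)"
        by (simp only: sum.union_disjoint[OF finite_atLeastAtMost finite_atLeastLessThan]) (subst sum.union_disjoint, auto)
      then show ?thesis by simp
    qed
    then have "(nrm M (\<lambda>x. (\<Sum>k=1..m. c k * u k x) - (\<Sum>k=1..n. c k * u k x)))\<^sup>2
        = (\<Sum>k=Suc n..<Suc m. (cmod (c k))\<^sup>2)"
      by (simp only: orthonormal_lincomb_nrm) (rule orthonormal_lincomb_nrm, auto)
    also have "\<dots> < e\<^sup>2" using N[of "Suc n" "Suc m"] that by simp
    finally show "(nrm M (\<lambda>x. (\<Sum>k=1..m. c k * u k x) - (\<Sum>k=1..n. c k * u k x)))\<^sup>2 < e\<^sup>2" .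
  qed (use e in simp)
  show "\<exists>N. \<forall>m\<ge>N. \<forall>n\<ge>N. nrm M (\<lambda>x. (\<Sum>k=1..m. c k * u k x) - (\<Sum>k=1..n. c k * u k x)) < e"
  proof (intro exI[of _ N] allI impI)
    fix m n assume "N \<le> m" "N \<le> n"
    then show "nrm M (\<lambda>x. (\<Sum>k=1..m. c k * u k x) - (\<Sum>k=1..n. c k * u k x)) < e"
      using ordered[of n m] ordered[of m n] by (subst nrm_minus_commute) (metis nle_le nrm_minus_commute)
  qed
qed

lemma orthonormal_series_coeff:
  assumes f: "f \<in> lsq M" and lim: "(\<lambda>N. nrm M (\<lambda>x. f x - (\<Sum>n=1..N. c n * u n x))) \<longlonglongrightarrow> 0"
    and m: "m \<ge> 1"
  shows "ip M f (u m) = c m"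
proof -
  have "(\<lambda>N. ip M (\<lambda>x. \<Sum>n=1..N. c n * u n x) (u m)) \<longlonglongrightarrow> ip M f (u m)"
    by (intro ip_tendsto_left f lim lsq_lincomb orthonormal_lsq m) auto
  moreover have "(\<lambda>N. ip M (\<lambda>x. \<Sum>n=1..N. c n * u n x) (u m)) \<longlonglongrightarrow> c m"
    by (intro tendsto_eventually eventually_sequentiallyI[of m])
      (use m in \<open>subst orthonormal_lincomb_ip, auto\<close>)
  ultimately show ?thesis by (rule LIMSEQ_unique)
qed

lemma Bessel_inequality:
  assumes f: "f \<in> lsq M"
  shows "(\<Sum>n=1..N. (cmod (ip M f (u n)))\<^sup>2) \<le> (nrm M f)\<^sup>2"
proof -
  define s where "s = (\<lambda>x. \<Sum>n=1..N. ip M f (u n) * u n x)"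
  have s: "s \<in> lsq M" unfolding s_def by (intro lsq_lincomb orthonormal_lsq) auto
  have "ip M f s = (\<Sum>n=1..N. cnj (ip M f (u n)) * ip M f (u n))"
    unfolding s_def by (intro ip_lincomb_right f orthonormal_lsq) auto
  also have "\<dots> = of_real (\<Sum>n=1..N. (cmod (ip M f (u n)))\<^sup>2)"
    unfolding of_real_sum complex_norm_square by (simp add: mult.commute)
  finally have "Re (ip M f s) = (\<Sum>n=1..N. (cmod (ip M f (u n)))\<^sup>2)" by simp
  moreover have "(nrm M s)\<^sup>2 = (\<Sum>n=1..N. (cmod (ip M f (u n)))\<^sup>2)"
    unfolding s_def by (rule orthonormal_lincomb_nrm) auto
  ultimately show ?thesis
    using nrm_diff_sq[OF f s] zero_le_power2[of "nrm M (\<lambda>x. f x - s x)"] by linarith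
qed

lemma Bessel_summable:
  assumes f: "f \<in> lsq M"
  shows "summable (\<lambda>n. (cmod (ip M f (u n)))\<^sup>2)"
proof -
  have "(\<Sum>n<N. (cmod (ip M f (u (Suc n))))\<^sup>2) \<le> (nrm M f)\<^sup>2" for N
    using Bessel_inequality[OF f, of N] by (simp add: sum.atLeast1_atMost_eq)
  then have "summable (\<lambda>n. (cmod (ip M f (u (Suc n))))\<^sup>2)"
    by (intro summableI_nonneg_bounded) auto
  then show ?thesis by (rule summable_Suc_iff[THEN iffD1])
qed

text \<open>Bessel's inequality makes the Fourier series of \<open>f\<close> converge; its sum has
  the same coefficients as \<open>f\<close>. Completeness of a system then amounts to showing that a
  vector orthogonal to all its members is zero, which is how it is used for the sines and for the
  shifts of a generator.\<close>

lemma orthonormal_projection: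
  assumes f: "f \<in> lsq M"
  obtains h where "h \<in> lsq M" "(\<lambda>N. nrm M (\<lambda>x. h x - (\<Sum>n=1..N. ip M f (u n) * u n x))) \<longlonglongrightarrow> 0"
    "\<And>n. n \<ge> 1 \<Longrightarrow> ip M (\<lambda>x. f x - h x) (u n) = 0"
proof -
  obtain h where h: "h \<in> lsq M" "(\<lambda>N. nrm M (\<lambda>x. h x - (\<Sum>n=1..N. ip M f (u n) * u n x))) \<longlonglongrightarrow> 0"
    using orthonormal_series[OF Bessel_summable[OF f]] by blast
  have "ip M (\<lambda>x. f x - h x) (u n) = 0" if "n \<ge> 1" for n
    using orthonormal_series_coeff[OF h that] that f h(1) by (simp add: ip_diff_left orthonormal_lsq)
  with h that show ?thesis by blast
qed

end

section \<open>Closed linear spans\<close>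

definition closed_span :: "'a measure \<Rightarrow> (nat \<Rightarrow> 'a \<Rightarrow> complex) \<Rightarrow> ('a \<Rightarrow> complex) set" where
  "closed_span M u =
     {f \<in> lsq M. \<forall>\<epsilon>>0. \<exists>N c. nrm M (\<lambda>x. f x - (\<Sum>n=1..N. c n * u n x)) < \<epsilon>}"

lemma closed_spanE:
  assumes "f \<in> closed_span M u" "\<epsilon> > 0"
  obtains N c where "nrm M (\<lambda>x. f x - (\<Sum>n=1..N. c n * u n x)) < \<epsilon>"
proof -
  from assms have "\<exists>N c. nrm M (\<lambda>x. f x - (\<Sum>n=1..N. c n * u n x)) < \<epsilon>"
    by (simp add: closed_span_def)
  then show thesis using that by (elim exE)
qed

lemma closed_span_subset:
  assumes K: "closed_subspace M K" and u: "\<And>n. n \<ge> 1 \<Longrightarrow> u n \<in> K"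
  shows "closed_span M u \<subseteq> K"
proof
  fix f assume f: "f \<in> closed_span M u"
  have "\<exists>g\<in>K. nrm M (\<lambda>x. f x - g x) < \<epsilon>" if "\<epsilon> > 0" for \<epsilon>
  proof -
    obtain N c where Nc: "nrm M (\<lambda>x. f x - (\<Sum>n=1..N. c n * u n x)) < \<epsilon>"
      using closed_spanE[OF f \<open>\<epsilon> > 0\<close>] by metis
    have "(\<lambda>x. \<Sum>n=1..N. c n * u n x) \<in> K"
      by (rule closed_subspace_lincomb[OF K]) (use u in auto)
    with Nc show ?thesis by (intro bexI[where x = "\<lambda>x. \<Sum>n=1..N. c n * u n x"])
  qed
  moreover have "f \<in> lsq M" using f by (simp add: closed_span_def)
  ultimately show "f \<in> K" using K by (auto simp: closed_subspace_def)
qed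

lemma closed_span_orthogonal:
  assumes f: "f \<in> closed_span M u" and g: "g \<in> lsq M" and u: "\<And>n. n \<ge> 1 \<Longrightarrow> u n \<in> lsq M"
    and orth: "\<And>n. n \<ge> 1 \<Longrightarrow> ip M (u n) g = 0"
  shows "ip M f g = 0"
proof (rule ccontr)
  assume neq: "ip M f g \<noteq> 0"
  have fl: "f \<in> lsq M" using f by (simp add: closed_span_def)
  \<comment> \<open>The added 1 keeps the denominator positive when \<open>g\<close> has norm zero
    and makes the final inequality strict.\<close>
  define \<epsilon> where "\<epsilon> = cmod (ip M f g) / (nrm M g + 1)"
  have pos: "nrm M g + 1 > 0" using nrm_nonneg[of M g] by linarith
  then have "\<epsilon> > 0" using neq by (simp add: \<epsilon>_def)
  then obtain N c where Nc: "nrm M (\<lambda>x. f x - (\<Sum>n=1..N. c n * u n x)) < \<epsilon>"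
    by (rule closed_spanE[OF f])
  define s where "s = (\<lambda>x. \<Sum>n=1..N. c n * u n x)"
  have s: "s \<in> lsq M" unfolding s_def by (intro lsq_lincomb u) auto
  have "ip M s g = (\<Sum>n=1..N. c n * ip M (u n) g)"
    unfolding s_def by (intro ip_lincomb_left g u) auto
  also have "\<dots> = 0" using orth by (intro sum.neutral) auto
  finally have "ip M f g = ip M (\<lambda>x. f x - s x) g"
    by (simp add: ip_diff_left[OF fl s g])
  then have "cmod (ip M f g) \<le> nrm M (\<lambda>x. f x - s x) * nrm M g"
    by (simp add: Cauchy_Schwarz_lsq[OF lsq_diff[OF fl s] g])
  also have "\<dots> \<le> \<epsilon> * nrm M g"
    using Nc by (intro mult_right_mono) (auto simp: s_def)
  also have "\<dots> < \<epsilon> * (nrm M g + 1)"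
    using \<open>\<epsilon> > 0\<close> by (simp add: distrib_left)
  also have "\<dots> = cmod (ip M f g)" using pos by (simp add: \<epsilon>_def)
  finally show False by simp
qed

section \<open>Square-summable sequences and their dilations\<close>

abbreviation natm :: "nat measure" where
  "natm \<equiv> count_space UNIV"

lemma lsq_natm_iff: "a \<in> lsq natm \<longleftrightarrow> summable (\<lambda>n. (cmod (a n))\<^sup>2)"
  by (simp add: lsq_def integrable_count_space_nat_iff)

lemma nrm_sq_natm: "a \<in> lsq natm \<Longrightarrow> (nrm natm a)\<^sup>2 = (\<Sum>n. (cmod (a n))\<^sup>2)"
  by (simp add: nrm_sq integral_count_space_nat lsqD)

lemma ip_natm: "a \<in> lsq natm \<Longrightarrow> b \<in> lsq natm \<Longrightarrow> ip natm a b = (\<Sum>n. a n * cnj (b n))"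
  unfolding ip_def by (intro integral_count_space_nat lsq_mult_integrable)

text \<open>Boundedness of the evaluation at an index: norm convergence implies convergence of each
  entry, and an entry is a functional that can be represented by a vector.\<close>

lemma cmod_le_nrm_natm:
  assumes "a \<in> lsq natm"
  shows "cmod (a m) \<le> nrm natm a"
proof (rule power2_le_imp_le)
  show "(cmod (a m))\<^sup>2 \<le> (nrm natm a)\<^sup>2"
    unfolding nrm_sq_natm[OF assms]
    using sum_le_suminf[of "\<lambda>n. (cmod (a n))\<^sup>2" "{m}"] assms by (simp add: lsq_natm_iff)
qed simp

lemma nrm_natm_eq_0: "a \<in> lsq natm \<Longrightarrow> nrm natm a = 0 \<Longrightarrow> a = (\<lambda>n. 0)"
  using cmod_le_nrm_natm[of a] by (auto intro: ext)

lemma ip_natm_self_eq_0: "a \<in> lsq natm \<Longrightarrow> ip natm a a = 0 \<Longrightarrow> a = (\<lambda>n. 0)"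
  by (rule nrm_natm_eq_0) (auto simp: ip_self)

lemma nrm_natm_tendsto_coord:
  assumes "a \<in> lsq natm" "\<And>N. s N \<in> lsq natm" "(\<lambda>N. nrm natm (\<lambda>n. a n - s N n)) \<longlonglongrightarrow> 0"
  shows "(\<lambda>N. s N m) \<longlonglongrightarrow> a m"
proof -
  have "(\<lambda>N. a m - s N m) \<longlonglongrightarrow> 0"
    using cmod_le_nrm_natm[OF lsq_diff[OF assms(1,2)], of m]
    by (intro Lim_null_comparison[OF _ assms(3)]) auto
  from tendsto_diff[OF tendsto_const[of "a m"] this] show ?thesis by simp
qed

text \<open>For \<open>n \<ge> 1\<close> these are the coefficients of \<open>n^(-s)\<close> times
  the series with coefficients \<open>a\<close>. Every \<open>n\<close> divides 0, so the entry at 0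
  stays in place; in the spaces considered it is 0.\<close>

definition shift :: "nat \<Rightarrow> (nat \<Rightarrow> complex) \<Rightarrow> nat \<Rightarrow> complex" where
  "shift n a m = (if n dvd m then a (m div n) else 0)"

lemma shift_mult [simp]: "n \<ge> 1 \<Longrightarrow> shift n a (n * k) = a k"
  by (simp add: shift_def)

lemma shift_one [simp]: "shift (Suc 0) a = a"
  by (simp add: shift_def fun_eq_iff)

lemma shift_at_0 [simp]: "shift n a 0 = a 0"
  by (simp add: shift_def)

lemma shift_shift: "m \<ge> 1 \<Longrightarrow> shift m (shift n a) = shift (m * n) a"
  by (auto simp: shift_def fun_eq_iff div_mult2_eq dvd_div_iff_mult mult.commute
      dest: dvd_mult_left)

lemma shift_eq_0_outside: "m \<notin> range ((*) n) \<Longrightarrow> shift n a m = 0"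
  by (auto simp: shift_def dvd_def)

lemma shift_lsq:
  assumes "n \<ge> 1" "a \<in> lsq natm"
  shows "shift n a \<in> lsq natm"
proof -
  have "summable (\<lambda>k. (cmod (shift n a (n * k)))\<^sup>2) \<longleftrightarrow> summable (\<lambda>m. (cmod (shift n a m))\<^sup>2)"
    by (rule summable_mono_reindex)
      (use assms in \<open>auto simp: shift_eq_0_outside intro: strict_monoI\<close>)
  then show ?thesis using assms by (simp add: lsq_natm_iff)
qed

text \<open>The shifted sequences live on the multiples of \<open>n\<close>, and the sum reindexes
  along \<open>k \<mapsto> n * k\<close>. So \<open>shift n\<close> is an isometry, which allows a
  common factor of two indices to be cancelled in inner products of shifts.\<close>

lemma ip_shift:
  assumes "n \<ge> 1" "a \<in> lsq natm" "b \<in> lsq natm"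
  shows "ip natm (shift n a) (shift n b) = ip natm a b"
proof -
  have "(\<Sum>k. shift n a (n * k) * cnj (shift n b (n * k))) = (\<Sum>m. shift n a m * cnj (shift n b m))"
    by (rule suminf_mono_reindex)
      (use assms in \<open>auto simp: shift_eq_0_outside intro: strict_monoI\<close>)
  then show ?thesis using assms by (simp add: ip_natm shift_lsq)
qed

text \<open>Norm convergence implies entrywise convergence, and the \<open>m\<close>-th entry of the
  partial sums is constant from \<open>N = m\<close> on, since only divisors of \<open>m\<close>
  contribute. The limit is the Dirichlet convolution of \<open>c\<close> and
  \<open>f\<close>.\<close>

lemma shift_series_coord:
  assumes "\<And>n. n \<ge> 1 \<Longrightarrow> shift n f \<in> lsq natm" "f 0 = 0" "h \<in> lsq natm"
    and "(\<lambda>N. nrm natm (\<lambda>m. h m - (\<Sum>n=1..N. c n * shift n f m))) \<longlonglongrightarrow> 0"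
  shows "h m = (if m = 0 then 0 else \<Sum>d | d dvd m. c d * f (m div d))"
proof -
  have "(\<lambda>N. \<Sum>n=1..N. c n * shift n f m) \<longlonglongrightarrow> h m"
    by (rule nrm_natm_tendsto_coord[OF assms(3) _ assms(4)]) (intro lsq_lincomb assms(1), auto)
  moreover have "(\<lambda>N. \<Sum>n=1..N. c n * shift n f m) \<longlonglongrightarrow> (if m = 0 then 0 else \<Sum>d | d dvd m. c d * f (m div d))"
  proof (intro tendsto_eventually eventually_sequentiallyI)
    fix N assume N: "m \<le> N"
    show "(\<Sum>n=1..N. c n * shift n f m) = (if m = 0 then 0 else \<Sum>d | d dvd m. c d * f (m div d))"
    proof (cases "m = 0")
      case False
      have "(\<Sum>n=1..N. c n * shift n f m) = (\<Sum>d | d dvd m. c d * f (m div d))"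
      proof (rule sum.mono_neutral_cong_right)
        show "{d. d dvd m} \<subseteq> {1..N}"
          using False N dvd_imp_le[of _ m] by (auto simp: Suc_le_eq dvd_pos_nat) (meson le_trans)
      qed (auto simp: shift_def)
      with False show ?thesis by simp
    qed (simp add: assms(2))
  qed
  ultimately show ?thesis by (rule LIMSEQ_unique)
qed

text \<open>The Dirichlet product of \<open>f\<close> and \<open>g\<close> lies both in the closed span of the dilations of \<open>f\<close>
  and in that of the dilations of \<open>g\<close>, and it does not vanish.\<close>

lemma shift_orthonormal_not_orthogonal:
  assumes f: "orthonormal natm (\<lambda>n. shift n f)" "f 0 = 0"
    and g: "orthonormal natm (\<lambda>n. shift n g)" "g 0 = 0"
    and orth: "\<And>n m. n \<ge> 1 \<Longrightarrow> m \<ge> 1 \<Longrightarrow> ip natm (shift n f) (shift m g) = 0"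
  shows False
proof -
  note fl = orthonormal_lsq[OF f(1)] and gl = orthonormal_lsq[OF g(1)]
  have f_lsq: "f \<in> lsq natm" and g_lsq: "g \<in> lsq natm" using fl[of 1] gl[of 1] by auto
  obtain h where h: "h \<in> lsq natm"
      "(\<lambda>N. nrm natm (\<lambda>m. h m - (\<Sum>n=1..N. g n * shift n f m))) \<longlonglongrightarrow> 0"
    using orthonormal_series[OF f(1) g_lsq[unfolded lsq_natm_iff]] by (elim bexE)
  obtain h' where h': "h' \<in> lsq natm"
      "(\<lambda>N. nrm natm (\<lambda>m. h' m - (\<Sum>n=1..N. f n * shift n g m))) \<longlonglongrightarrow> 0"
    using orthonormal_series[OF g(1) f_lsq[unfolded lsq_natm_iff]] by (elim bexE)
  note h_coord = shift_series_coord[OF fl f(2) h] and h'_coord = shift_series_coord[OF gl g(2) h']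
  have "h' m = h m" for m
  proof (cases "m = 0")
    case False
    have "(\<Sum>d | d dvd m. f d * g (m div d)) = (\<Sum>d | d dvd m. g d * f (m div d))"
      by (rule sum.reindex_bij_witness[of _ "\<lambda>d. m div d" "\<lambda>d. m div d"])
        (use False in \<open>auto simp: dvd_def mult.commute\<close>)
    then show ?thesis by (simp add: h_coord h'_coord)
  qed (simp add: h_coord h'_coord)
  then have "h' = h" by blast
  \<comment> \<open>As a limit of combinations of shifts of \<open>f\<close>, \<open>h\<close> is
    orthogonal to the shifts of \<open>g\<close>; as \<open>h'\<close> it is a limit of combinations
    of these. Hence it is orthogonal to itself.\<close>
  have "ip natm h (shift m g) = 0" if "m \<ge> 1" for m
  proof (rule LIMSEQ_unique[OF _ tendsto_const])
    have "ip natm (\<lambda>k. \<Sum>n=1..N. g n * shift n f k) (shift m g) = 0" for N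
      by (subst ip_lincomb_left) (use fl gl orth that in \<open>auto intro!: sum.neutral\<close>)
    moreover have "(\<lambda>k. \<Sum>n=1..N. g n * shift n f k) \<in> lsq natm" for N
      by (intro lsq_lincomb fl) auto
    ultimately show "(\<lambda>N. 0) \<longlonglongrightarrow> ip natm h (shift m g)"
      using ip_tendsto_left[OF h(1) gl[OF that] _ h(2)] by simp
  qed
  then have "ip natm h (\<lambda>k. \<Sum>n=1..N. f n * shift n g k) = 0" for N
    by (subst ip_lincomb_right) (use h gl in \<open>auto intro!: sum.neutral\<close>)
  moreover have "(\<lambda>k. \<Sum>n=1..N. f n * shift n g k) \<in> lsq natm" for N
    by (intro lsq_lincomb gl) auto
  ultimately have "(\<lambda>N. 0) \<longlonglongrightarrow> ip natm h h'"
    using ip_tendsto_right[OF h'(1) h(1) _ h'(2)] by simp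
  then have "ip natm h h = 0"
    unfolding \<open>h' = h\<close> using LIMSEQ_unique tendsto_const by blast
  then have h0: "h = (\<lambda>n. 0)" by (rule ip_natm_self_eq_0[OF h(1)])
  have "f \<noteq> (\<lambda>n. 0)" "g \<noteq> (\<lambda>n. 0)"
    using orthonormal_ip[OF f(1), of 1 1] orthonormal_ip[OF g(1), of 1 1] by auto
  then have ex: "\<exists>n. f n \<noteq> 0" "\<exists>n. g n \<noteq> 0" by auto
  \<comment> \<open>Leading indices multiply: in the entry at \<open>j * i\<close> a divisor
    \<open>d < j\<close> meets a zero of \<open>g\<close>, and for \<open>d > j\<close> the
    complementary divisor is below \<open>i\<close>, a zero of \<open>f\<close>. Only
    \<open>d = j\<close> survives.\<close>
  define i where "i = (LEAST n. f n \<noteq> 0)"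
  define j where "j = (LEAST n. g n \<noteq> 0)"
  have i: "f i \<noteq> 0" "\<And>n. n < i \<Longrightarrow> f n = 0" and j: "g j \<noteq> 0" "\<And>n. n < j \<Longrightarrow> g n = 0"
    unfolding i_def j_def using LeastI_ex[OF ex(1)] LeastI_ex[OF ex(2)] not_less_Least by blast+
  have "i > 0" "j > 0" using i(1) j(1) f(2) g(2) by (auto intro: Nat.gr0I)
  have "h (j * i) = (\<Sum>d | d dvd j * i. g d * f (j * i div d))"
    using \<open>i > 0\<close> \<open>j > 0\<close> by (simp add: h_coord)
  also have "\<dots> = (\<Sum>d | d dvd j * i. if d = j then g j * f i else 0)"
  proof (intro sum.cong refl)
    fix d assume d: "d \<in> {d. d dvd j * i}"
    consider "d < j" | "d = j" | "d > j" by linarith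
    then show "g d * f (j * i div d) = (if d = j then g j * f i else 0)"
    proof cases
      case 3
      have "j * i div d < i"
        using 3 \<open>i > 0\<close> by (simp add: less_mult_imp_div_less mult.commute)
      with i(2) 3 show ?thesis by simp
    qed (use j \<open>j > 0\<close> in auto)
  qed
  also have "\<dots> = g j * f i"
    using \<open>i > 0\<close> \<open>j > 0\<close> by simp
  finally show False using h0 i(1) j(1) by simp
qed

section \<open>Shift invariant spaces of sequences\<close>

text \<open>\<open>B p\<close> stands for the adjoint of \<open>shift p\<close> on \<open>K\<close>.
  Treating it as a parameter known only through its defining identity keeps the operator argument
  apart from the definite description in \<open>adjoint_on\<close>.\<close>

locale shift_subspace =
  fixes K :: "(nat \<Rightarrow> complex) set" and B :: "nat \<Rightarrow> (nat \<Rightarrow> complex) \<Rightarrow> nat \<Rightarrow> complex"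
  assumes closed: "closed_subspace natm K"
    and at_0: "a \<in> K \<Longrightarrow> a 0 = 0"
    and shift_in: "n \<ge> 1 \<Longrightarrow> a \<in> K \<Longrightarrow> shift n a \<in> K"
    and adjoint_in: "prime p \<Longrightarrow> a \<in> K \<Longrightarrow> B p a \<in> K"
    and adjoint: "prime p \<Longrightarrow> a \<in> K \<Longrightarrow> b \<in> K \<Longrightarrow> ip natm (shift p a) b = ip natm a (B p b)"
begin

lemma in_lsq: "a \<in> K \<Longrightarrow> a \<in> lsq natm"
  by (rule closed_subspace_lsq[OF closed])

lemma eqI:
  assumes "a \<in> K" "b \<in> K" "\<And>x. x \<in> K \<Longrightarrow> ip natm x a = ip natm x b"
  shows "a = b"
proof -
  have d: "(\<lambda>n. a n - b n) \<in> K" by (rule closed_subspace_diff[OF closed assms(1,2)])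
  have "ip natm (\<lambda>n. a n - b n) (\<lambda>n. a n - b n) = 0"
    using assms(3)[OF d] assms(1,2) d by (simp add: ip_diff_right in_lsq)
  from ip_natm_self_eq_0[OF in_lsq[OF d] this] show ?thesis
    by (metis eq_iff_diff_eq_0 ext)
qed

lemma adjoint_shift_self:
  assumes "prime p" "a \<in> K"
  shows "B p (shift p a) = a"
proof (rule eqI)
  have p: "p \<ge> 1" using prime_ge_1_nat[OF assms(1)] .
  show "B p (shift p a) \<in> K" by (intro adjoint_in shift_in assms p)
  show "ip natm x (B p (shift p a)) = ip natm x a" if "x \<in> K" for x
    using adjoint[OF assms(1) that shift_in[OF p assms(2)]] ip_shift[OF p in_lsq[OF that] in_lsq[OF assms(2)]]
    by simp
qed fact

text \<open>Pairing with \<open>g\<close> reads off the entry at \<open>k\<close>, so the squared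
  norm of \<open>B p g\<close> is the entry of \<open>shift p (B p g)\<close> at \<open>k\<close>.
  That entry is zero or the entry of \<open>B p g\<close> at the smaller index
  \<open>k div p\<close>, where all of \<open>J\<close> vanishes. A general reducing
  \<open>J\<close> is allowed because the lemma is applied to \<open>K\<close> and to the complement
  of the shifts of a first generator.\<close>

lemma exists_common_kernel_vector:
  assumes J: "closed_subspace natm J" "J \<subseteq> K" "\<exists>a\<in>J. a \<noteq> (\<lambda>n. 0)"
    and inv: "\<And>p a. prime p \<Longrightarrow> a \<in> J \<Longrightarrow> shift p a \<in> J" "\<And>p a. prime p \<Longrightarrow> a \<in> J \<Longrightarrow> B p a \<in> J"
  shows "\<exists>g\<in>J. g \<noteq> (\<lambda>n. 0) \<and> (\<forall>p. prime p \<longrightarrow> B p g = (\<lambda>n. 0))"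
proof -
  have ex: "\<exists>n. \<exists>a\<in>J. a n \<noteq> 0" using J(3) by auto
  define k where "k = (LEAST n. \<exists>a\<in>J. a n \<noteq> 0)"
  obtain a where a: "a \<in> J" "a k \<noteq> 0" using LeastI_ex[OF ex] unfolding k_def by blast
  have min: "b n = 0" if "b \<in> J" "n < k" for b n
    using not_less_Least[of n "\<lambda>n. \<exists>a\<in>J. a n \<noteq> 0"] that by (auto simp: k_def)
  \<comment> \<open>The index 0 would be fixed by \<open>shift p\<close>; only for positive
    \<open>k\<close> is \<open>k div p\<close> smaller than \<open>k\<close>.\<close>
  have "k > 0" using a at_0[of a] J(2) by (auto intro: Nat.gr0I)
  have "\<exists>g\<in>J. \<forall>b\<in>J. b k = ip natm b g"
    by (rule Riesz_representation[OF J(1), where L = "\<lambda>b. b k" and C = 1])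
      (use J(2) in_lsq cmod_le_nrm_natm in auto)
  then obtain g where g: "g \<in> J" "\<And>b. b \<in> J \<Longrightarrow> b k = ip natm b g" by blast
  have "g \<noteq> (\<lambda>n. 0)" using g(2)[OF a(1)] a(2) by auto
  moreover have "B p g = (\<lambda>n. 0)" if p: "prime p" for p
  proof (rule ip_natm_self_eq_0)
    have Bg: "B p g \<in> J" by (rule inv(2)[OF p g(1)])
    then show "B p g \<in> lsq natm" using J(2) in_lsq by blast
    have "ip natm (B p g) (B p g) = ip natm (shift p (B p g)) g"
      using adjoint[OF p subsetD[OF J(2) Bg] subsetD[OF J(2) g(1)]] by simp
    also have "\<dots> = shift p (B p g) k"
      using g(2)[OF inv(1)[OF p Bg]] by simp
    also have "\<dots> = 0"
      using min[OF Bg, of "k div p"] \<open>k > 0\<close> prime_gt_1_nat[OF p] by (simp add: shift_def)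
    finally show "ip natm (B p g) (B p g) = 0" .
  qed
  ultimately show ?thesis using g(1) by blast
qed

text \<open>The difference of both sides lies in \<open>K\<close>, hence vanishes once it is
  orthogonal to every \<open>shift m f\<close>. If \<open>p\<close> divides \<open>m\<close>, the
  factor \<open>p\<close> cancels by isometry and \<open>q\<close> moves across by the adjoint;
  otherwise both pairings are zero.\<close>

lemma commute_if_orthonormal_shifts:
  assumes f: "orthonormal natm (\<lambda>n. shift n f)" and span: "K = closed_span natm (\<lambda>n. shift n f)"
    and pq: "prime p" "prime q" "p \<noteq> q" and a: "a \<in> K"
  shows "shift p (B q a) = B q (shift p a)"
proof -
  have p: "p \<ge> 1" and q: "q \<ge> 1" using pq prime_ge_1_nat by auto
  have fl: "f \<in> lsq natm" using orthonormal_lsq[OF f, of 1] by simp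
  have fK: "f \<in> K"
    unfolding span closed_span_def using fl by (auto intro!: exI[of _ "1::nat"] exI[of _ "\<lambda>_. 1"])
  define x where "x = (\<lambda>n. shift p (B q a) n - B q (shift p a) n)"
  have in1: "shift p (B q a) \<in> K" and in2: "B q (shift p a) \<in> K"
    by (intro shift_in adjoint_in p pq a)+
  then have x: "x \<in> K" unfolding x_def by (rule closed_subspace_diff[OF closed])
  have "ip natm (shift m f) x = 0" if m: "m \<ge> 1" for m
  proof -
    have mf: "shift m f \<in> K" by (rule shift_in[OF m fK])
    have "ip natm (shift m f) (B q (shift p a)) = ip natm (shift (q * m) f) (shift p a)"
      using adjoint[OF pq(2) mf shift_in[OF p a]] q by (simp add: shift_shift)
    also have "\<dots> = ip natm (shift m f) (shift p (B q a))"
    proof (cases "p dvd m")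
      case True
      then obtain k where k: "m = p * k" by blast
      have k1: "k \<ge> 1" using m k by (cases k) auto
      have kf: "shift k f \<in> K" and qkf: "shift (q * k) f \<in> K"
        using k1 q fK by (auto intro: shift_in)
      have "ip natm (shift (q * m) f) (shift p a) = ip natm (shift (q * k) f) a"
        using ip_shift[OF p in_lsq[OF qkf] in_lsq[OF a]] p by (simp add: shift_shift k mult_ac)
      also have "\<dots> = ip natm (shift k f) (B q a)"
        using adjoint[OF pq(2) kf a] q by (simp add: shift_shift)
      also have "\<dots> = ip natm (shift m f) (shift p (B q a))"
        using ip_shift[OF p in_lsq[OF kf] in_lsq[OF adjoint_in[OF pq(2) a]]] p
        by (simp add: shift_shift k)
      finally show ?thesis .
    next
      case False
      \<comment> \<open>Since \<open>p * n\<close> never equals \<open>k\<close>,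
        \<open>B p (shift k f)\<close> is orthogonal to every \<open>shift n f\<close>, hence to
        \<open>K\<close>; moving \<open>p\<close> back makes \<open>shift k f\<close> orthogonal to
        all \<open>shift p b\<close>.\<close>
      have zero: "ip natm (shift k f) (shift p b) = 0" if b: "b \<in> K" and k: "k \<ge> 1" "\<not> p dvd k" for k b
      proof -
        have kf: "shift k f \<in> K" using k fK by (auto intro: shift_in)
        have "ip natm b (B p (shift k f)) = 0"
        proof (rule closed_span_orthogonal)
          show "b \<in> closed_span natm (\<lambda>n. shift n f)" using b span by simp
          show "B p (shift k f) \<in> lsq natm" using adjoint_in[OF pq(1) kf] by (rule in_lsq)
          show "shift n f \<in> lsq natm" if "n \<ge> 1" for n using orthonormal_lsq[OF f that] .
          show "ip natm (shift n f) (B p (shift k f)) = 0" if n: "n \<ge> 1" for n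
          proof -
            have "ip natm (shift n f) (B p (shift k f)) = ip natm (shift (p * n) f) (shift k f)"
              using adjoint[OF pq(1) shift_in[OF n fK] kf] p by (simp add: shift_shift)
            also have "\<dots> = 0"
              using orthonormal_ip[OF f, of "p * n" k] p n k by auto
            finally show ?thesis .
          qed
        qed
        then have "ip natm (shift p b) (shift k f) = 0" using adjoint[OF pq(1) b kf] by simp
        then show ?thesis using ip_cnj[of natm "shift k f" "shift p b"] by simp
      qed
      \<comment> \<open>The point where distinctness of the primes enters: for \<open>q = p\<close>
        the first pairing need not vanish.\<close>
      have "\<not> p dvd q * m"
        using False pq by (metis prime_dvd_mult_iff primes_dvd_imp_eq)
      then show ?thesis
        using zero[OF a, of "q * m"] zero[OF adjoint_in[OF pq(2) a] m False] m q by simp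
    qed
    finally show ?thesis
      unfolding x_def using in1 in2 mf by (simp add: ip_diff_right in_lsq)
  qed
  then have "ip natm x x = 0"
    by (intro closed_span_orthogonal[of x natm "\<lambda>n. shift n f"]) (use x span in_lsq orthonormal_lsq[OF f] in auto)
  from ip_natm_self_eq_0[OF in_lsq[OF x] this] show ?thesis
    by (metis x_def eq_iff_diff_eq_0 ext)
qed

end

section \<open>The orthonormal generator of a doubly commuting subspace\<close>

locale doubly_commuting = shift_subspace +
  assumes commute: "prime p \<Longrightarrow> prime q \<Longrightarrow> p \<noteq> q \<Longrightarrow> a \<in> K \<Longrightarrow> shift p (B q a) = B q (shift p a)"
begin

text \<open>Strong induction on \<open>m\<close>, splitting off one prime factor \<open>q\<close> at
  a time: none of them is \<open>p\<close>, so each \<open>shift q\<close> may be moved past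
  \<open>B p\<close>.\<close>

lemma adjoint_shift_commute:
  assumes p: "prime p" and m: "m \<ge> 1" "\<not> p dvd m" and a: "a \<in> K"
  shows "B p (shift m a) = shift m (B p a)"
  using m a
proof (induction m arbitrary: a rule: less_induct)
  case (less m)
  show ?case
  proof (cases "m = 1")
    case False
    then obtain q where q: "prime q" "q dvd m" using prime_factor_nat by blast
    then obtain k where k: "m = q * k" by blast
    have q1: "q > 1" using prime_gt_1_nat[OF q(1)] .
    have k1: "k \<ge> 1" "k < m" using less.prems(1) q1 by (auto simp: k intro: Suc_leI Nat.gr0I)
    have pk: "\<not> p dvd k" "p \<noteq> q" using less.prems(2) k by auto
    have "B p (shift m a) = B p (shift q (shift k a))"
      using q1 by (simp add: shift_shift k)
    also have "\<dots> = shift q (B p (shift k a))"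
      using commute[OF q(1) p _ shift_in[OF k1(1) less.prems(3)]] pk(2) by simp
    also have "\<dots> = shift q (shift k (B p a))"
      using less.IH[OF k1(2,1) pk(1) less.prems(3)] by simp
    also have "\<dots> = shift m (B p a)"
      using q1 by (simp add: shift_shift k)
    finally show ?thesis .
  qed simp
qed

text \<open>Common prime factors of \<open>n\<close> and \<open>m\<close> cancel by isometry. A
  prime dividing only one of them is moved across by its adjoint, passes the other shift and
  annihilates the kernel vector. With \<open>f = g\<close> this gives an orthogonal family, with two
  vectors the orthogonality of two families up to the diagonal case \<open>n = m\<close>.\<close>

lemma shift_kernel_orthogonal:
  assumes f: "f \<in> K" "\<And>p. prime p \<Longrightarrow> B p f = (\<lambda>n. 0)"
    and g: "g \<in> K" "\<And>p. prime p \<Longrightarrow> B p g = (\<lambda>n. 0)"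
    and "n \<ge> 1" "m \<ge> 1" "n \<noteq> m"
  shows "ip natm (shift n f) (shift m g) = 0"
proof -
  have strip: "ip natm (shift n f) (shift m g) = 0"
    if f: "f \<in> K" and g: "g \<in> K" "\<And>p. prime p \<Longrightarrow> B p g = (\<lambda>n. 0)"
      and nm: "n \<ge> 1" "m \<ge> 1" and p: "prime p" "p dvd n" "\<not> p dvd m" for f g n m p
  proof -
    obtain k where k: "n = p * k" using p(2) by blast
    have k1: "k \<ge> 1" using nm k by (cases k) auto
    have kf: "shift k f \<in> K" and mg: "shift m g \<in> K" using k1 nm f g by (auto intro: shift_in)
    have "ip natm (shift n f) (shift m g) = ip natm (shift k f) (B p (shift m g))"
      using adjoint[OF p(1) kf mg] prime_ge_1_nat[OF p(1)] by (simp add: shift_shift k)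
    also have "B p (shift m g) = (\<lambda>n. 0)"
      using adjoint_shift_commute[OF p(1) nm(2) p(3) g(1)] g(2)[OF p(1)]
      by (simp add: shift_def fun_eq_iff)
    finally show ?thesis by simp
  qed
  show ?thesis
    using assms(5-7)
  proof (induction n arbitrary: m rule: less_induct)
    case (less n)
    \<comment> \<open>As \<open>n \<noteq> m\<close>, at least one of the indices differs from 1 and
      has a prime factor.\<close>
    obtain p where p: "prime p" "p dvd n \<or> p dvd m"
      using less.prems prime_factor_nat[of n] prime_factor_nat[of m] by metis
    have p1: "p > 1" using prime_gt_1_nat[OF p(1)] .
    consider "p dvd n" "p dvd m" | "p dvd n" "\<not> p dvd m" | "\<not> p dvd n" "p dvd m" using p(2) by blast
    then show ?case
    proof cases
      case 1
      then obtain k l where kl: "n = p * k" "m = p * l" by (auto simp: dvd_def)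
      have k1: "k \<ge> 1" "l \<ge> 1" "k < n" "k \<noteq> l"
        using less.prems p1 by (auto simp: kl intro: Suc_leI Nat.gr0I)
      have "ip natm (shift n f) (shift m g) = ip natm (shift k f) (shift l g)"
        using ip_shift[of p "shift k f" "shift l g"] p1 k1 f(1) g(1)
        by (simp add: shift_shift kl in_lsq shift_in)
      then show ?thesis using less.IH[OF k1(3,1,2,4)] by simp
    next
      case 2
      then show ?thesis using strip[OF f(1) g] less.prems p(1) by blast
    next
      case 3
      then have "ip natm (shift m g) (shift n f) = 0"
        using strip[OF g(1) f] less.prems p(1) by blast
      then show ?thesis using ip_cnj[of natm "shift n f" "shift m g"] by simp
    qed
  qed
qed

lemma kernel_orthonormal:
  assumes "f \<in> K" "\<And>p. prime p \<Longrightarrow> B p f = (\<lambda>n. 0)" "ip natm f f = 1"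
  shows "orthonormal natm (\<lambda>n. shift n f)"
  unfolding orthonormal_def
  using assms shift_kernel_orthogonal[OF assms(1,2) assms(1,2)]
  by (auto simp: shift_lsq in_lsq ip_shift)

lemma normalise_kernel_vector:
  assumes J: "closed_subspace natm J" "J \<subseteq> K"
    and g: "g \<in> J" "g \<noteq> (\<lambda>n. 0)" "\<And>p. prime p \<Longrightarrow> B p g = (\<lambda>n. 0)"
  obtains f where "f \<in> J" "ip natm f f = 1" "\<And>p. prime p \<Longrightarrow> B p f = (\<lambda>n. 0)"
proof -
  have gK: "g \<in> K" and gl: "g \<in> lsq natm" using g(1) J in_lsq by auto
  have pos: "nrm natm g > 0"
    using nrm_natm_eq_0[OF gl] g(2) nrm_nonneg[of natm g] by (auto simp: less_le)
  define f where "f = (\<lambda>n. of_real (1 / nrm natm g) * g n)"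
  have fJ: "f \<in> J" unfolding f_def by (rule closed_subspace_scale[OF J(1) g(1)])
  have "nrm natm f = 1" unfolding f_def nrm_scale using pos by (simp add: norm_divide)
  then have "ip natm f f = 1" by (simp add: ip_self)
  moreover have "B p f = (\<lambda>n. 0)" if p: "prime p" for p
  proof (rule eqI)
    have fK: "f \<in> K" using fJ J by blast
    show "B p f \<in> K" by (rule adjoint_in[OF p fK])
    show "(\<lambda>n. 0) \<in> K" by (rule closed_subspace_zero[OF closed])
    show "ip natm x (B p f) = ip natm x (\<lambda>n. 0)" if x: "x \<in> K" for x
      using adjoint[OF p x fK] adjoint[OF p x gK] g(3)[OF p]
      unfolding f_def ip_scale_right by simp
  qed
  ultimately show ?thesis using fJ that by blast
qed

theorem exists_orthonormal_generator:
  assumes "\<exists>a\<in>K. a \<noteq> (\<lambda>n. 0)"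
  shows "\<exists>f\<in>K. orthonormal natm (\<lambda>n. shift n f) \<and> K = closed_span natm (\<lambda>n. shift n f)"
proof -
  obtain f0 where f0: "f0 \<in> K" "f0 \<noteq> (\<lambda>n. 0)" "\<And>p. prime p \<Longrightarrow> B p f0 = (\<lambda>n. 0)"
    using exists_common_kernel_vector[OF closed order_refl assms] shift_in adjoint_in prime_ge_1_nat
    by blast
  obtain f where f: "f \<in> K" "ip natm f f = 1" "\<And>p. prime p \<Longrightarrow> B p f = (\<lambda>n. 0)"
    using normalise_kernel_vector[OF closed order_refl f0] by blast
  have on: "orthonormal natm (\<lambda>n. shift n f)" using kernel_orthonormal[OF f(1,3,2)] .
  have nf: "shift n f \<in> K" if "n \<ge> 1" for n using shift_in[OF that f(1)] .
  define J where "J = {a \<in> K. \<forall>n\<ge>1. ip natm a (shift n f) = 0}"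
  have J_sub: "J \<subseteq> K" by (auto simp: J_def)
  have J_closed: "closed_subspace natm J"
    unfolding closed_subspace_def
  proof (intro conjI ballI allI impI)
    show "J \<subseteq> lsq natm" using J_sub in_lsq by blast
    show "(\<lambda>n. 0) \<in> J" by (simp add: J_def closed_subspace_zero[OF closed])
    show "(\<lambda>n. a n + b n) \<in> J" if "a \<in> J" "b \<in> J" for a b
      using that nf by (auto simp: J_def ip_add_left in_lsq intro: closed_subspace_add[OF closed])
    show "(\<lambda>n. c * a n) \<in> J" if "a \<in> J" for a c
      using that by (auto simp: J_def ip_scale_left intro: closed_subspace_scale[OF closed])
    fix a assume a: "a \<in> lsq natm" and approx: "\<forall>\<epsilon>>0. \<exists>b\<in>J. nrm natm (\<lambda>n. a n - b n) < \<epsilon>"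
    then have "\<forall>n. \<exists>b\<in>J. nrm natm (\<lambda>k. a k - b k) < inverse (real (Suc n))" by simp
    then obtain b where b: "\<And>n. b n \<in> J" "\<And>n. nrm natm (\<lambda>k. a k - b n k) < inverse (real (Suc n))"
      by metis
    have lim: "(\<lambda>n. nrm natm (\<lambda>k. a k - b n k)) \<longlonglongrightarrow> 0"
      by (rule Lim_null_comparison[OF _ LIMSEQ_inverse_real_of_nat])
        (use b(2) in \<open>auto intro!: always_eventually less_imp_le\<close>)
    have "a \<in> K" using closed_subspace_limit[OF closed a _ lim] b(1) J_sub by blast
    moreover have "ip natm a (shift n f) = 0" if "n \<ge> 1" for n
    proof (rule LIMSEQ_unique)
      show "(\<lambda>k. ip natm (b k) (shift n f)) \<longlonglongrightarrow> ip natm a (shift n f)"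
        using ip_tendsto_left[OF a in_lsq[OF nf[OF that]] _ lim] b(1) J_sub in_lsq by blast
      show "(\<lambda>k. ip natm (b k) (shift n f)) \<longlonglongrightarrow> 0"
        using b(1) that by (simp add: J_def)
    qed
    ultimately show "a \<in> J" by (simp add: J_def)
  qed
  \<comment> \<open>\<open>B p\<close> sends \<open>shift n f\<close> to the shift by
    \<open>n div p\<close> if \<open>p\<close> divides \<open>n\<close> and to zero otherwise. The
    adjoint thus preserves the family of shifts up to zeros, which makes its complement
    \<open>J\<close> shift invariant.\<close>
  have B_shift: "ip natm (shift p a) (shift n f) = 0" if a: "a \<in> J" and p: "prime p" and n: "n \<ge> 1" for a p n
  proof -
    have aK: "a \<in> K" using a J_sub by blast
    have "ip natm (shift p a) (shift n f) = ip natm a (B p (shift n f))"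
      by (rule adjoint[OF p aK nf[OF n]])
    also have "\<dots> = 0"
    proof (cases "p dvd n")
      case True
      then obtain k where k: "n = p * k" by blast
      have k1: "k \<ge> 1" using n k by (cases k) auto
      have "B p (shift n f) = shift k f"
        using adjoint_shift_self[OF p nf[OF k1]] prime_ge_1_nat[OF p] by (simp add: shift_shift k)
      then show ?thesis using a k1 by (simp add: J_def)
    next
      case False
      then have "B p (shift n f) = (\<lambda>n. 0)"
        using adjoint_shift_commute[OF p n False f(1)] f(3)[OF p] by (simp add: shift_def fun_eq_iff)
      then show ?thesis by simp
    qed
    finally show ?thesis .
  qed
  have "\<not> (\<exists>a\<in>J. a \<noteq> (\<lambda>n. 0))"
  proof
    assume "\<exists>a\<in>J. a \<noteq> (\<lambda>n. 0)"
    moreover have "shift p a \<in> J" if "prime p" "a \<in> J" for p a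
      using that B_shift prime_ge_1_nat[OF that(1)] J_sub shift_in by (auto simp: J_def)
    moreover have "B p a \<in> J" if "prime p" "a \<in> J" for p a
    proof -
      have aK: "a \<in> K" using that J_sub by blast
      have p1: "p \<ge> 1" using prime_ge_1_nat[OF that(1)] .
      have "ip natm (B p a) (shift n f) = 0" if n: "n \<ge> 1" for n
      proof -
        have "ip natm (shift n f) (B p a) = ip natm (shift (p * n) f) a"
          using adjoint[OF \<open>prime p\<close> nf[OF n] aK] p1 by (simp add: shift_shift)
        also have "\<dots> = cnj (ip natm a (shift (p * n) f))" by (rule ip_cnj)
        also have "\<dots> = 0" using \<open>a \<in> J\<close> p1 n by (simp add: J_def)
        finally show ?thesis using ip_cnj[of natm "B p a" "shift n f"] by simp
      qed
      then show ?thesis using adjoint_in[OF that(1) aK] by (simp add: J_def)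
    qed
    ultimately obtain g0 where g0: "g0 \<in> J" "g0 \<noteq> (\<lambda>n. 0)" "\<And>p. prime p \<Longrightarrow> B p g0 = (\<lambda>n. 0)"
      using exists_common_kernel_vector[OF J_closed J_sub] by blast
    obtain g where g: "g \<in> J" "ip natm g g = 1" "\<And>p. prime p \<Longrightarrow> B p g = (\<lambda>n. 0)"
      using normalise_kernel_vector[OF J_closed J_sub g0] by blast
    have gK: "g \<in> K" using g(1) J_sub by blast
    \<comment> \<open>The diagonal case left open by \<open>shift_kernel_orthogonal\<close>: equal
      shifts reduce to \<open>f\<close> and \<open>g\<close> themselves, and \<open>g\<close> lies
      in the complement of the shifts of \<open>f\<close>.\<close>
    have fg: "ip natm f g = 0"
      using g(1) ip_cnj[of natm f g] by (auto simp: J_def dest: spec[of _ 1])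
    show False
    proof (rule shift_orthonormal_not_orthogonal)
      show "orthonormal natm (\<lambda>n. shift n f)" by fact
      show "orthonormal natm (\<lambda>n. shift n g)" using kernel_orthonormal[OF gK g(3,2)] .
      show "f 0 = 0" "g 0 = 0" using at_0 f(1) gK by auto
      show "ip natm (shift n f) (shift m g) = 0" if "n \<ge> 1" "m \<ge> 1" for n m
        using shift_kernel_orthogonal[OF f(1,3) gK g(3) that] ip_shift[OF that(1) in_lsq[OF f(1)] in_lsq[OF gK]] fg
        by (cases "n = m") auto
    qed
  qed
  then have J_zero: "a = (\<lambda>n. 0)" if "a \<in> J" for a using that by blast
  have "K \<subseteq> closed_span natm (\<lambda>n. shift n f)"
  proof
    fix a assume a: "a \<in> K"
    obtain h where h: "h \<in> lsq natm"
        "(\<lambda>N. nrm natm (\<lambda>x. h x - (\<Sum>n=1..N. ip natm a (shift n f) * shift n f x))) \<longlonglongrightarrow> 0"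
        "\<And>n. n \<ge> 1 \<Longrightarrow> ip natm (\<lambda>x. a x - h x) (shift n f) = 0"
      using orthonormal_projection[OF on in_lsq[OF a]] by blast
    have "h \<in> K"
      by (rule closed_subspace_limit[OF closed h(1) _ h(2)])
        (intro closed_subspace_lincomb[OF closed] nf, auto)
    then have "(\<lambda>x. a x - h x) \<in> J"
      using closed_subspace_diff[OF closed a] h(3) by (simp add: J_def)
    from J_zero[OF this] have "h = a" by (metis eq_iff_diff_eq_0 ext)
    show "a \<in> closed_span natm (\<lambda>n. shift n f)"
      unfolding closed_span_def
    proof (intro CollectI conjI allI impI)
      show "a \<in> lsq natm" using in_lsq[OF a] .
      fix \<epsilon> :: real assume "\<epsilon> > 0"
      from LIMSEQ_D[OF h(2) this] obtain N
        where "nrm natm (\<lambda>x. h x - (\<Sum>n=1..N. ip natm a (shift n f) * shift n f x)) < \<epsilon>"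
        by auto
      then show "\<exists>N c. nrm natm (\<lambda>x. a x - (\<Sum>n=1..N. c n * shift n f x)) < \<epsilon>"
        unfolding \<open>h = a\<close> by (intro exI)
    qed
  qed
  moreover have "closed_span natm (\<lambda>n. shift n f) \<subseteq> K"
    by (rule closed_span_subset[OF closed nf])
  ultimately show ?thesis using f(1) on by blast
qed

end

section \<open>Sine expansions on the unit interval\<close>

lemma L2_eq_lsq: "L2 = lsq unit_measure"
  and L2_inner_eq_ip: "L2_inner = ip unit_measure"
  and L2_norm_eq_nrm: "L2_norm = nrm unit_measure"
  by (simp_all add: fun_eq_iff L2_def lsq_def L2_inner_def ip_def L2_norm_def nrm_def)

lemma L2_orthonormal_iff: "L2_orthonormal u \<longleftrightarrow> orthonormal unit_measure u"
  by (simp add: L2_orthonormal_def orthonormal_def L2_eq_lsq L2_inner_eq_ip)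

lemma L2_closed_span_eq: "L2_closed_span u = closed_span unit_measure u"
  by (simp add: L2_closed_span_def closed_span_def L2_eq_lsq L2_norm_eq_nrm)

lemma space_unit_measure [simp]: "space unit_measure = {0<..<1}"
  by (simp add: space_restrict_space)

lemma emeasure_unit_measure [simp]: "emeasure unit_measure {0<..<1} = 1"
  by (simp add: emeasure_restrict_space)

lemma finite_measure_unit_measure: "finite_measure unit_measure"
  by (rule finite_measureI) simp

lemma measure_unit_measure [simp]: "measure unit_measure {0<..<1} = 1"
  by (simp add: measure_def)

lemma borel_measurable_unit_measure [intro]: "f \<in> borel_measurable borel \<Longrightarrow> f \<in> borel_measurable unit_measure"
  by (rule measurable_restrict_space1) simp

lemma bounded_lsq_unit_measure:
  assumes "f \<in> borel_measurable borel" "\<And>x. 0 < x \<Longrightarrow> x < 1 \<Longrightarrow> cmod (f x) \<le> C"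
  shows "f \<in> lsq unit_measure" "nrm unit_measure f \<le> C"
proof -
  interpret finite_measure unit_measure by (rule finite_measure_unit_measure)
  have f: "f \<in> borel_measurable unit_measure" using assms(1) by auto
  have bound: "AE x in unit_measure. (cmod (f x))\<^sup>2 \<le> C\<^sup>2"
    by (rule AE_I2) (use assms(2) in \<open>auto intro!: power_mono\<close>)
  have int: "integrable unit_measure (\<lambda>x. (cmod (f x))\<^sup>2)"
    by (rule integrable_const_bound[of _ "C\<^sup>2"]) (use bound f in auto)
  with f show "f \<in> lsq unit_measure" by (simp add: lsq_def)
  have "C \<ge> 0" using assms(2)[of "1/2"] norm_ge_zero[of "f (1/2)"] by linarith
  have "(LINT x|unit_measure. (cmod (f x))\<^sup>2) \<le> (LINT x|unit_measure. C\<^sup>2)"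
    by (rule integral_mono_AE) (use int bound in auto)
  then show "nrm unit_measure f \<le> C"
    using \<open>C \<ge> 0\<close> by (simp add: nrm_def real_le_lsqrt)
qed

lemma integral_unit_measure_FTC:
  assumes "\<And>x. (F has_real_derivative f x) (at x)" "continuous_on UNIV f"
  shows "(LINT x|unit_measure. f x) = F 1 - F 0"
proof -
  have "(LBINT x=ereal 0..ereal 1. f x) = F 1 - F 0"
    by (rule interval_integral_FTC_finite)
      (use assms in \<open>auto intro: continuous_on_subset
        simp: has_real_derivative_iff_has_vector_derivative[symmetric] has_field_derivative_at_within\<close>)
  then show ?thesis
    unfolding interval_lebesgue_integral_def einterval_eq set_lebesgue_integral_def
    by (simp add: integral_restrict_space)
qed

lemma integral_cos_unit_measure:
  assumes "k \<in> \<int>"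
  shows "(LINT x|unit_measure. cos (pi * k * x)) = (if k = 0 then 1 else 0)"
proof (cases "k = 0")
  case False
  have "(LINT x|unit_measure. cos (pi * k * x)) = sin (pi * k * 1) / (pi * k) - sin (pi * k * 0) / (pi * k)"
    by (rule integral_unit_measure_FTC)
      (use False in \<open>auto intro!: derivative_eq_intros continuous_intros\<close>)
  also have "sin (pi * k * 1) = 0"
    using assms by (auto elim!: Ints_cases simp: sin_zero_iff_int2 mult.commute)
  finally show ?thesis using False by simp
qed simp

section \<open>The sine system: orthonormality and completeness\<close>

lemma cmod_sine_basis_le: "cmod (sine_basis n x) \<le> sqrt 2"
proof -
  have "sqrt 2 * \<bar>sin (pi * of_nat n * x)\<bar> \<le> sqrt 2 * 1"
    by (intro mult_left_mono) auto
  then show ?thesis by (simp add: sine_basis_def norm_mult abs_mult del: of_real_mult)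
qed

lemma sine_basis_measurable [measurable]: "sine_basis n \<in> borel_measurable borel"
  unfolding sine_basis_def by measurable

lemma sine_basis_lsq: "sine_basis n \<in> lsq unit_measure"
  by (rule bounded_lsq_unit_measure(1)[where C = "sqrt 2"]) (auto simp: cmod_sine_basis_le)

lemma sine_basis_0 [simp]: "sine_basis 0 = (\<lambda>x. 0)"
  by (simp add: sine_basis_def fun_eq_iff)

text \<open>The product formula for sines leaves cosines of the integer frequencies
  \<open>m - n\<close> and \<open>m + n\<close>. Only frequency zero has a nonzero integral, and
  \<open>m + n\<close> is positive.\<close>

lemma orthonormal_sine_basis: "orthonormal unit_measure sine_basis"
  unfolding orthonormal_def
proof (intro conjI allI impI sine_basis_lsq)
  fix m n :: nat assume mn: "1 \<le> m" "1 \<le> n"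
  have int: "integrable unit_measure (\<lambda>x. cos (pi * k * x))" for k
    by (rule finite_measure.integrable_const_bound[OF finite_measure_unit_measure, of _ 1])
      (auto intro!: borel_measurable_unit_measure)
  have "sine_basis m x * cnj (sine_basis n x)
      = of_real (cos (pi * (real m - real n) * x) - cos (pi * (real m + real n) * x))" for x
  proof -
    have "2 * (sin (pi * real m * x) * sin (pi * real n * x))
        = cos (pi * real m * x - pi * real n * x) - cos (pi * real m * x + pi * real n * x)"
      by (simp add: sin_times_sin)
    moreover have "sqrt 2 * sin (pi * real m * x) * (sqrt 2 * sin (pi * real n * x))
        = 2 * (sin (pi * real m * x) * sin (pi * real n * x))" by simp
    ultimately have "sqrt 2 * sin (pi * real m * x) * (sqrt 2 * sin (pi * real n * x))
        = cos (pi * (real m - real n) * x) - cos (pi * (real m + real n) * x)"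
      by (simp only: left_diff_distrib right_diff_distrib distrib_left distrib_right)
    then show ?thesis
      unfolding sine_basis_def complex_cnj_complex_of_real of_real_mult[symmetric] by (rule arg_cong)
  qed
  then have "ip unit_measure (sine_basis m) (sine_basis n)
      = of_real (LINT x|unit_measure. cos (pi * (real m - real n) * x) - cos (pi * (real m + real n) * x))"
    unfolding ip_def by (simp only: integral_complex_of_real)
  also have "(LINT x|unit_measure. cos (pi * (real m - real n) * x) - cos (pi * (real m + real n) * x))
      = (if m = n then 1 else 0)"
    using mn by (subst Bochner_Integration.integral_diff[OF int int])
      (simp add: integral_cos_unit_measure Ints_diff Ints_add)
  finally show "ip unit_measure (sine_basis m) (sine_basis n) = (if m = n then 1 else 0)" by simp
qed

text \<open>The half-lines form an intersection-stable generator of the Borel sets, so by a Dynkin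
  argument the integral of \<open>G\<close> vanishes over every Borel set. \<open>total\<close> is
  what closes the induction under complements.\<close>

lemma AE_zero_if_integral_lessThan_zero:
  fixes G :: "real \<Rightarrow> complex"
  assumes G: "integrable lborel G" and total: "(LINT x|lborel. G x) = 0"
    and zero: "\<And>b. (LINT x:{..<b}|lborel. G x) = 0"
  shows "AE x in lborel. G x = 0"
proof (rule sigma_finite_measure.density_zero[OF sigma_finite_lborel G])
  fix A :: "real set" assume "A \<in> sets lborel"
  then have A: "A \<in> sigma_sets UNIV (range lessThan)"
    by (simp add: borel_Iio)
  have "{..<a} \<inter> {..<b} = {..<min a b}" for a b :: real by auto
  then have "Int_stable (range (lessThan :: real \<Rightarrow> real set))"
    by (auto simp: Int_stable_def)
  moreover have "range (lessThan :: real \<Rightarrow> real set) \<subseteq> Pow UNIV" by simp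
  moreover note A
  ultimately show "(LINT x:A|lborel. G x) = 0"
  proof (induction rule: sigma_sets_induct_disjoint)
    case (basic A)
    then show ?case using zero by auto
  next
    case empty
    then show ?case by (simp add: set_lebesgue_integral_def)
  next
    case (compl A)
    have A: "A \<in> sets lborel" using compl(1) by (simp add: borel_Iio)
    have "(LINT x:UNIV - A|lborel. G x) = (LINT x|lborel. G x - indicator A x *\<^sub>R G x)"
      unfolding set_lebesgue_integral_def
      by (rule Bochner_Integration.integral_cong) (auto simp: indicator_def)
    also have "\<dots> = (LINT x|lborel. G x) - (LINT x:A|lborel. G x)"
      unfolding set_lebesgue_integral_def
      by (rule Bochner_Integration.integral_diff[OF G integrable_mult_indicator[OF A G]])
    finally show ?case using total compl(2) by simp
  next
    case (union A)
    have A: "A i \<in> sets lborel" for i using union(2) by (auto simp: borel_Iio image_subset_iff)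
    have "(LINT x:(\<Union>i. A i)|lborel. G x) = (\<Sum>i. LINT x:A i|lborel. G x)"
    proof (rule lebesgue_integral_countable_add[OF A])
      show "A i \<inter> A j = {}" if "i \<noteq> j" for i j
        using union(1) that by (auto simp: disjoint_family_on_def)
      show "set_integrable lborel (\<Union>i. A i) G"
        unfolding set_integrable_def by (rule integrable_mult_indicator[OF _ G]) (use A in auto)
    qed
    with union(3) show ?case by simp
  qed
qed

text \<open>After Weierstrass, \<open>f\<close> is orthogonal to
  \<open>sin (pi * x) * H (cos (pi * x))\<close> for every continuous \<open>H\<close>. Letting
  \<open>H\<close> tend to the indicator of \<open>{y. t < y}\<close> and using that
  \<open>cos (pi * x)\<close> decreases on the interval, \<open>f x * sin (pi * x)\<close>
  integrates to zero over every initial segment, hence vanishes almost everywhere; the sine factor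
  is positive there.\<close>

lemma sine_basis_orthogonal_AE_zero:
  assumes f: "f \<in> lsq unit_measure" and orth: "\<And>n. n \<ge> 1 \<Longrightarrow> ip unit_measure f (sine_basis n) = 0"
  shows "AE x in unit_measure. f x = 0"
proof -
  have bounded: "(\<lambda>x. of_real (h x)) \<in> lsq unit_measure" "nrm unit_measure (\<lambda>x. of_real (h x)) \<le> C"
    if "h \<in> borel_measurable borel" "\<And>x. \<bar>h x\<bar> \<le> C" for h :: "real \<Rightarrow> real" and C
    by (rule bounded_lsq_unit_measure[of _ C]; use that in simp)+
  have trig: "(\<lambda>x. of_real (sin (pi * real n * x) * cos (pi * x) ^ k)) \<in> lsq unit_measure" for n k
  proof (rule bounded(1)[of _ 1])
    have "\<bar>cos (pi * x)\<bar> ^ k \<le> 1" for x by (intro power_le_one) auto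
    then have "\<bar>sin (pi * real n * x)\<bar> * \<bar>cos (pi * x)\<bar> ^ k \<le> 1 * 1" for x by (intro mult_mono) auto
    then show "\<bar>sin (pi * real n * x) * cos (pi * x) ^ k\<bar> \<le> 1" for x
      by (simp add: abs_mult power_abs)
  qed measurable
  \<comment> \<open>A factor \<open>cos (pi * x)\<close> turns frequency \<open>n\<close> into the
    mean of the frequencies \<open>n + 1\<close> and \<open>n - 1\<close>, so induction on the power
    reduces everything to pure sines; frequency 0 is the zero function.\<close>
  have monomial: "ip unit_measure f (\<lambda>x. of_real (sin (pi * real n * x) * cos (pi * x) ^ k)) = 0" for n k
  proof (induction k arbitrary: n)
    case 0
    show ?case
    proof (cases "n = 0")
      case False
      have "(\<lambda>x. complex_of_real (sin (pi * real n * x) * cos (pi * x) ^ 0))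
          = (\<lambda>x. of_real (1 / sqrt 2) * sine_basis n x)"
        by (simp add: sine_basis_def fun_eq_iff)
      then show ?thesis using orth[of n] False by (simp only: ip_scale_right) simp
    qed simp
  next
    case (Suc k)
    show ?case
    proof (cases n)
      case (Suc l)
      have "sin (pi * real n * x) * cos (pi * x) ^ Suc k
          = 1/2 * (sin (pi * real (Suc n) * x) * cos (pi * x) ^ k + sin (pi * real l * x) * cos (pi * x) ^ k)" for x
      proof -
        have "sin (pi * real n * x) * cos (pi * x)
            = (sin (pi * real n * x + pi * x) + sin (pi * real n * x - pi * x)) / 2"
          by (rule sin_times_cos)
        also have "pi * real n * x + pi * x = pi * real (Suc n) * x" by (simp add: algebra_simps)
        also have "pi * real n * x - pi * x = pi * real l * x" by (simp add: algebra_simps Suc)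
        finally have *: "sin (pi * real n * x) * cos (pi * x)
            = (sin (pi * real (Suc n) * x) + sin (pi * real l * x)) / 2" .
        have "sin (pi * real n * x) * cos (pi * x) ^ Suc k
            = (sin (pi * real n * x) * cos (pi * x)) * cos (pi * x) ^ k" by simp
        then show ?thesis unfolding * by (simp add: distrib_right)
      qed
      then have "(\<lambda>x. complex_of_real (sin (pi * real n * x) * cos (pi * x) ^ Suc k))
          = (\<lambda>x. of_real (1/2) * (of_real (sin (pi * real (Suc n) * x) * cos (pi * x) ^ k)
              + of_real (sin (pi * real l * x) * cos (pi * x) ^ k)))"
        by (simp only: of_real_mult of_real_add)
      then show ?thesis
        by (simp only: ip_scale_right ip_add_right[OF trig trig f] Suc.IH) simp
    qed simp
  qed
  have continuous: "ip unit_measure f (\<lambda>x. of_real (sin (pi * x) * H (cos (pi * x)))) = 0"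
    if H: "continuous_on UNIV H" for H :: "real \<Rightarrow> real"
  proof (rule ccontr)
    let ?h = "\<lambda>H x. complex_of_real (sin (pi * x) * H (cos (pi * x)))"
    assume neq: "ip unit_measure f (?h H) \<noteq> 0"
    have pos: "nrm unit_measure f + 1 > 0" using nrm_nonneg[of unit_measure f] by linarith
    define e where "e = cmod (ip unit_measure f (?h H)) / (nrm unit_measure f + 1)"
    have "e > 0" using neq pos by (simp add: e_def)
    then obtain P where P: "real_polynomial_function P" "\<And>y. y \<in> {-1..1} \<Longrightarrow> \<bar>H y - P y\<bar> < e"
      using Stone_Weierstrass_real_polynomial_function[of "{-1..1::real}" H e] H
      by (metis compact_Icc continuous_on_subset subset_UNIV)
    obtain a n where a: "P = (\<lambda>y. \<Sum>i\<le>n. a i * y ^ i)"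
      using real_polynomial_function_imp_sum[OF P(1)] by blast
    have "?h P = (\<lambda>x. \<Sum>i\<le>n. of_real (a i) * of_real (sin (pi * real 1 * x) * cos (pi * x) ^ i))"
      unfolding a of_real_mult[symmetric] of_real_sum[symmetric]
      by (simp add: sum_distrib_left mult_ac)
    then have hP: "?h P \<in> lsq unit_measure" "ip unit_measure f (?h P) = 0"
      by (simp_all only: lsq_lincomb[OF trig] ip_lincomb_right[OF f trig] monomial) simp
    have [measurable]: "H \<in> borel_measurable borel" "P \<in> borel_measurable borel"
      using H P(1) by (auto intro!: borel_measurable_continuous_onI continuous_real_polymonial_function
          simp: continuous_on_eq_continuous_at)
    have le: "\<bar>sin (pi * x) * (H (cos (pi * x)) - P (cos (pi * x)))\<bar> \<le> e" for x
    proof -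
      have "\<bar>sin (pi * x)\<bar> * \<bar>H (cos (pi * x)) - P (cos (pi * x))\<bar> \<le> 1 * e"
        using P(2)[of "cos (pi * x)"] by (intro mult_mono) auto
      then show ?thesis by (simp add: abs_mult)
    qed
    have d: "(\<lambda>x. of_real (sin (pi * x) * (H (cos (pi * x)) - P (cos (pi * x))))) \<in> lsq unit_measure"
        "nrm unit_measure (\<lambda>x. of_real (sin (pi * x) * (H (cos (pi * x)) - P (cos (pi * x))))) \<le> e"
      by (rule bounded; use le in measurable)+
    have split: "?h H = (\<lambda>x. of_real (sin (pi * x) * (H (cos (pi * x)) - P (cos (pi * x)))) + ?h P x)"
      by (simp add: fun_eq_iff algebra_simps)
    have "ip unit_measure f (?h H) =
        ip unit_measure f (\<lambda>x. of_real (sin (pi * x) * (H (cos (pi * x)) - P (cos (pi * x)))))"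
      by (subst split, subst ip_add_right[OF d(1) hP(1) f]) (simp add: hP(2) del: of_real_mult of_real_diff)
    then have "cmod (ip unit_measure f (?h H)) \<le> nrm unit_measure f * e"
      using Cauchy_Schwarz_lsq[OF f d(1)] mult_left_mono[OF d(2) nrm_nonneg[of unit_measure f]]
      by (simp del: of_real_mult of_real_diff)
    also have "\<dots> < (nrm unit_measure f + 1) * e" using \<open>e > 0\<close> by simp
    also have "\<dots> = cmod (ip unit_measure f (?h H))" using pos by (simp add: e_def)
    finally show False by simp
  qed
  define g where "g = (\<lambda>x. f x * of_real (sin (pi * x)))"
  have sin_lsq: "(\<lambda>x. of_real (sin (pi * x))) \<in> lsq unit_measure"
    by (rule bounded(1)[of _ 1]) auto
  have g_int: "integrable unit_measure g"
    using lsq_mult_integrable[OF f sin_lsq] by (simp add: g_def)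
  have g_meas [measurable]: "g \<in> borel_measurable unit_measure"
    using g_int by (rule borel_measurable_integrable)
  have upper: "(LINT x|unit_measure. indicator {y. t < y} (cos (pi * x)) *\<^sub>R g x) = 0" for t
  proof (rule LIMSEQ_unique[OF _ tendsto_const])
    \<comment> \<open>Ramps of slope \<open>k\<close> clipped to values between 0 and 1: continuous,
      bounded by 1 and pointwise convergent to the indicator of \<open>{y. t < y}\<close>, so that
      \<open>norm (g x)\<close> dominates.\<close>
    define H where "H k y = min 1 (max 0 (real k * (y - t)))" for k y
    have H_cont: "continuous_on UNIV (H k)" for k
      unfolding H_def by (intro continuous_intros)
    have H_meas [measurable]: "H k \<in> borel_measurable borel" for k
      using H_cont by (rule borel_measurable_continuous_onI)
    have "(\<lambda>k. LINT x|unit_measure. H k (cos (pi * x)) *\<^sub>R g x)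
        \<longlonglongrightarrow> (LINT x|unit_measure. indicator {y. t < y} (cos (pi * x)) *\<^sub>R g x)"
    proof (rule integral_dominated_convergence[where w = "\<lambda>x. norm (g x)"])
      show "AE x in unit_measure. (\<lambda>k. H k (cos (pi * x)) *\<^sub>R g x) \<longlonglongrightarrow> indicator {y. t < y} (cos (pi * x)) *\<^sub>R g x"
      proof (intro AE_I2 tendsto_scaleR tendsto_const)
        fix x
        show "(\<lambda>k. H k (cos (pi * x))) \<longlonglongrightarrow> indicator {y. t < y} (cos (pi * x))"
        proof (cases "t < cos (pi * x)")
          case True
          obtain k0 where k0: "1 < real k0 * (cos (pi * x) - t)"
            using ex_less_of_nat_mult[of "cos (pi * x) - t" 1] True by auto
          have "H k (cos (pi * x)) = 1" if "k \<ge> k0" for k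
          proof -
            have "real k0 * (cos (pi * x) - t) \<le> real k * (cos (pi * x) - t)"
              using that True by (intro mult_right_mono) auto
            with k0 show ?thesis by (simp add: H_def)
          qed
          then show ?thesis using True
            by (intro tendsto_eventually eventually_sequentiallyI[of k0]) simp
        next
          case False
          then have "H k (cos (pi * x)) = 0" for k
            by (simp add: H_def mult_nonneg_nonpos max_absorb1)
          then show ?thesis using False by simp
        qed
      qed
      have "\<bar>H k y\<bar> \<le> 1" for k y by (simp add: H_def)
      then show "AE x in unit_measure. norm (H k (cos (pi * x)) *\<^sub>R g x) \<le> norm (g x)" for k
        by (intro AE_I2) (simp add: mult_left_le_one_le)
      show "integrable unit_measure (\<lambda>x. norm (g x))" using g_int by simp
      have m1: "(\<lambda>x. H k (cos (pi * x))) \<in> borel_measurable unit_measure" for k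
        by (intro borel_measurable_unit_measure) measurable
      show "(\<lambda>x. H k (cos (pi * x)) *\<^sub>R g x) \<in> borel_measurable unit_measure" for k
        by (intro borel_measurable_scaleR m1 g_meas)
      have m2: "(\<lambda>x. indicator {y. t < y} (cos (pi * x)) :: real) \<in> borel_measurable unit_measure"
        by (intro borel_measurable_unit_measure) measurable
      show "(\<lambda>x. indicator {y. t < y} (cos (pi * x)) *\<^sub>R g x) \<in> borel_measurable unit_measure"
        by (intro borel_measurable_scaleR m2 g_meas)
    qed
    moreover have "(LINT x|unit_measure. H k (cos (pi * x)) *\<^sub>R g x) = 0" for k
      using continuous[OF H_cont, of k] by (simp add: ip_def g_def scaleR_conv_of_real mult_ac)
    ultimately show "(\<lambda>k::nat. 0) \<longlonglongrightarrow> (LINT x|unit_measure. indicator {y. t < y} (cos (pi * x)) *\<^sub>R g x)"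
      by simp
  qed
  define G where "G = (\<lambda>x. indicator {0<..<1} x *\<^sub>R g x)"
  have G_int: "integrable lborel G"
    using g_int unfolding G_def by (subst (asm) integrable_restrict_space) auto
  have zero: "(LINT x:{..<b}|lborel. G x) = 0" for b
  proof -
    \<comment> \<open>For \<open>b\<close> outside the open interval the level is one that
      \<open>cos (pi * x)\<close> never exceeds there (1) or always exceeds (-1), giving the empty
      and the full segment.\<close>
    define t where "t = (if b \<le> 0 then 1 else if b \<ge> 1 then - 1 else cos (pi * b))"
    have "indicator {..<b} x = (indicator {y. t < y} (cos (pi * x)) :: real)" if x: "0 < x" "x < 1" for x
    proof -
      have range: "0 < pi * x" "pi * x < pi" using x by auto
      have "x < b \<longleftrightarrow> t < cos (pi * x)"
      proof -
        consider "b \<le> 0" | "b \<ge> 1" | "0 < b" "b < 1" by linarith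
        then show ?thesis
        proof cases
          case 1
          then show ?thesis using x cos_le_one[of "pi * x"] by (simp add: t_def not_less)
        next
          case 2
          have "cos pi < cos (pi * x)" using range by (intro cos_monotone_0_pi) auto
          then show ?thesis using 2 x by (simp add: t_def)
        next
          case 3
          have "t < cos (pi * x) \<longleftrightarrow> pi * x < pi * b"
            using cos_mono_less_eq[of "pi * b" "pi * x"] 3 range by (simp add: t_def)
          then show ?thesis by simp
        qed
      qed
      then show ?thesis by (simp add: indicator_def)
    qed
    then have "(LINT x:{..<b}|lborel. G x)
        = (LINT x|lborel. indicator {0<..<1} x *\<^sub>R (indicator {y. t < y} (cos (pi * x)) *\<^sub>R g x))"
      unfolding set_lebesgue_integral_def G_def
      by (intro Bochner_Integration.integral_cong) (auto simp: indicator_def)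
    also have "\<dots> = 0"
      using upper[of t] by (subst (asm) integral_restrict_space) auto
    finally show ?thesis .
  qed
  have "(LINT x|lborel. G x) = (LINT x:{..<1}|lborel. G x)"
    unfolding set_lebesgue_integral_def G_def
    by (intro Bochner_Integration.integral_cong) (auto simp: indicator_def)
  then have "AE x in lborel. G x = 0"
    using AE_zero_if_integral_lessThan_zero[OF G_int] zero by simp
  then have "AE x in unit_measure. g x = 0"
    by (subst AE_restrict_space_iff) (auto simp: G_def elim!: eventually_mono)
  moreover have "AE x in unit_measure. sin (pi * x) \<noteq> 0"
  proof (rule AE_I2)
    fix x assume "x \<in> space unit_measure"
    then have "sin (pi * x) > 0" by (intro sin_gt_zero) auto
    then show "sin (pi * x) \<noteq> 0" by simp
  qed
  ultimately show ?thesis by eventually_elim (simp add: g_def)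
qed

section \<open>Dirichlet series with square-summable coefficients\<close>

lemma square_summable_iff:
  assumes "a 0 = 0"
  shows "square_summable a \<longleftrightarrow> a \<in> lsq natm"
proof -
  have "(\<lambda>n. (cmod (a n))\<^sup>2) summable_on {1..} \<longleftrightarrow> (\<lambda>n. (cmod (a n))\<^sup>2) summable_on UNIV"
    by (rule summable_on_cong_neutral) (use assms in \<open>auto simp: Suc_le_eq\<close>)
  also have "\<dots> \<longleftrightarrow> summable (\<lambda>n. (cmod (a n))\<^sup>2)"
    by (rule summable_on_UNIV_nonneg_real_iff) simp
  finally show ?thesis by (simp add: square_summable_def lsq_natm_iff)
qed

lemma square_summable_fun_upd: "square_summable (a(0 := 0)) \<longleftrightarrow> square_summable a"
  unfolding square_summable_def by (rule summable_on_cong) simp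

lemma dirichlet_series_fun_upd: "dirichlet_series (a(0 := 0)) = dirichlet_series a"
  unfolding dirichlet_series_def by (auto simp: fun_eq_iff intro!: infsum_cong)

text \<open>The normalisation at index 0 is that of \<open>H2_coeff\<close>; it makes
  \<open>dirichlet_series\<close> injective.\<close>

definition seqs :: "(nat \<Rightarrow> complex) set" where
  "seqs = {a \<in> lsq natm. a 0 = 0}"

lemma seqs_fun_upd: "square_summable a \<Longrightarrow> a(0 := 0) \<in> seqs"
  by (simp add: seqs_def square_summable_fun_upd flip: square_summable_iff)

lemma H2_eq: "H2 = dirichlet_series ` seqs"
proof
  show "H2 \<subseteq> dirichlet_series ` seqs"
    unfolding H2_def
    by (auto intro!: rev_image_eqI[OF seqs_fun_upd] simp: dirichlet_series_fun_upd)
  show "dirichlet_series ` seqs \<subseteq> H2"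
    by (auto simp: H2_def seqs_def square_summable_iff)
qed

lemma cmod_of_nat_powr: "n \<ge> 1 \<Longrightarrow> cmod (of_nat n powr s) = real n powr Re s"
  using norm_powr_real_powr[of "of_nat n" s] by simp

text \<open>Each term is at most \<open>(cmod (a n))\<^sup>2\<close> plus \<open>n\<close> to the
  power \<open>- 2 * Re s\<close>, and \<open>2 * Re s > 1\<close>.\<close>

lemma dirichlet_terms_summable:
  assumes "a \<in> lsq natm" "Re s > 1/2"
  shows "summable (\<lambda>n. cmod (a n * of_nat n powr - s))"
proof (rule summable_comparison_test')
  have "summable (\<lambda>n. real n powr (- 2 * Re s))"
    using assms(2) by (simp add: summable_real_powr_iff)
  then show "summable (\<lambda>n. (cmod (a n))\<^sup>2 + real n powr (- 2 * Re s))"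
    using assms(1) by (intro summable_add) (simp_all add: lsq_natm_iff)
  fix n :: nat assume "n \<ge> 1"
  then have "cmod (a n * of_nat n powr - s) = cmod (a n) * real n powr (- Re s)"
    using cmod_of_nat_powr[of n "- s"] by (simp add: norm_mult)
  moreover have "(real n powr (- Re s))\<^sup>2 = real n powr (- 2 * Re s)"
    unfolding power2_eq_square powr_add[symmetric] by simp
  moreover have "x * y \<le> x\<^sup>2 + y\<^sup>2" if "0 \<le> x" "0 \<le> y" for x y :: real
    using sum_squares_bound[of x y] mult_nonneg_nonneg[OF that] by linarith
  from this[of "cmod (a n)" "real n powr (- Re s)"]
  have "cmod (a n) * real n powr (- Re s) \<le> (cmod (a n))\<^sup>2 + (real n powr (- Re s))\<^sup>2" by simp
  ultimately show "norm (cmod (a n * of_nat n powr - s)) \<le> (cmod (a n))\<^sup>2 + real n powr (- 2 * Re s)"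
    by simp
qed

lemma dirichlet_terms_summable_on:
  assumes "a \<in> lsq natm" "Re s > 1/2"
  shows "(\<lambda>n. a n * of_nat n powr - s) summable_on A"
proof -
  have "(\<lambda>n. a n * of_nat n powr - s) summable_on UNIV"
    using dirichlet_terms_summable[OF assms] by (rule norm_summable_imp_summable_on)
  then show ?thesis using summable_on_subset_banach by blast
qed

lemma dirichlet_series_add:
  assumes "a \<in> lsq natm" "b \<in> lsq natm"
  shows "dirichlet_series (\<lambda>n. a n + b n) = (\<lambda>s. dirichlet_series a s + dirichlet_series b s)"
  using assms
  by (auto simp: fun_eq_iff dirichlet_series_def distrib_right infsum_add dirichlet_terms_summable_on)

lemma dirichlet_series_scale:
  "dirichlet_series (\<lambda>n. c * a n) = (\<lambda>s. c * dirichlet_series a s)"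
  by (auto simp: fun_eq_iff dirichlet_series_def mult.assoc infsum_cmult_right')

lemma dirichlet_series_diff:
  assumes "a \<in> lsq natm" "b \<in> lsq natm"
  shows "dirichlet_series (\<lambda>n. a n - b n) = (\<lambda>s. dirichlet_series a s - dirichlet_series b s)"
  using dirichlet_series_add[OF assms(1) lsq_scale[OF assms(2), of "-1"]]
  by (simp only: dirichlet_series_scale) simp

lemma dirichlet_series_zero: "dirichlet_series (\<lambda>n. 0) = (\<lambda>s. 0)"
  by (simp add: dirichlet_series_def fun_eq_iff)

lemma dirichlet_series_shift:
  assumes n: "n \<ge> 1" and a: "a 0 = 0"
  shows "dirichlet_series (shift n a) = \<Lambda> n (dirichlet_series a)"
proof
  fix s
  show "dirichlet_series (shift n a) s = \<Lambda> n (dirichlet_series a) s"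
  proof (cases "Re s > 1/2")
    case True
    have inj: "inj_on ((*) n) {1..}" using n by (auto intro: inj_onI)
    have "(\<Sum>\<^sub>\<infinity>m\<in>{1..}. shift n a m * of_nat m powr - s)
        = (\<Sum>\<^sub>\<infinity>m\<in>(*) n ` {1..}. shift n a m * of_nat m powr - s)"
    proof (rule infsum_cong_neutral)
      fix m :: nat assume m: "m \<in> {1..} - (*) n ` {1..}"
      have "\<not> n dvd m"
      proof
        assume "n dvd m"
        then obtain k where k: "m = n * k" by blast
        then have "k \<ge> 1" using m by (cases k) auto
        then show False using m k by auto
      qed
      then show "shift n a m * of_nat m powr - s = 0" by (simp add: shift_def)
    qed (use n in auto)
    also have "\<dots> = (\<Sum>\<^sub>\<infinity>k\<in>{1..}. of_nat n powr - s * (a k * of_nat k powr - s))"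
      unfolding infsum_reindex[OF inj] o_def
      by (intro infsum_cong, simp only: shift_mult[OF n] of_nat_mult powr_times_real Reals_of_nat
          complex_Re_of_nat of_nat_0_le_iff) (simp only: mult_ac)
    also have "\<dots> = of_nat n powr - s * (\<Sum>\<^sub>\<infinity>k\<in>{1..}. a k * of_nat k powr - s)"
      by (rule infsum_cmult_right')
    finally show ?thesis using True by (simp add: dirichlet_series_def \<Lambda>_def)
  qed (simp add: dirichlet_series_def \<Lambda>_def)
qed

text \<open>Letting \<open>s \<rightarrow> \<infinity>\<close> along the reals isolates the first nonzero coefficient.\<close>

lemma dirichlet_series_eq_0:
  assumes a: "a \<in> seqs" and zero: "dirichlet_series a = (\<lambda>s. 0)"
  shows "a = (\<lambda>n. 0)"
proof (rule ccontr)
  assume "a \<noteq> (\<lambda>n. 0)"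
  then have ex: "\<exists>n. a n \<noteq> 0" by auto
  define k where "k = (LEAST n. a n \<noteq> 0)"
  have k: "a k \<noteq> 0" "\<And>n. n < k \<Longrightarrow> a n = 0"
    unfolding k_def using LeastI_ex[OF ex] not_less_Least by blast+
  have al: "a \<in> lsq natm" and "a 0 = 0" using a by (auto simp: seqs_def)
  with k have k1: "k \<ge> 1" by (cases k) auto
  \<comment> \<open>The terms at \<open>s = 1\<close> control the tail at \<open>s = 1 + j\<close>:
    for \<open>n > k\<close> the extra exponent contributes a factor of at most \<open>Suc k\<close>
    to the power \<open>- j\<close>.\<close>
  define T where "T = (\<lambda>n. cmod (a n * of_nat n powr - 1))"
  have T: "summable T" unfolding T_def by (rule dirichlet_terms_summable[OF al]) simp
  have T_nonneg: "T n \<ge> 0" for n by (simp add: T_def)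
  \<comment> \<open>Multiplying by \<open>k\<close> to the power \<open>1 + j\<close> isolates
    \<open>a k\<close> and leaves the ratio of \<open>k\<close> to \<open>Suc k\<close> to the power
    \<open>j\<close>, which tends to zero.\<close>
  define r where "r = real k / real (Suc k)"
  have r: "0 < r" "r < 1" using k1 by (auto simp: r_def)
  have bound: "cmod (a k) \<le> real k * suminf T * r ^ j" for j
  proof -
    define s where "s = complex_of_real (1 + real j)"
    have s: "Re s > 1/2" by (simp add: s_def)
    define t where "t = (\<lambda>n. a n * of_nat n powr - s)"
    have t: "summable (\<lambda>n. norm (t n))"
      unfolding t_def by (rule dirichlet_terms_summable[OF al s])
    have "(\<Sum>\<^sub>\<infinity>n\<in>{1..}. t n) = 0"
      using fun_cong[OF zero, of s] s by (simp add: dirichlet_series_def t_def)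
    also have "(\<Sum>\<^sub>\<infinity>n\<in>{1..}. t n) = (\<Sum>\<^sub>\<infinity>n\<in>UNIV. t n)"
      by (rule infsum_cong_neutral) (use \<open>a 0 = 0\<close> in \<open>auto simp: t_def Suc_le_eq\<close>)
    also have "\<dots> = suminf t"
      using norm_summable_imp_has_sum[OF t summable_sums[OF summable_norm_cancel[OF t]]] by (rule infsumI)
    finally have sum0: "suminf t = 0" .
    have tn: "cmod (t n) = real n powr - (1 + real j) * cmod (a n)" if "n \<ge> 1" for n
      using cmod_of_nat_powr[OF that, of "- s"] by (simp add: t_def s_def norm_mult)
    have Tn: "T n = real n powr - 1 * cmod (a n)" if "n \<ge> 1" for n
      using cmod_of_nat_powr[OF that, of "-1"] by (simp add: T_def norm_mult)
    have le: "cmod ((t(k := 0)) n) \<le> real (Suc k) powr - real j * T n" for n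
    proof (cases "n > k")
      case True
      have "real n powr - (1 + real j) = real n powr - real j * real n powr - 1"
        unfolding powr_add[symmetric] by (rule arg_cong[where f = "\<lambda>z. real n powr z"]) simp
      also have "\<dots> \<le> real (Suc k) powr - real j * real n powr - 1"
        using True by (intro mult_right_mono powr_mono2') auto
      finally have "real n powr - (1 + real j) * cmod (a n)
          \<le> real (Suc k) powr - real j * real n powr - 1 * cmod (a n)"
        by (intro mult_right_mono) auto
      with True show ?thesis using tn[of n] Tn[of n] by (simp add: mult.assoc)
    next
      case False
      then show ?thesis using k(2)[of n] T_nonneg by (cases "n = k") (auto simp: t_def)
    qed
    have "suminf t = t k + suminf (t(k := 0))"
    proof -
      have "t sums suminf t" by (rule summable_sums[OF summable_norm_cancel[OF t]])
      then have "(\<lambda>n. t n - (if n = k then t n else 0)) sums (suminf t - t k)"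
        by (intro sums_diff sums_single)
      moreover have "(\<lambda>n. t n - (if n = k then t n else 0)) = t(k := 0)" by auto
      ultimately have "t(k := 0) sums (suminf t - t k)" by simp
      then have "suminf (t(k := 0)) = suminf t - t k" by (rule sums_unique[symmetric])
      then show ?thesis by simp
    qed
    then have "t k = - suminf (t(k := 0))" using sum0 by (simp add: add_eq_0_iff2)
    then have "cmod (t k) = cmod (suminf (t(k := 0)))" by simp
    also have "\<dots> \<le> (\<Sum>n. real (Suc k) powr - real j * T n)"
      by (rule norm_suminf_le[OF le summable_mult[OF T]])
    also have "\<dots> = real (Suc k) powr - real j * suminf T"
      by (rule suminf_mult[OF T])
    finally have "real k powr - (1 + real j) * cmod (a k) \<le> real (Suc k) powr - real j * suminf T"
      using tn[OF k1] by simp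
    then have "real k powr (1 + real j) * (real k powr - (1 + real j) * cmod (a k))
        \<le> real k powr (1 + real j) * (real (Suc k) powr - real j * suminf T)"
      by (rule mult_left_mono) simp
    moreover have "real k powr (1 + real j) * (real k powr - (1 + real j) * cmod (a k)) = cmod (a k)"
      using k1 by (simp flip: mult.assoc powr_add)
    moreover have "real k powr (1 + real j) * (real (Suc k) powr - real j * suminf T) = real k * suminf T * r ^ j"
    proof -
      have "real k powr (1 + real j) = real k * real k ^ j"
        using k1 by (simp add: powr_add powr_realpow)
      moreover have "real (Suc k) powr - real j = 1 / real (Suc k) ^ j"
        by (simp add: powr_minus powr_realpow inverse_eq_divide del: of_nat_Suc)
      ultimately show ?thesis by (simp add: r_def power_divide del: of_nat_Suc)
    qed
    ultimately show ?thesis by (simp only:)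
  qed
  have "(\<lambda>j. real k * suminf T * r ^ j) \<longlonglongrightarrow> real k * suminf T * 0"
    by (intro tendsto_mult tendsto_const LIMSEQ_power_zero) (use r in simp)
  then have "cmod (a k) \<le> real k * suminf T * 0"
    by (rule LIMSEQ_le_const) (use bound in blast)
  with k(1) show False by simp
qed

lemma dirichlet_series_inj:
  assumes "a \<in> seqs" "b \<in> seqs" "dirichlet_series a = dirichlet_series b"
  shows "a = b"
proof -
  have "(\<lambda>n. a n - b n) = (\<lambda>n. 0)"
    by (rule dirichlet_series_eq_0) (use assms in \<open>auto simp: seqs_def lsq_diff dirichlet_series_diff\<close>)
  then show ?thesis by (auto simp: fun_eq_iff)
qed

lemma H2_coeff_dirichlet_series:
  assumes "a \<in> seqs"
  shows "H2_coeff (dirichlet_series a) = a"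
  unfolding H2_coeff_def
proof (rule the_equality)
  show "a 0 = 0 \<and> square_summable a \<and> dirichlet_series a = dirichlet_series a"
    using assms by (auto simp: seqs_def square_summable_iff)
  show "b = a" if "b 0 = 0 \<and> square_summable b \<and> dirichlet_series a = dirichlet_series b" for b
    using that assms dirichlet_series_inj[of b a] by (auto simp: seqs_def square_summable_iff)
qed

lemma infsum_atLeast_1_eq_suminf:
  fixes f :: "nat \<Rightarrow> 'a::banach"
  assumes "f 0 = 0" "summable (\<lambda>n. norm (f n))"
  shows "(\<Sum>\<^sub>\<infinity>n\<in>{1..}. f n) = suminf f"
proof -
  have "(\<Sum>\<^sub>\<infinity>n\<in>{1..}. f n) = (\<Sum>\<^sub>\<infinity>n\<in>UNIV. f n)"
    by (rule infsum_cong_neutral) (use \<open>f 0 = 0\<close> in \<open>auto simp: Suc_le_eq\<close>)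
  also have "\<dots> = suminf f"
    using norm_summable_imp_has_sum[OF assms(2) summable_sums[OF summable_norm_cancel[OF assms(2)]]]
    by (rule infsumI)
  finally show ?thesis .
qed

lemma H2_inner_dirichlet_series:
  assumes "a \<in> seqs" "b \<in> seqs"
  shows "H2_inner (dirichlet_series a) (dirichlet_series b) = ip natm a b"
proof -
  have ab: "a \<in> lsq natm" "b \<in> lsq natm" "a 0 = 0" using assms by (auto simp: seqs_def)
  have "summable (\<lambda>n. norm (a n * cnj (b n)))"
    using lsq_mult_integrable[OF ab(1,2)] by (simp add: integrable_count_space_nat_iff)
  then show ?thesis
    unfolding H2_inner_def H2_coeff_dirichlet_series[OF assms(1)] H2_coeff_dirichlet_series[OF assms(2)]
      ip_natm[OF ab(1,2)]
    by (intro infsum_atLeast_1_eq_suminf) (simp_all add: ab(3))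
qed

lemma H2_norm_dirichlet_series:
  assumes "a \<in> seqs"
  shows "H2_norm (dirichlet_series a) = nrm natm a"
proof -
  have a: "a \<in> lsq natm" "a 0 = 0" using assms by (auto simp: seqs_def)
  then have "(\<Sum>\<^sub>\<infinity>n\<in>{1..}. (cmod (a n))\<^sup>2) = (nrm natm a)\<^sup>2"
    unfolding nrm_sq_natm[OF a(1)] by (intro infsum_atLeast_1_eq_suminf) (simp_all add: lsq_natm_iff)
  then show ?thesis
    by (simp add: H2_norm_def H2_coeff_dirichlet_series[OF assms])
qed

section \<open>The sine transform and the isomorphism with Dirichlet series\<close>

definition sine_coeff :: "(real \<Rightarrow> complex) \<Rightarrow> nat \<Rightarrow> complex" where
  "sine_coeff f n = ip unit_measure f (sine_basis n)"

lemma sine_coeff_seqs: "f \<in> lsq unit_measure \<Longrightarrow> sine_coeff f \<in> seqs"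
  unfolding sine_coeff_def seqs_def
  by (simp add: lsq_natm_iff Bessel_summable[OF orthonormal_sine_basis])

lemma sine_partial_sum_lsq: "(\<lambda>x. \<Sum>n\<in>A. c n * sine_basis n x) \<in> lsq unit_measure"
  by (intro lsq_lincomb sine_basis_lsq)

text \<open>Completeness of the sines: the projection of \<open>f\<close> differs from
  \<open>f\<close> by a function orthogonal to all sines, hence null, and \<open>nrm\<close> does
  not see null sets.\<close>

lemma sine_expansion_sine_coeff:
  assumes f: "f \<in> lsq unit_measure"
  shows "sine_expansion (sine_coeff f) f"
proof -
  obtain h where h: "h \<in> lsq unit_measure"
      "(\<lambda>N. nrm unit_measure (\<lambda>x. h x - (\<Sum>n=1..N. ip unit_measure f (sine_basis n) * sine_basis n x))) \<longlonglongrightarrow> 0"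
      "\<And>n. n \<ge> 1 \<Longrightarrow> ip unit_measure (\<lambda>x. f x - h x) (sine_basis n) = 0"
    using orthonormal_projection[OF orthonormal_sine_basis f] by blast
  have "AE x in unit_measure. f x - h x = 0"
    by (rule sine_basis_orthogonal_AE_zero[OF lsq_diff[OF f h(1)] h(3)])
  then have "nrm unit_measure (\<lambda>x. f x - (\<Sum>n=1..N. sine_coeff f n * sine_basis n x))
      = nrm unit_measure (\<lambda>x. h x - (\<Sum>n=1..N. sine_coeff f n * sine_basis n x))" for N
    by (intro nrm_cong_AE lsqD(1) lsq_diff sine_partial_sum_lsq f h(1)) (auto elim: eventually_mono)
  with h(2) show ?thesis
    by (simp add: sine_expansion_def L2_norm_eq_nrm sine_coeff_def)
qed

lemma sine_expansion_unique:
  assumes "f \<in> lsq unit_measure" "sine_expansion c f" "n \<ge> 1"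
  shows "c n = sine_coeff f n"
  using orthonormal_series_coeff[OF orthonormal_sine_basis assms(1) _ assms(3), of c] assms(2)
  by (simp add: sine_expansion_def L2_norm_eq_nrm sine_coeff_def)

lemma exists_sine_coeff:
  assumes "a \<in> seqs"
  shows "\<exists>f\<in>lsq unit_measure. sine_coeff f = a"
proof -
  have "summable (\<lambda>n. (cmod (a n))\<^sup>2)" using assms by (simp add: seqs_def lsq_natm_iff)
  from orthonormal_series[OF orthonormal_sine_basis this] obtain f where f: "f \<in> lsq unit_measure"
      "(\<lambda>N. nrm unit_measure (\<lambda>x. f x - (\<Sum>n=1..N. a n * sine_basis n x))) \<longlonglongrightarrow> 0"
    by (elim bexE)
  have "sine_coeff f n = a n" for n
  proof (cases "n = 0")
    case True
    then show ?thesis using assms by (simp add: sine_coeff_def seqs_def)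
  next
    case False
    then show ?thesis
      using orthonormal_series_coeff[OF orthonormal_sine_basis f, of n] by (simp add: sine_coeff_def)
  qed
  with f(1) show ?thesis by blast
qed

text \<open>The expansion exists by completeness. Its coefficients are unique from index 1 on, and
  these are the only ones that \<open>dirichlet_series\<close> sums, so the description in
  \<open>S\<close> has exactly one solution.\<close>

lemma S_eq:
  assumes f: "f \<in> lsq unit_measure"
  shows "S f = dirichlet_series (sine_coeff f)"
  unfolding S_def
proof (rule the_equality)
  show "\<exists>c. square_summable c \<and> sine_expansion c f \<and> dirichlet_series (sine_coeff f) = dirichlet_series c"
    using sine_expansion_sine_coeff[OF f] sine_coeff_seqs[OF f]
    by (intro exI[of _ "sine_coeff f"]) (auto simp: seqs_def square_summable_iff)
  fix F assume "\<exists>c. square_summable c \<and> sine_expansion c f \<and> F = dirichlet_series c"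
  then obtain c where c: "sine_expansion c f" "F = dirichlet_series c" by blast
  have "dirichlet_series c = dirichlet_series (sine_coeff f)"
    unfolding dirichlet_series_def
    using sine_expansion_unique[OF f c(1)] by (auto simp: fun_eq_iff intro!: infsum_cong)
  with c(2) show "F = dirichlet_series (sine_coeff f)" by simp
qed

text \<open>Parseval's identity, from continuity of the inner product along the partial sums of
  \<open>f\<close>.\<close>

lemma ip_sine_coeff:
  assumes f: "f \<in> lsq unit_measure" and g: "g \<in> lsq unit_measure"
  shows "ip natm (sine_coeff f) (sine_coeff g) = ip unit_measure f g"
proof -
  have c: "sine_coeff f \<in> lsq natm" "sine_coeff g \<in> lsq natm"
    using sine_coeff_seqs f g by (auto simp: seqs_def)
  have zero: "sine_coeff f 0 = 0" by (simp add: sine_coeff_def)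
  have "(\<lambda>N. ip unit_measure (\<lambda>x. \<Sum>n=1..N. sine_coeff f n * sine_basis n x) g) \<longlonglongrightarrow> ip unit_measure f g"
    using sine_expansion_sine_coeff[OF f] unfolding sine_expansion_def L2_norm_eq_nrm
    by (intro ip_tendsto_left f g sine_partial_sum_lsq)
  \<comment> \<open>Starting at 0 instead of 1 adds only the zero entry and matches the form of
    \<open>sums\<close>; the resulting offset \<open>Suc N\<close> is removed by
    \<open>LIMSEQ_imp_Suc\<close>.\<close>
  moreover have "ip unit_measure (\<lambda>x. \<Sum>n=1..N. sine_coeff f n * sine_basis n x) g
      = (\<Sum>n<Suc N. sine_coeff f n * cnj (sine_coeff g n))" for N
  proof -
    have "ip unit_measure (\<lambda>x. \<Sum>n=1..N. sine_coeff f n * sine_basis n x) g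
        = (\<Sum>n=1..N. sine_coeff f n * ip unit_measure (sine_basis n) g)"
      by (intro ip_lincomb_left g sine_basis_lsq)
    also have "\<dots> = (\<Sum>n=1..N. sine_coeff f n * cnj (sine_coeff g n))"
      by (simp add: sine_coeff_def flip: ip_cnj)
    also have "\<dots> = (\<Sum>n<Suc N. sine_coeff f n * cnj (sine_coeff g n))"
      by (rule sum.mono_neutral_left) (use zero in \<open>auto simp: not_le\<close>)
    finally show ?thesis .
  qed
  ultimately have "(\<lambda>N. \<Sum>n<Suc N. sine_coeff f n * cnj (sine_coeff g n)) \<longlonglongrightarrow> ip unit_measure f g"
    by (simp only:)
  then have "(\<lambda>n. sine_coeff f n * cnj (sine_coeff g n)) sums ip unit_measure f g"
    unfolding sums_def by (rule LIMSEQ_imp_Suc)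
  then show ?thesis unfolding ip_natm[OF c] by (rule sums_unique[symmetric])
qed

lemma nrm_sine_coeff:
  assumes "f \<in> lsq unit_measure"
  shows "nrm natm (sine_coeff f) = nrm unit_measure f"
  by (rule power2_eq_imp_eq) (simp_all add: nrm_sq_ip ip_sine_coeff[OF assms assms])

lemma sine_coeff_diff_lincomb:
  assumes "f \<in> lsq unit_measure" "\<And>i. i \<in> A \<Longrightarrow> u i \<in> lsq unit_measure"
  shows "sine_coeff (\<lambda>x. f x - (\<Sum>i\<in>A. c i * u i x)) = (\<lambda>n. sine_coeff f n - (\<Sum>i\<in>A. c i * sine_coeff (u i) n))"
  using assms by (simp add: fun_eq_iff sine_coeff_def ip_diff_left ip_lincomb_left lsq_lincomb sine_basis_lsq)

section \<open>Dilations of odd periodic functions\<close>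

lemma odd_periodic_ext_measurable:
  assumes "\<phi> \<in> borel_measurable unit_measure"
  shows "odd_periodic_ext \<phi> \<in> borel_measurable borel"
proof -
  \<comment> \<open>\<open>\<phi>\<close> is known to be measurable only on the interval. Cut off by
    zero it is Borel on the line, and the extension evaluates it only at points of the
    interval.\<close>
  define \<psi> where "\<psi> = (\<lambda>x. indicator {0<..<1} x *\<^sub>R \<phi> x)"
  have [measurable]: "\<psi> \<in> borel_measurable borel"
    using assms unfolding \<psi>_def by (simp add: borel_measurable_restrict_space_iff)
  have frac [measurable]: "(\<lambda>x. 2 * frac (x / 2)) \<in> borel_measurable (borel :: real measure)"
    unfolding frac_def by measurable
  have "odd_periodic_ext \<phi> = (\<lambda>x. if 0 < 2 * frac (x / 2) \<and> 2 * frac (x / 2) < 1 then \<psi> (2 * frac (x / 2))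
      else if 1 < 2 * frac (x / 2) then - \<psi> (2 - 2 * frac (x / 2)) else 0)"
    using frac_lt_1 by (auto simp: fun_eq_iff odd_periodic_ext_def \<psi>_def Let_def indicator_def)
  also have "\<dots> \<in> borel_measurable borel" by measurable
  finally show ?thesis .
qed

lemma odd_periodic_ext_periodic: "odd_periodic_ext \<phi> (x + 2 * of_int k) = odd_periodic_ext \<phi> x"
proof -
  have "(x + 2 * of_int k) / 2 = x / 2 + of_int k" by simp
  then have "frac ((x + 2 * of_int k) / 2) = frac (x / 2)" by (simp only: frac_add_of_int_right)
  then show ?thesis by (simp add: odd_periodic_ext_def)
qed

lemma odd_periodic_ext_minus: "odd_periodic_ext \<phi> (- x) = - odd_periodic_ext \<phi> x"
proof (cases "x / 2 \<in> \<int>")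
  case True
  then have "- x / 2 \<in> \<int>" using Ints_minus[of "x / 2"] by simp
  with True have "frac (x / 2) = 0" "frac (- x / 2) = 0" by (simp_all only: frac_eq_0_iff)
  then show ?thesis by (simp only: odd_periodic_ext_def Let_def) simp
next
  case False
  then have "frac (- x / 2) = 1 - frac (x / 2)" using frac_neg[of "x / 2"] by simp
  moreover have "0 < frac (x / 2)" "frac (x / 2) < 1" using False frac_lt_1 by auto
  ultimately show ?thesis by (auto simp: odd_periodic_ext_def Let_def)
qed

lemma odd_periodic_ext_unit: "0 < x \<Longrightarrow> x < 1 \<Longrightarrow> odd_periodic_ext \<phi> x = \<phi> x"
  using frac_eq[of "x / 2"] by (simp add: odd_periodic_ext_def)

lemma odd_periodic_ext_diff_lincomb:
  "odd_periodic_ext (\<lambda>x. f x - (\<Sum>i\<in>A. c i * u i x)) x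
    = odd_periodic_ext f x - (\<Sum>i\<in>A. c i * odd_periodic_ext (u i) x)"
  by (simp add: odd_periodic_ext_def Let_def sum_negf)

text \<open>A sine is already odd and 2-periodic. As a consequence, dilating an expansion by
  \<open>n\<close> replaces \<open>sine_basis k\<close> by
  \<open>sine_basis (n * k)\<close>.\<close>

lemma odd_periodic_ext_sine_basis: "odd_periodic_ext (sine_basis k) x = sine_basis k x"
proof -
  define y where "y = 2 * frac (x / 2)"
  have sin_periodic: "sin (t + 2 * pi * of_int m) = sin t" for t and m :: int
    by (simp add: sin_add sin_int_2pin cos_int_2pin)
  obtain m :: int where m: "x = y + 2 * of_int m"
    using that[of "\<lfloor>x / 2\<rfloor>"] by (simp add: y_def frac_def)
  have "pi * real k * x = pi * real k * y + 2 * pi * of_int (int k * m)"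
    unfolding m by (simp add: algebra_simps)
  then have x: "sin (pi * real k * x) = sin (pi * real k * y)" by (simp only: sin_periodic)
  have "0 \<le> y" "y < 2" using frac_lt_1[of "x / 2"] by (auto simp: y_def)
  then consider "0 < y" "y < 1" | "1 < y" | "y = 0" | "y = 1" by linarith
  then show ?thesis
  proof cases
    case 2
    have "pi * real k * (2 - y) = - (pi * real k * y) + 2 * pi * of_int (int k)" by (simp add: algebra_simps)
    then have "sin (pi * real k * (2 - y)) = - sin (pi * real k * y)"
      by (simp only: sin_periodic sin_minus)
    with 2 x show ?thesis by (simp add: odd_periodic_ext_def sine_basis_def flip: y_def)
  next
    case 4
    \<comment> \<open>At odd integers the extension has the default value 0, and the sine agrees
      with it.\<close>
    have "sin (pi * real k) = 0" by simp
    with 4 x show ?thesis by (simp add: odd_periodic_ext_def sine_basis_def flip: y_def)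
  qed (use x in \<open>simp_all add: odd_periodic_ext_def sine_basis_def flip: y_def\<close>)
qed

text \<open>The substitution \<open>n * x\<close> stretches the interval to length \<open>n\<close>,
  which splits into \<open>n\<close> unit pieces with equal integrals: translation brings a piece
  with even left end back to the first, reflection one with odd left end. The factor
  \<open>n\<close> cancels. With nonnegative integrals, integrability of the dilation becomes a
  conclusion instead of an assumption.\<close>

lemma nn_integral_unit_dilation:
  fixes G :: "real \<Rightarrow> ennreal"
  assumes [measurable]: "G \<in> borel_measurable borel"
    and periodic: "\<And>x k. G (x + 2 * of_int k) = G x" and even: "\<And>x. G (- x) = G x" and n: "n \<ge> 1"
  shows "(\<integral>\<^sup>+x. G (real n * x) * indicator {0<..<1} x \<partial>lborel) = (\<integral>\<^sup>+x. G x * indicator {0<..<1} x \<partial>lborel)"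
proof -
  let ?I = "\<integral>\<^sup>+x. G x * indicator {0<..<1} x \<partial>lborel"
  have piece: "(\<integral>\<^sup>+x. G x * indicator {real j<..<real (Suc j)} x \<partial>lborel) = ?I" for j
  proof (cases "even j")
    case True
    then obtain k where k: "j = 2 * k" by blast
    have "(\<integral>\<^sup>+x. G x * indicator {real j<..<real (Suc j)} x \<partial>lborel)
        = ennreal \<bar>1\<bar> * (\<integral>\<^sup>+x. G (real j + 1 * x) * indicator {real j<..<real (Suc j)} (real j + 1 * x) \<partial>lborel)"
      by (rule nn_integral_real_affine) auto
    also have "\<dots> = ?I"
      using periodic[of _ "int k"]
      by (auto simp: k indicator_def add.commute intro!: nn_integral_cong)
    finally show ?thesis .
  next
    case False
    then obtain k where k: "Suc j = 2 * k" by (metis even_Suc evenE)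
    then have k': "real (Suc j) = 2 * real k" by (metis of_nat_mult of_nat_numeral)
    have "(\<integral>\<^sup>+x. G x * indicator {real j<..<real (Suc j)} x \<partial>lborel)
        = ennreal \<bar>-1\<bar> * (\<integral>\<^sup>+x. G (real (Suc j) + (-1) * x) * indicator {real j<..<real (Suc j)} (real (Suc j) + (-1) * x) \<partial>lborel)"
      by (rule nn_integral_real_affine) auto
    also have "\<dots> = ?I"
    proof -
      have "G (real (Suc j) + (-1) * x) = G x" for x
        using periodic[of "- x" "int k"] even[of x] by (simp add: k' add.commute del: of_nat_Suc)
      moreover have "indicator {real j<..<real (Suc j)} (real (Suc j) + (-1) * x) = (indicator {0<..<1} x :: ennreal)" for x
        by (auto simp: indicator_def)
      ultimately show ?thesis by simp
    qed
    finally show ?thesis .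
  qed
  have total: "(\<integral>\<^sup>+x. G x * indicator {0<..<real m} x \<partial>lborel) = of_nat m * ?I" for m
  proof (induction m)
    case (Suc m)
    have "AE x in lborel. x \<noteq> real m" by (rule AE_lborel_singleton)
    then have "AE x in lborel. G x * indicator {0<..<real (Suc m)} x
        = G x * indicator {0<..<real m} x + G x * indicator {real m<..<real (Suc m)} x"
      by eventually_elim (auto simp: indicator_def)
    then have "(\<integral>\<^sup>+x. G x * indicator {0<..<real (Suc m)} x \<partial>lborel)
        = (\<integral>\<^sup>+x. G x * indicator {0<..<real m} x + G x * indicator {real m<..<real (Suc m)} x \<partial>lborel)"
      by (rule nn_integral_cong_AE)
    also have "\<dots> = of_nat m * ?I + ?I"
      by (subst nn_integral_add) (auto simp: Suc.IH piece simp del: of_nat_Suc)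
    finally show ?case by (simp add: distrib_right add.commute)
  qed simp
  have "of_nat n * ?I = (\<integral>\<^sup>+x. G x * indicator {0<..<real n} x \<partial>lborel)" by (simp add: total)
  also have "\<dots> = ennreal \<bar>real n\<bar> * (\<integral>\<^sup>+x. G (0 + real n * x) * indicator {0<..<real n} (0 + real n * x) \<partial>lborel)"
    by (rule nn_integral_real_affine) (use n in auto)
  also have "\<dots> = of_nat n * (\<integral>\<^sup>+x. G (real n * x) * indicator {0<..<1} x \<partial>lborel)"
  proof -
    have "indicator {0<..<real n} (0 + real n * x) = (indicator {0<..<1} x :: ennreal)" for x
      using n by (auto simp: indicator_def zero_less_mult_iff)
    then show ?thesis by (simp add: ennreal_of_nat_eq_real_of_nat)
  qed
  finally show ?thesis
    using n by (simp add: ennreal_mult_cancel_left)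
qed

text \<open>Squaring the modulus removes the sign, so the odd extension yields an even function of
  period 2, to which the substitution applies.\<close>

lemma dilation_isometry:
  assumes \<phi>: "\<phi> \<in> lsq unit_measure" and n: "n \<ge> 1"
  shows "dilation \<phi> n \<in> lsq unit_measure" "nrm unit_measure (dilation \<phi> n) = nrm unit_measure \<phi>"
proof -
  have ext [measurable]: "odd_periodic_ext \<phi> \<in> borel_measurable borel"
    by (rule odd_periodic_ext_measurable[OF lsqD(1)[OF \<phi>]])
  have dil: "dilation \<phi> n \<in> borel_measurable borel"
    unfolding dilation_def by measurable
  have meas: "dilation \<phi> n \<in> borel_measurable unit_measure" using dil by auto
  define G where "G = (\<lambda>x. ennreal ((cmod (odd_periodic_ext \<phi> x))\<^sup>2))"
  have G_meas: "G \<in> borel_measurable borel" unfolding G_def by measurable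
  have G_props: "G (x + 2 * of_int k) = G x" "G (- x) = G x" for x k
    by (simp_all add: G_def odd_periodic_ext_periodic odd_periodic_ext_minus)
  have "(\<integral>\<^sup>+x. ennreal ((cmod (dilation \<phi> n x))\<^sup>2) \<partial>unit_measure)
      = (\<integral>\<^sup>+x. G (real n * x) * indicator {0<..<1} x \<partial>lborel)"
    by (subst nn_integral_restrict_space) (auto simp: G_def dilation_def)
  also have "\<dots> = (\<integral>\<^sup>+x. G x * indicator {0<..<1} x \<partial>lborel)"
    by (rule nn_integral_unit_dilation[OF G_meas G_props n])
  also have "\<dots> = (\<integral>\<^sup>+x. ennreal ((cmod (\<phi> x))\<^sup>2) * indicator {0<..<1} x \<partial>lborel)"
    by (rule nn_integral_cong) (auto simp: G_def indicator_def odd_periodic_ext_unit)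
  also have "\<dots> = (\<integral>\<^sup>+x. ennreal ((cmod (\<phi> x))\<^sup>2) \<partial>unit_measure)"
    by (subst nn_integral_restrict_space) auto
  finally have eq: "(\<integral>\<^sup>+x. ennreal ((cmod (dilation \<phi> n x))\<^sup>2) \<partial>unit_measure)
      = (\<integral>\<^sup>+x. ennreal ((cmod (\<phi> x))\<^sup>2) \<partial>unit_measure)" .
  also have fin: "\<dots> = ennreal ((nrm unit_measure \<phi>)\<^sup>2)"
    unfolding nrm_sq by (rule nn_integral_eq_integral) (use lsqD(2)[OF \<phi>] in auto)
  finally have nn: "(\<integral>\<^sup>+x. ennreal ((cmod (dilation \<phi> n x))\<^sup>2) \<partial>unit_measure) = ennreal ((nrm unit_measure \<phi>)\<^sup>2)" .
  have int: "integrable unit_measure (\<lambda>x. (cmod (dilation \<phi> n x))\<^sup>2)"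
    by (rule integrableI_bounded) (use meas nn in \<open>simp_all add: less_top\<close>)
  with meas show lsq: "dilation \<phi> n \<in> lsq unit_measure" by (simp add: lsq_def)
  have "ennreal ((nrm unit_measure (dilation \<phi> n))\<^sup>2) = ennreal ((nrm unit_measure \<phi>)\<^sup>2)"
    unfolding nn[symmetric] nrm_sq[of _ "dilation \<phi> n"]
    by (rule nn_integral_eq_integral[symmetric]) (use int in auto)
  then show "nrm unit_measure (dilation \<phi> n) = nrm unit_measure \<phi>"
    by (simp add: power2_eq_iff_nonneg)
qed

text \<open>Dilation is linear and isometric, so it carries the sine expansion of
  \<open>\<phi>\<close> to a convergent one with \<open>sine_basis (n * k)\<close> in place of
  \<open>sine_basis k\<close>; comparing coefficients moves the entry at \<open>k\<close> to
  \<open>n * k\<close>.\<close>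

lemma sine_coeff_dilation:
  assumes \<phi>: "\<phi> \<in> lsq unit_measure" and n: "n \<ge> 1"
  shows "sine_coeff (dilation \<phi> n) = shift n (sine_coeff \<phi>)"
proof
  fix m
  let ?c = "sine_coeff \<phi>"
  show "sine_coeff (dilation \<phi> n) m = shift n ?c m"
  proof (cases "m = 0")
    case False
    define s where "s N = (\<lambda>x. \<Sum>k=1..N. ?c k * sine_basis (n * k) x)" for N
    have s: "s N \<in> lsq unit_measure" for N
      unfolding s_def by (intro lsq_lincomb sine_basis_lsq)
    have "dilation \<phi> n x - s N x = dilation (\<lambda>x. \<phi> x - (\<Sum>k=1..N. ?c k * sine_basis k x)) n x" for N x
      unfolding dilation_def odd_periodic_ext_diff_lincomb odd_periodic_ext_sine_basis s_def
      by (simp add: sine_basis_def mult_ac)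
    then have "(\<lambda>x. dilation \<phi> n x - s N x) = dilation (\<lambda>x. \<phi> x - (\<Sum>k=1..N. ?c k * sine_basis k x)) n" for N
      by (rule ext)
    then have "nrm unit_measure (\<lambda>x. dilation \<phi> n x - s N x)
        = nrm unit_measure (\<lambda>x. \<phi> x - (\<Sum>k=1..N. ?c k * sine_basis k x))" for N
      using dilation_isometry(2)[OF lsq_diff[OF \<phi> sine_partial_sum_lsq] n] by simp
    then have "(\<lambda>N. nrm unit_measure (\<lambda>x. dilation \<phi> n x - s N x)) \<longlonglongrightarrow> 0"
      using sine_expansion_sine_coeff[OF \<phi>] by (simp add: sine_expansion_def L2_norm_eq_nrm)
    from ip_tendsto_left[OF dilation_isometry(1)[OF \<phi> n] sine_basis_lsq s this]
    have "(\<lambda>N. ip unit_measure (s N) (sine_basis m)) \<longlonglongrightarrow> sine_coeff (dilation \<phi> n) m"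
      by (simp add: sine_coeff_def)
    moreover have "(\<lambda>N. ip unit_measure (s N) (sine_basis m)) \<longlonglongrightarrow> shift n ?c m"
    proof (intro tendsto_eventually eventually_sequentiallyI)
      fix N assume N: "m \<le> N"
      have "ip unit_measure (s N) (sine_basis m) = (\<Sum>k=1..N. ?c k * ip unit_measure (sine_basis (n * k)) (sine_basis m))"
        unfolding s_def by (intro ip_lincomb_left sine_basis_lsq)
      also have "\<dots> = (\<Sum>k=1..N. if n * k = m then ?c k else 0)"
        using n False by (intro sum.cong) (auto simp: orthonormal_ip[OF orthonormal_sine_basis] Suc_le_eq)
      also have "\<dots> = shift n ?c m"
      proof (cases "n dvd m")
        case True
        then obtain l where l: "m = n * l" by blast
        have "l \<ge> 1" using l \<open>m \<noteq> 0\<close> by (cases l) auto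
        moreover have "l \<le> m" unfolding l using mult_le_mono1[OF n, of l] by simp
        ultimately have "l \<in> {1..N}" using N by simp
        moreover have "(\<Sum>k=1..N. if n * k = m then ?c k else 0) = (\<Sum>k=1..N. if k = l then ?c k else 0)"
          using n by (intro sum.cong) (auto simp: l)
        ultimately show ?thesis using n by (simp add: l)
      next
        case False
        then show ?thesis by (auto simp: shift_def intro!: sum.neutral)
      qed
      finally show "ip unit_measure (s N) (sine_basis m) = shift n ?c m" .
    qed
    ultimately show ?thesis by (rule LIMSEQ_unique)
  qed (simp add: sine_coeff_def)
qed

section \<open>Transfer to sequences\<close>

lemma seqs_closed:
  assumes a: "a \<in> lsq natm" and approx: "\<And>\<epsilon>. \<epsilon> > 0 \<Longrightarrow> \<exists>b\<in>seqs. nrm natm (\<lambda>n. a n - b n) < \<epsilon>"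
  shows "a \<in> seqs"
proof -
  have small: "cmod (a 0) \<le> \<epsilon>" if "\<epsilon> > 0" for \<epsilon>
  proof -
    obtain b where b: "b \<in> seqs" "nrm natm (\<lambda>n. a n - b n) < \<epsilon>" using approx[OF \<open>\<epsilon> > 0\<close>] by blast
    then have "cmod (a 0) \<le> nrm natm (\<lambda>n. a n - b n)"
      using cmod_le_nrm_natm[OF lsq_diff[OF a], of b 0] by (simp add: seqs_def)
    with b(2) show ?thesis by simp
  qed
  have "cmod (a 0) \<le> 0" by (rule field_le_epsilon) (simp add: small)
  with a show ?thesis by (simp add: seqs_def)
qed

lemma closed_subspace_seqs: "closed_subspace natm seqs"
  unfolding closed_subspace_def
proof (intro conjI ballI allI impI)
  fix a assume "a \<in> lsq natm" "\<forall>\<epsilon>>0. \<exists>b\<in>seqs. nrm natm (\<lambda>n. a n - b n) < \<epsilon>"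
  then show "a \<in> seqs" by (intro seqs_closed) auto
qed (auto simp: seqs_def lsq_add lsq_scale)

lemma shift_seqs: "n \<ge> 1 \<Longrightarrow> a \<in> seqs \<Longrightarrow> shift n a \<in> seqs"
  by (simp add: seqs_def shift_lsq)

definition coeffs :: "(complex \<Rightarrow> complex) set \<Rightarrow> (nat \<Rightarrow> complex) set" where
  "coeffs I = {a \<in> seqs. dirichlet_series a \<in> I}"

section \<open>The coefficient space of a shift invariant subspace\<close>

locale H2_shift_invariant =
  fixes I :: "(complex \<Rightarrow> complex) set"
  assumes subspace: "H2_subspace I" and invariant: "shift_invariant I"
begin

abbreviation "K \<equiv> coeffs I"

text \<open>Read off from the adjoint in the statement of the theorem, not from a representing
  vector, so that \<open>commute_iff\<close> is a translation; \<open>adjoint_spec\<close> shows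
  that both agree on \<open>K\<close>.\<close>

definition adj :: "nat \<Rightarrow> (nat \<Rightarrow> complex) \<Rightarrow> nat \<Rightarrow> complex" where
  "adj q a = H2_coeff (adjoint_on I (restrict (\<Lambda> q) I) (dirichlet_series a))"

lemma coeffsD: "a \<in> K \<Longrightarrow> a \<in> seqs" "a \<in> K \<Longrightarrow> a \<in> lsq natm" "a \<in> K \<Longrightarrow> dirichlet_series a \<in> I"
  by (auto simp: coeffs_def seqs_def)

lemma I_cases:
  assumes "F \<in> I"
  obtains a where "a \<in> K" "F = dirichlet_series a"
  using assms subspace by (auto simp: H2_subspace_def coeffs_def H2_eq)

lemma ball_I: "(\<forall>F\<in>I. P F) \<longleftrightarrow> (\<forall>a\<in>K. P (dirichlet_series a))"
  using I_cases coeffsD(3) by metis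

lemma closed_subspace_coeffs: "closed_subspace natm K"
  unfolding closed_subspace_def
proof (intro conjI ballI allI impI)
  show "K \<subseteq> lsq natm" using coeffsD by blast
  show "(\<lambda>n. 0) \<in> K"
    using subspace by (simp add: coeffs_def seqs_def dirichlet_series_zero H2_subspace_def)
  show "(\<lambda>n. a n + b n) \<in> K" if "a \<in> K" "b \<in> K" for a b
    using that subspace by (auto simp: coeffs_def seqs_def dirichlet_series_add H2_subspace_def lsq_add)
  show "(\<lambda>n. c * a n) \<in> K" if "a \<in> K" for c a
    using that subspace by (auto simp: coeffs_def seqs_def dirichlet_series_scale H2_subspace_def lsq_scale)
  fix a assume a: "a \<in> lsq natm" and approx: "\<forall>\<epsilon>>0. \<exists>b\<in>K. nrm natm (\<lambda>n. a n - b n) < \<epsilon>"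
  have as: "a \<in> seqs"
    using approx by (intro seqs_closed[OF a]) (meson coeffsD(1))
  have "\<exists>G\<in>I. H2_norm (\<lambda>s. dirichlet_series a s - G s) < \<epsilon>" if "\<epsilon> > 0" for \<epsilon>
  proof -
    obtain b where b: "b \<in> K" "nrm natm (\<lambda>n. a n - b n) < \<epsilon>" using approx \<open>\<epsilon> > 0\<close> by blast
    have "(\<lambda>n. a n - b n) \<in> seqs" using as coeffsD(1)[OF b(1)] by (simp add: seqs_def lsq_diff)
    from H2_norm_dirichlet_series[OF this] b(2)
    have "H2_norm (\<lambda>s. dirichlet_series a s - dirichlet_series b s) < \<epsilon>"
      unfolding dirichlet_series_diff[OF a coeffsD(2)[OF b(1)]] by simp
    with coeffsD(3)[OF b(1)] show ?thesis by blast
  qed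
  moreover have "dirichlet_series a \<in> H2" using as by (auto simp: H2_eq)
  ultimately have "dirichlet_series a \<in> I" using subspace by (auto simp: H2_subspace_def)
  with as show "a \<in> K" by (simp add: coeffs_def)
qed

lemma shift_coeffs:
  assumes "n \<ge> 1" "a \<in> K"
  shows "shift n a \<in> K"
  using assms invariant coeffsD[OF assms(2)]
  by (auto simp: coeffs_def shift_seqs dirichlet_series_shift seqs_def shift_lsq shift_invariant_def image_subset_iff)

text \<open>Isometry of the shift bounds the functional
  \<open>a \<mapsto> ip natm (shift q a) b\<close>, which gives a representing vector. Another one
  differs from it by an element of \<open>K\<close> orthogonal to itself, so the description in
  \<open>adjoint_on\<close> is well defined.\<close>

lemma adjoint_spec:
  assumes q: "q \<ge> 1" and b: "b \<in> K"
  shows "adj q b \<in> K \<and> (\<forall>a\<in>K. ip natm (shift q a) b = ip natm a (adj q b)) \<and>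
    adjoint_on I (restrict (\<Lambda> q) I) (dirichlet_series b) = dirichlet_series (adj q b)"
proof -
  note K = closed_subspace_coeffs
  have "\<exists>h\<in>K. \<forall>a\<in>K. ip natm (shift q a) b = ip natm a h"
  proof (rule Riesz_representation[OF K, where L = "\<lambda>a. ip natm (shift q a) b" and C = "nrm natm b"])
    fix a assume a: "a \<in> K"
    have "(\<lambda>n. c * shift q a n) = shift q (\<lambda>n. c * a n)" for c by (auto simp: shift_def)
    then show "ip natm (shift q (\<lambda>n. c * a n)) b = c * ip natm (shift q a) b" for c
      by (simp flip: ip_scale_left)
    have "nrm natm (shift q a) = nrm natm a"
      by (rule power2_eq_imp_eq) (simp_all add: nrm_sq_ip ip_shift[OF q] coeffsD a)
    then show "cmod (ip natm (shift q a) b) \<le> nrm natm b * nrm natm a"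
      using Cauchy_Schwarz_lsq[of "shift q a" natm b] coeffsD(2) a b q
      by (simp add: shift_lsq mult.commute)
    fix a' assume a': "a' \<in> K"
    have "(\<lambda>n. shift q a n + shift q a' n) = shift q (\<lambda>n. a n + a' n)" by (auto simp: shift_def)
    then show "ip natm (shift q (\<lambda>n. a n + a' n)) b = ip natm (shift q a) b + ip natm (shift q a') b"
      using a a' b q coeffsD(2) by (simp add: shift_lsq flip: ip_add_left)
  qed
  then obtain h where h: "h \<in> K" "\<And>a. a \<in> K \<Longrightarrow> ip natm (shift q a) b = ip natm a h" by blast
  have inner: "H2_inner (restrict (\<Lambda> q) I (dirichlet_series a)) (dirichlet_series b) = ip natm a h" if "a \<in> K" for a
  proof -
    have "restrict (\<Lambda> q) I (dirichlet_series a) = dirichlet_series (shift q a)"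
      using coeffsD(1,3)[OF that] q by (simp add: dirichlet_series_shift seqs_def)
    then show ?thesis
      using h(2)[OF that] coeffsD(1)[OF b] shift_seqs[OF q coeffsD(1)[OF that]]
      by (simp add: H2_inner_dirichlet_series)
  qed
  have "(THE H. H \<in> I \<and> (\<forall>F\<in>I. H2_inner (restrict (\<Lambda> q) I F) (dirichlet_series b) = H2_inner F H))
      = dirichlet_series h"
  proof (rule the_equality)
    show "dirichlet_series h \<in> I \<and>
        (\<forall>F\<in>I. H2_inner (restrict (\<Lambda> q) I F) (dirichlet_series b) = H2_inner F (dirichlet_series h))"
      unfolding ball_I using inner coeffsD(1,3) h(1) by (auto simp: H2_inner_dirichlet_series)
    fix H assume H: "H \<in> I \<and> (\<forall>F\<in>I. H2_inner (restrict (\<Lambda> q) I F) (dirichlet_series b) = H2_inner F H)"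
    then obtain h' where h': "h' \<in> K" "H = dirichlet_series h'" using I_cases by blast
    have eq: "ip natm a h' = ip natm a h" if "a \<in> K" for a
      using H inner[OF that] coeffsD(1,3) that h' by (simp add: H2_inner_dirichlet_series)
    have d: "(\<lambda>n. h' n - h n) \<in> K" by (rule closed_subspace_diff[OF K h'(1) h(1)])
    have "ip natm (\<lambda>n. h' n - h n) (\<lambda>n. h' n - h n) = 0"
      using eq[OF d] coeffsD(2) h(1) h'(1) d by (simp add: ip_diff_right)
    from ip_natm_self_eq_0[OF coeffsD(2)[OF d] this] have "h' = h" by (auto simp: fun_eq_iff)
    with h'(2) show "H = dirichlet_series h" by simp
  qed
  then have adj: "adjoint_on I (restrict (\<Lambda> q) I) (dirichlet_series b) = dirichlet_series h"
    using coeffsD(3)[OF b] by (simp add: adjoint_on_def)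
  then have "adj q b = h"
    unfolding adj_def using H2_coeff_dirichlet_series[OF coeffsD(1)[OF h(1)]] by simp
  with h adj show ?thesis by blast
qed

sublocale shift_subspace K adj
proof
  show "closed_subspace natm K" by (rule closed_subspace_coeffs)
  show "a 0 = 0" if "a \<in> K" for a using coeffsD(1)[OF that] by (simp add: seqs_def)
qed (use shift_coeffs adjoint_spec prime_ge_1_nat in \<open>blast+\<close>)

text \<open>\<open>adj q\<close> and \<open>shift p\<close> map \<open>K\<close> into itself, so
  every \<open>restrict\<close> acts as the operator itself, and injectivity of
  \<open>dirichlet_series\<close> on \<open>seqs\<close> reduces the equation to
  coefficients.\<close>

lemma commute_iff:
  "(\<forall>p q :: nat. prime p \<longrightarrow> prime q \<longrightarrow> p \<noteq> q \<longrightarrow>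
      (\<forall>F\<in>I. restrict (\<Lambda> p) I (adjoint_on I (restrict (\<Lambda> q) I) F) =
              adjoint_on I (restrict (\<Lambda> q) I) (restrict (\<Lambda> p) I F))) \<longleftrightarrow>
   (\<forall>p q. prime p \<longrightarrow> prime q \<longrightarrow> p \<noteq> q \<longrightarrow> (\<forall>a\<in>K. shift p (adj q a) = adj q (shift p a)))"
proof -
  have "restrict (\<Lambda> p) I (adjoint_on I (restrict (\<Lambda> q) I) (dirichlet_series a)) =
        adjoint_on I (restrict (\<Lambda> q) I) (restrict (\<Lambda> p) I (dirichlet_series a)) \<longleftrightarrow>
      shift p (adj q a) = adj q (shift p a)"
    if pq: "prime p" "prime q" and a: "a \<in> K" for p q a
  proof -
    have p: "p \<ge> 1" and q: "q \<ge> 1" using pq prime_ge_1_nat by auto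
    have \<Lambda>: "restrict (\<Lambda> p) I (dirichlet_series b) = dirichlet_series (shift p b)" if "b \<in> K" for b
      using coeffsD(1,3)[OF that] p by (simp add: dirichlet_series_shift seqs_def)
    have adj: "adj q b \<in> K" "adjoint_on I (restrict (\<Lambda> q) I) (dirichlet_series b) = dirichlet_series (adj q b)"
      if "b \<in> K" for b
      using adjoint_spec[OF q that] by auto
    show ?thesis
      unfolding adj(2)[OF a] \<Lambda>[OF a] \<Lambda>[OF adj(1)[OF a]] adj(2)[OF shift_coeffs[OF p a]]
      using dirichlet_series_inj coeffsD(1) shift_coeffs[OF p] adj(1) a by metis
  qed
  then show ?thesis unfolding ball_I by (simp cong: imp_cong ball_cong)
qed

text \<open>\<open>sine_coeff\<close> is isometric and turns dilations into shifts, so both sides of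
  the first equation are preimages under it of subsets of \<open>seqs\<close>. It maps onto
  \<open>seqs\<close>, so the preimages agree only if the subsets do.\<close>

lemma span_iff:
  assumes \<phi>: "\<phi> \<in> L2"
  shows "S_preimage I = L2_closed_span (dilation \<phi>) \<longleftrightarrow> K = closed_span natm (\<lambda>n. shift n (sine_coeff \<phi>))"
proof -
  let ?C = "closed_span natm (\<lambda>n. shift n (sine_coeff \<phi>))"
  have \<phi>l: "\<phi> \<in> lsq unit_measure" using \<phi> by (simp add: L2_eq_lsq)
  have "?C \<subseteq> seqs"
    by (rule closed_span_subset[OF closed_subspace_seqs]) (intro shift_seqs sine_coeff_seqs \<phi>l)
  moreover have "K \<subseteq> seqs" using coeffsD(1) by blast
  moreover have "S_preimage I = {g \<in> lsq unit_measure. sine_coeff g \<in> K}"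
    using sine_coeff_seqs by (auto simp: S_preimage_def L2_eq_lsq S_eq coeffs_def)
  moreover have "L2_closed_span (dilation \<phi>) = {g \<in> lsq unit_measure. sine_coeff g \<in> ?C}"
  proof -
    have "nrm unit_measure (\<lambda>x. g x - (\<Sum>n=1..N. c n * dilation \<phi> n x))
        = nrm natm (\<lambda>m. sine_coeff g m - (\<Sum>n=1..N. c n * shift n (sine_coeff \<phi>) m))"
      if g: "g \<in> lsq unit_measure" for g N c
    proof -
      have dil: "dilation \<phi> n \<in> lsq unit_measure" if "n \<in> {1..N}" for n
        using that by (intro dilation_isometry(1) \<phi>l) simp
      have "nrm unit_measure (\<lambda>x. g x - (\<Sum>n=1..N. c n * dilation \<phi> n x))
          = nrm natm (sine_coeff (\<lambda>x. g x - (\<Sum>n=1..N. c n * dilation \<phi> n x)))"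
        by (intro nrm_sine_coeff[symmetric] lsq_diff lsq_lincomb g dil)
      also have "sine_coeff (\<lambda>x. g x - (\<Sum>n=1..N. c n * dilation \<phi> n x))
          = (\<lambda>m. sine_coeff g m - (\<Sum>n=1..N. c n * sine_coeff (dilation \<phi> n) m))"
        by (rule sine_coeff_diff_lincomb[OF g dil])
      also have "\<dots> = (\<lambda>m. sine_coeff g m - (\<Sum>n=1..N. c n * shift n (sine_coeff \<phi>) m))"
        by (simp add: sine_coeff_dilation[OF \<phi>l])
      finally show ?thesis .
    qed
    moreover have "sine_coeff g \<in> lsq natm" if "g \<in> lsq unit_measure" for g
      using sine_coeff_seqs[OF that] by (simp add: seqs_def)
    ultimately show ?thesis
      unfolding L2_closed_span_eq closed_span_def by (intro Collect_cong conj_cong) auto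
  qed
  moreover have "\<exists>g\<in>lsq unit_measure. sine_coeff g = a" if "a \<in> seqs" for a
    by (rule exists_sine_coeff[OF that])
  ultimately show ?thesis by (simp only: set_eq_iff mem_Collect_eq subset_iff) metis
qed

lemma orthonormal_iff:
  assumes \<phi>: "\<phi> \<in> L2"
  shows "L2_orthonormal (dilation \<phi>) \<longleftrightarrow> orthonormal natm (\<lambda>n. shift n (sine_coeff \<phi>))"
proof -
  have \<phi>l: "\<phi> \<in> lsq unit_measure" using \<phi> by (simp add: L2_eq_lsq)
  have "ip natm (shift m (sine_coeff \<phi>)) (shift n (sine_coeff \<phi>)) = ip unit_measure (dilation \<phi> m) (dilation \<phi> n)"
    if "m \<ge> 1" "n \<ge> 1" for m n
    using ip_sine_coeff[OF dilation_isometry(1)[OF \<phi>l that(1)] dilation_isometry(1)[OF \<phi>l that(2)]]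
    unfolding sine_coeff_dilation[OF \<phi>l that(1)] sine_coeff_dilation[OF \<phi>l that(2)] .
  moreover have "shift n (sine_coeff \<phi>) \<in> lsq natm" if "n \<ge> 1" for n
    using shift_seqs[OF that sine_coeff_seqs[OF \<phi>l]] by (simp add: seqs_def)
  moreover have "dilation \<phi> n \<in> lsq unit_measure" if "n \<ge> 1" for n
    by (rule dilation_isometry(1)[OF \<phi>l that])
  ultimately show ?thesis
    unfolding L2_orthonormal_iff orthonormal_def by auto
qed

end

theorem theorem4p7:
  fixes I :: "(complex \<Rightarrow> complex) set"
  assumes "H2_subspace I" and "I \<noteq> {\<lambda>s. 0}" and "shift_invariant I"
  shows "(\<forall>p q :: nat. prime p \<longrightarrow> prime q \<longrightarrow> p \<noteq> q \<longrightarrow>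
            (\<forall>F\<in>I. restrict (\<Lambda> p) I (adjoint_on I (restrict (\<Lambda> q) I) F) =
                    adjoint_on I (restrict (\<Lambda> q) I) (restrict (\<Lambda> p) I F))) \<longleftrightarrow>
         (\<exists>\<phi>\<in>L2. L2_orthonormal (dilation \<phi>) \<and>
                  S_preimage I = L2_closed_span (dilation \<phi>))"
proof -
  interpret H2_shift_invariant I
    by unfold_locales (rule assms(1,3))+
  have "\<exists>F\<in>I. F \<noteq> (\<lambda>s. 0)"
    using assms(1,2) by (auto simp: H2_subspace_def)
  then have nonzero: "\<exists>a\<in>K. a \<noteq> (\<lambda>n. 0)"
    using I_cases dirichlet_series_zero by metis
  have "(\<forall>p q. prime p \<longrightarrow> prime q \<longrightarrow> p \<noteq> q \<longrightarrow> (\<forall>a\<in>K. shift p (adj q a) = adj q (shift p a))) \<longleftrightarrow>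
      (\<exists>f\<in>seqs. orthonormal natm (\<lambda>n. shift n f) \<and> K = closed_span natm (\<lambda>n. shift n f))"
  proof
    assume comm: "\<forall>p q. prime p \<longrightarrow> prime q \<longrightarrow> p \<noteq> q \<longrightarrow> (\<forall>a\<in>K. shift p (adj q a) = adj q (shift p a))"
    interpret doubly_commuting K adj
      by unfold_locales (use comm in blast)
    show "\<exists>f\<in>seqs. orthonormal natm (\<lambda>n. shift n f) \<and> K = closed_span natm (\<lambda>n. shift n f)"
      using exists_orthonormal_generator[OF nonzero] coeffsD(1) by blast
  next
    assume "\<exists>f\<in>seqs. orthonormal natm (\<lambda>n. shift n f) \<and> K = closed_span natm (\<lambda>n. shift n f)"
    then show "\<forall>p q. prime p \<longrightarrow> prime q \<longrightarrow> p \<noteq> q \<longrightarrow> (\<forall>a\<in>K. shift p (adj q a) = adj q (shift p a))"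
      using commute_if_orthonormal_shifts by blast
  qed
  also have "\<dots> \<longleftrightarrow> (\<exists>\<phi>\<in>L2. orthonormal natm (\<lambda>n. shift n (sine_coeff \<phi>)) \<and>
      K = closed_span natm (\<lambda>n. shift n (sine_coeff \<phi>)))"
    unfolding L2_eq_lsq using exists_sine_coeff sine_coeff_seqs by metis
  also have "\<dots> \<longleftrightarrow> (\<exists>\<phi>\<in>L2. L2_orthonormal (dilation \<phi>) \<and> S_preimage I = L2_closed_span (dilation \<phi>))"
    by (intro bex_cong refl) (simp only: span_iff orthonormal_iff)
  finally show ?thesis unfolding commute_iff .
qed

end
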